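(* Let $k\ge2$, $\ell\ge1$ and $n=k+\ell+1$. For every vertex $(i,m)$ of $\Gamma^-_{-2\ell-2}$ and every positive integer $v$ such that $v\le\frac{m+2\ell+(-1)^{i+1}}{2}$, there is a unique (up to isomorphism) indecomposable rigid module $M_{v,m}^{(i)}$ in $\mathrm{CM}(B_{k,n})$ such that there is a triangle $$L_{i,m}\to L_{i,m-2v}\to M_{v,m}^{(i)}\to\tau L_{i,m}$$ in $\underline{\mathrm{CM}}(B_{k,n})$. Moreover, $M_{v,m}^{(i)}$ is the rank one module with $k$-subset $$I_{i,m}^{(v)}=\Big[\tfrac{i-m+1}{2},\tfrac{i-m+1}{2}+k-i-1\Big]\cup\Big[\tfrac{i-m+2v-1}{2}+k-i+1,\tfrac{i-m+2v-1}{2}+k\Big].$$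
   Context: The vertices of $\Gamma^-_{-2\ell-2}$ are the pairs $(i,m)$ with $1\le i\le k-1$ and $m\in\mathbb{Z}_{<0}$, $m\ge-2\ell-2$, such that $m$ is even if $i$ is odd and $m$ is odd if $i$ is even. Grassmannian cluster category: $Q_C$ is the quiver with vertex set $\mathbb{Z}_n$ and arrows $x_i:i-1\to i$, $y_i:i\to i-1$; $B_{k,n}$ is the quotient of the complete path algebra $\widehat{\mathbb{C}Q_C}$ by the relations $xy=yx$, $x^k=y^{n-k}$ (at every vertex, with appropriate subscripts), with center $Z=\mathbb{C}[[t]]$, $t=\sum x_iy_i$. $\mathrm{CM}(B_{k,n})$ is the Frobenius category of $B_{k,n}$-modules which are free of finite rank over $Z$; its stable category $\underline{\mathrm{CM}}(B_{k,n})$ is a 2-Calabi–Yau triangulated category, and $\tau$ is its Auslander–Reiten translation (which coincides with the suspension functor). $N$ is rigid if $\mathrm{Ext}^1(N,N)=0$. The rank one module with $k$-subset $I\subset[n]$ is $L_I$: it has $\mathbb{C}[[t]]$ at each vertex, $x_i$ acts by $1$ if $i\in I$ and by $t$ otherwise, $y_i$ acts by $t$ if $i\in I$ and by $1$ otherwise. Let $\xi'(i)=0$ if $i$ is even and $\xi'(i)=-1$ if $i$ is odd. $L_{i,m}$ is the rank one module with $k$-subset $$J_{i,m}=\Big[\tfrac{i-\xi'(i)}{2},\tfrac{i-\xi'(i)}{2}+k-i-1\Big]\cup\Big[\tfrac{i-m-1}{2}+k-i+1,\tfrac{i-m-1}{2}+k\Big].$$ In all these formulas, intervals of integers $[a,b]=\{a,a+1,\dots,b\}$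 are taken modulo $n$ (they wrap around cyclically in $\{1,\dots,n\}$). *)

theory Defs
  imports "Jordan_Normal_Form.Matrix" "HOL-Computational_Algebra.Formal_Power_Series"
begin

(* The ring Z = C[[t]] is complex fps, with t = fps_X.

   A B_{k,n}-module that is free of finite rank over Z is a representation of the quiver Q_C by
   finitely generated free Z-modules (e_j M is a direct summand of M, hence free because Z is a
   principal ideal domain) and Z-linear maps satisfying the relations, on which the central
   element t = sum_i x_i y_i acts as the scalar t.  Choosing a Z-basis of each e_j M, such a module
   is recorded as e_j M = Z^(rk M j) together with the matrices of the x_j and y_j, acting on column
   vectors; a path is the product of its arrows read from right to left.

   The vertex set Z_n is represented by {1..n}.  Families indexed by vertices are functions on int
   whose values outside {1..n} are irrelevant; they are compared with fam_eq. *)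

type_synonym zmat = "complex fps mat"
type_synonym fam = "int \<Rightarrow> zmat"

record bmod =
  rk :: "int \<Rightarrow> nat"
  xm :: fam    (* xm M j is x_j, from vertex j - 1 to vertex j *)
  ym :: fam    (* ym M j is y_j, from vertex j to vertex j - 1 *)

definition cyc :: "nat \<Rightarrow> int \<Rightarrow> int" where
  "cyc n j = (j - 1) mod int n + 1"

definition cyc_interval :: "nat \<Rightarrow> int \<Rightarrow> int \<Rightarrow> int set" where
  "cyc_interval n a b = cyc n ` {a..b}"

definition fcomp :: "fam \<Rightarrow> fam \<Rightarrow> fam" (infixr \<open>\<circ>\<^sub>f\<close> 70) where
  "(g \<circ>\<^sub>f f) = (\<lambda>j. g j * f j)"

definition fam_id :: "bmod \<Rightarrow> fam" where
  "fam_id M = (\<lambda>j. 1\<^sub>m (rk M j))"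

text \<open>A conflation starting at an object \<open>A\<close> and ending at an object \<open>S\<close>, recorded as
  \<open>(\<iota>, I, \<pi>, S)\<close>.\<close>
type_synonym conflation = "fam \<times> bmod \<times> fam \<times> bmod"

context
  fixes k n :: nat
begin

definition verts :: "int set" where
  "verts = {1..int n}"

abbreviation prv :: "int \<Rightarrow> int" where
  "prv j \<equiv> cyc n (j - 1)"

definition fam_eq :: "fam \<Rightarrow> fam \<Rightarrow> bool" where
  "fam_eq f g \<longleftrightarrow> (\<forall>j\<in>verts. f j = g j)"

(* The action of the paths x^p and y^p that start at the vertex j. *)
primrec xpath :: "bmod \<Rightarrow> int \<Rightarrow> nat \<Rightarrow> zmat" where
  "xpath M j 0 = 1\<^sub>m (rk M j)"
| "xpath M j (Suc p) = xm M (cyc n (j + int p + 1)) * xpath M j p"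

primrec ypath :: "bmod \<Rightarrow> int \<Rightarrow> nat \<Rightarrow> zmat" where
  "ypath M j 0 = 1\<^sub>m (rk M j)"
| "ypath M j (Suc p) = ym M (cyc n (j - int p)) * ypath M j p"

(* The objects of CM(B_{k,n}).  Both composites of x_j and y_j being the scalar t expresses
   xy = yx together with t = sum_i x_i y_i. *)
definition cm :: "bmod \<Rightarrow> bool" where
  "cm M \<longleftrightarrow> (\<forall>j\<in>verts.
      xm M j \<in> carrier_mat (rk M j) (rk M (prv j)) \<and>
      ym M j \<in> carrier_mat (rk M (prv j)) (rk M j) \<and>
      xm M j * ym M j = fps_X \<cdot>\<^sub>m 1\<^sub>m (rk M j) \<and>
      ym M j * xm M j = fps_X \<cdot>\<^sub>m 1\<^sub>m (rk M (prv j)) \<and>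
      xpath M j k = ypath M j (n - k))"

definition Hom :: "bmod \<Rightarrow> bmod \<Rightarrow> fam set" where
  "Hom M N = {f. \<forall>j\<in>verts.
      f j \<in> carrier_mat (rk N j) (rk M j) \<and>
      f j * xm M j = xm N j * f (prv j) \<and>
      f (prv j) * ym M j = ym N j * f j}"

definition isomorphic :: "bmod \<Rightarrow> bmod \<Rightarrow> bool" where
  "isomorphic M N \<longleftrightarrow> (\<exists>f\<in>Hom M N. \<exists>g\<in>Hom N M.
      fam_eq (g \<circ>\<^sub>f f) (fam_id M) \<and> fam_eq (f \<circ>\<^sub>f g) (fam_id N))"

definition is_zero :: "bmod \<Rightarrow> bool" where
  "is_zero M \<longleftrightarrow> (\<forall>j\<in>verts. rk M j = 0)"

definition dsum :: "bmod \<Rightarrow> bmod \<Rightarrow> bmod" where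
  "dsum M N = \<lparr> rk = \<lambda>j. rk M j + rk N j,
     xm = \<lambda>j. four_block_mat (xm M j) (0\<^sub>m (rk M j) (rk N (prv j)))
                              (0\<^sub>m (rk N j) (rk M (prv j))) (xm N j),
     ym = \<lambda>j. four_block_mat (ym M j) (0\<^sub>m (rk M (prv j)) (rk N j))
                              (0\<^sub>m (rk N (prv j)) (rk M j)) (ym N j) \<rparr>"

definition dsum_in :: "bmod \<Rightarrow> bmod \<Rightarrow> fam" where
  "dsum_in M N = (\<lambda>j. mat (rk M j + rk N j) (rk M j) (\<lambda>(r, c). if r = c then 1 else 0))"

definition dsum_out :: "bmod \<Rightarrow> bmod \<Rightarrow> fam" where
  "dsum_out M N = (\<lambda>j. mat (rk N j) (rk M j + rk N j) (\<lambda>(r, c). if c = rk M j + r then 1 else 0))"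

definition indecomposable :: "bmod \<Rightarrow> bool" where
  "indecomposable M \<longleftrightarrow> \<not> is_zero M \<and>
     (\<forall>M1 M2. cm M1 \<and> cm M2 \<and> isomorphic M (dsum M1 M2) \<longrightarrow> is_zero M1 \<or> is_zero M2)"

definition short_exact :: "bmod \<Rightarrow> fam \<Rightarrow> bmod \<Rightarrow> fam \<Rightarrow> bmod \<Rightarrow> bool" where
  "short_exact A f E g C \<longleftrightarrow> cm A \<and> cm E \<and> cm C \<and> f \<in> Hom A E \<and> g \<in> Hom E C \<and>
     (\<forall>j\<in>verts.
        inj_on (\<lambda>v. f j *\<^sub>v v) (carrier_vec (rk A j)) \<and>
        (\<lambda>v. f j *\<^sub>v v) ` carrier_vec (rk A j) =
          {v \<in> carrier_vec (rk E j). g j *\<^sub>v v = 0\<^sub>v (rk C j)} \<and>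
        (\<lambda>v. g j *\<^sub>v v) ` carrier_vec (rk E j) = carrier_vec (rk C j))"

(* Ext^1 as the set of Yoneda classes of extensions of C by A.  An extension of Z-free modules is
   Z-free, so it makes no difference whether the middle term is required to lie in CM. *)
definition yoneda_rel ::
    "bmod \<Rightarrow> bmod \<Rightarrow> ((fam \<times> bmod \<times> fam) \<times> (fam \<times> bmod \<times> fam)) set" where
  "yoneda_rel C A = {((f, E, g), (f', E', g')).
     short_exact A f E g C \<and> short_exact A f' E' g' C \<and>
     (\<exists>\<phi>\<in>Hom E E'. fam_eq (\<phi> \<circ>\<^sub>f f) f' \<and> fam_eq (g' \<circ>\<^sub>f \<phi>) g)}"

definition Ext1 :: "bmod \<Rightarrow> bmod \<Rightarrow> (fam \<times> bmod \<times> fam) set set" where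
  "Ext1 C A = {(f, E, g). short_exact A f E g C} // yoneda_rel C A"

definition Ext1_zero :: "bmod \<Rightarrow> bmod \<Rightarrow> (fam \<times> bmod \<times> fam) set" where
  "Ext1_zero C A = yoneda_rel C A `` {(dsum_in A C, dsum A C, dsum_out A C)}"

definition rigid :: "bmod \<Rightarrow> bool" where
  "rigid M \<longleftrightarrow> Ext1 M M = {Ext1_zero M M}"

definition projective :: "bmod \<Rightarrow> bool" where
  "projective P \<longleftrightarrow> cm P \<and> (\<forall>A f E g C. short_exact A f E g C \<longrightarrow>
     (\<forall>h\<in>Hom P C. \<exists>h'\<in>Hom P E. fam_eq (g \<circ>\<^sub>f h') h))"

definition injective :: "bmod \<Rightarrow> bool" where
  "injective I \<longleftrightarrow> cm I \<and> (\<forall>A f E g C. short_exact A f E g C \<longrightarrow>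
     (\<forall>h\<in>Hom A I. \<exists>h'\<in>Hom E I. fam_eq (h' \<circ>\<^sub>f f) h))"

(* Equality in the stable category of two morphisms f, g in Hom M N. *)
definition stable_eq :: "bmod \<Rightarrow> bmod \<Rightarrow> fam \<Rightarrow> fam \<Rightarrow> bool" where
  "stable_eq M N f g \<longleftrightarrow> (\<exists>P. projective P \<and>
     (\<exists>a\<in>Hom M P. \<exists>b\<in>Hom P N. fam_eq (\<lambda>j. f j - g j) (b \<circ>\<^sub>f a)))"

definition stable_iso :: "bmod \<Rightarrow> bmod \<Rightarrow> fam \<Rightarrow> bool" where
  "stable_iso M N f \<longleftrightarrow> f \<in> Hom M N \<and>
     (\<exists>g\<in>Hom N M. stable_eq M M (g \<circ>\<^sub>f f) (fam_id M) \<and> stable_eq N N (f \<circ>\<^sub>f g) (fam_id N))"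

(* 0 -> A -> I -> S -> 0 with I injective, exhibiting S as the suspension of A. *)
definition suspension :: "bmod \<Rightarrow> conflation \<Rightarrow> bool" where
  "suspension A D \<longleftrightarrow> (case D of (\<iota>, I, \<pi>, S) \<Rightarrow> injective I \<and> short_exact A \<iota> I \<pi> S)"

(* s represents the suspension of the morphism a, computed with the suspension data D and D'. *)
definition suspension_map :: "conflation \<Rightarrow> conflation \<Rightarrow> fam \<Rightarrow> fam \<Rightarrow> bool" where
  "suspension_map D D' a s \<longleftrightarrow> (case D of (\<iota>, I, \<pi>, S) \<Rightarrow> case D' of (\<iota>', I', \<pi>', S') \<Rightarrow>
     s \<in> Hom S S' \<and>
     (\<exists>e\<in>Hom I I'. fam_eq (e \<circ>\<^sub>f \<iota>) (\<iota>' \<circ>\<^sub>f a) \<and> fam_eq (s \<circ>\<^sub>f \<pi>) (\<pi>' \<circ>\<^sub>f e)))"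

(* Happel's standard triangle A -u-> B -v-> C -w-> S: the bottom row of the pushout diagram
     0 -> A -> I -> S -> 0
          |u   |    ||
     0 -> B -> C -> S -> 0 *)
definition standard_triangle ::
    "conflation \<Rightarrow> bmod \<Rightarrow> fam \<Rightarrow> bmod \<Rightarrow> fam \<Rightarrow> bmod \<Rightarrow> fam \<Rightarrow> bool" where
  "standard_triangle D A u B v C w \<longleftrightarrow> suspension A D \<and> u \<in> Hom A B \<and>
     (case D of (\<iota>, I, \<pi>, S) \<Rightarrow> short_exact B v C w S \<and>
        (\<exists>\<phi>\<in>Hom I C. fam_eq (\<phi> \<circ>\<^sub>f \<iota>) (v \<circ>\<^sub>f u) \<and> fam_eq (w \<circ>\<^sub>f \<phi>) \<pi>))"

(* A distinguished triangle A -u-> B -v-> C -w-> S of the stable category, where S is the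
   suspension of A given by D: a sextuple isomorphic to a standard triangle. *)
definition triangle ::
    "conflation \<Rightarrow> bmod \<Rightarrow> fam \<Rightarrow> bmod \<Rightarrow> fam \<Rightarrow> bmod \<Rightarrow> fam \<Rightarrow> bool" where
  "triangle D A u B v C w \<longleftrightarrow>
     suspension A D \<and> cm B \<and> cm C \<and> u \<in> Hom A B \<and> v \<in> Hom B C \<and>
     (case D of (\<iota>, I, \<pi>, S) \<Rightarrow> w \<in> Hom C S \<and>
       (\<exists>\<iota>' I' \<pi>' S' A' u' B' v' C' w' a b c s.
          standard_triangle (\<iota>', I', \<pi>', S') A' u' B' v' C' w' \<and> cm B' \<and> cm C' \<and>
          stable_iso A A' a \<and> stable_iso B B' b \<and> stable_iso C C' c \<and>
          suspension_map D (\<iota>', I', \<pi>', S') a s \<and>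
          stable_eq A B' (b \<circ>\<^sub>f u) (u' \<circ>\<^sub>f a) \<and>
          stable_eq B C' (c \<circ>\<^sub>f v) (v' \<circ>\<^sub>f b) \<and>
          stable_eq C S' (s \<circ>\<^sub>f w) (w' \<circ>\<^sub>f c)))"

(* There is a triangle A -> B -> C -> tau A; the Auslander-Reiten translation tau of the
   2-Calabi-Yau category is its suspension functor. *)
definition has_triangle :: "bmod \<Rightarrow> bmod \<Rightarrow> bmod \<Rightarrow> bool" where
  "has_triangle A B C \<longleftrightarrow> (\<exists>D u v w. triangle D A u B v C w)"

end

definition rank_one :: "int set \<Rightarrow> bmod" where
  "rank_one I = \<lparr> rk = \<lambda>j. 1,
     xm = \<lambda>j. if j \<in> I then 1\<^sub>m 1 else fps_X \<cdot>\<^sub>m 1\<^sub>m 1,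
     ym = \<lambda>j. if j \<in> I then fps_X \<cdot>\<^sub>m 1\<^sub>m 1 else 1\<^sub>m 1 \<rparr>"

definition Gamma_minus :: "nat \<Rightarrow> nat \<Rightarrow> (nat \<times> int) set" where
  "Gamma_minus k l = {(i, m). 1 \<le> i \<and> i \<le> k - 1 \<and> m < 0 \<and> m \<ge> - 2 * int l - 2 \<and>
     (odd i \<longrightarrow> even m) \<and> (even i \<longrightarrow> odd m)}"

definition xi' :: "nat \<Rightarrow> int" where
  "xi' i = (if even i then 0 else - 1)"

(* All divisions by 2 below are exact when (i, m) is a vertex of Gamma_minus k l. *)
definition Jset :: "nat \<Rightarrow> nat \<Rightarrow> nat \<Rightarrow> int \<Rightarrow> int set" where
  "Jset k n i m =
     cyc_interval n ((int i - xi' i) div 2) ((int i - xi' i) div 2 + int k - int i - 1) \<union>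
     cyc_interval n ((int i - m - 1) div 2 + int k - int i + 1) ((int i - m - 1) div 2 + int k)"

definition Iset :: "nat \<Rightarrow> nat \<Rightarrow> nat \<Rightarrow> int \<Rightarrow> nat \<Rightarrow> int set" where
  "Iset k n i m v =
     cyc_interval n ((int i - m + 1) div 2) ((int i - m + 1) div 2 + int k - int i - 1) \<union>
     cyc_interval n ((int i - m + 2 * int v - 1) div 2 + int k - int i + 1)
                    ((int i - m + 2 * int v - 1) div 2 + int k)"

definition Lmod :: "nat \<Rightarrow> nat \<Rightarrow> nat \<Rightarrow> int \<Rightarrow> bmod" where
  "Lmod k n i m = rank_one (Jset k n i m)"

end

theory Submission
  imports Defs "HOL-Library.Function_Algebras"
begin

text \<open>
  All modules in sight have \<open>k\<close>-subsets consisting of an interval \<open>X\<close> of length \<open>k - i\<close> and an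
  interval \<open>Y\<close> of length \<open>i\<close>; write \<open>L a b\<close> for the one in which they start after \<open>a\<close> and
  \<open>b + k - i\<close>. With \<open>N = n - k\<close> such a module exists for \<open>a \<le> b \<le> a + N\<close>, and it is projective
  (equivalently injective) if \<open>b\<close> is \<open>a\<close> or \<open>a + N\<close>. Moving an interval to the right gives a canonical
  monomorphism; these compose strictly, and for \<open>a \<le> a' \<le> b \<le> b' \<le> a + N\<close> they form an exact sequence
  \<open>0 \<rightarrow> L a b \<rightarrow> L a b' \<oplus> L a' b \<rightarrow> L a' b' \<rightarrow> 0\<close>. Injective hulls, projective covers and the
  required triangle \<open>L a b \<rightarrow> L a b' \<rightarrow> L b b'\<close> are all instances of it.

  For uniqueness let \<open>M\<close> be the cone of \<open>u : L a b \<rightarrow> L a b'\<close>, so \<open>u = z g\<close> with \<open>g\<close> canonical and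
  \<open>z \<in> \<complex>[[t]]\<close>. If \<open>M\<close> is rigid, every map \<open>L a b \<rightarrow> M\<close> factors stably through \<open>u\<close>. Apply this to
  \<open>L a b \<rightarrow> L a b' \<rightarrow> M\<close> with first map \<open>g\<close>: as there are no extensions of \<open>L a b'\<close> by \<open>L a b\<close>, it follows
  that \<open>g\<close> is stably a combination of \<open>u\<close> composed with endomorphisms, all of which are scalars. Since
  \<open>g\<close> is not stably a multiple of \<open>t g\<close>, the scalar \<open>z\<close> is a unit. Then \<open>L b b'\<close> is a direct summand of
  \<open>M\<close>, hence equal to it if \<open>M\<close> is indecomposable.
\<close>

section \<open>Finite matrices as a ring\<close>

text \<open>The sequence is exact because moving the first interval and moving the second one change
  the heights of the lattice path at disjoint sets of vertices: at each vertex one of the two maps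
  out of \<open>L a b\<close> is already invertible. The obstacle is that a triangle is given only
  up to stable isomorphism. \<open>M\<close> is stably the cone of some \<open>u : A' -> B'\<close>,
  where \<open>A'\<close> and \<open>B'\<close> need not have rank one, and each identity
  transported to \<open>L a b\<close> and \<open>L a b'\<close> carries an error that factors
  through a projective. Some errors are removed by extending them along monomorphisms, since
  projectives are injective. The others are measured by one fact: a multiple \<open>z\<close> of a
  canonical map in question factors through a projective only if t divides \<open>z\<close>. Indeed
  the projective cover of the target has two summands, and the height of each lies below that of the
  source at some vertex, which costs a factor t. The endomorphisms of \<open>L b b'\<close> are
  scalars in a local ring, so a scalar known only to be 1 modulo t is a unit. This is how a stable
  splitting becomes a splitting of modules.\<close>

text \<open>Matrices of all sizes are embedded in the nonunital ring of finitely supported infinite matrices,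
  and families of matrices in the ring of functions from vertices to it. Multiplication is then total
  and associative, and the identity of a module is an idempotent.\<close>

typedef (overloaded) 'a fmat =
  "{A :: nat \<Rightarrow> nat \<Rightarrow> 'a::zero. \<exists>N. \<forall>i j. N \<le> i \<or> N \<le> j \<longrightarrow> A i j = 0}"
  morphisms ent Abs_fmat
  by (rule exI[of _ "\<lambda>_ _. 0"]) simp

setup_lifting type_definition_fmat

lemma fmat_eqI: "(\<And>i j. ent A i j = ent B i j) \<Longrightarrow> A = B"
  by (metis ent_inject ext)

lemma ent_bound: "\<exists>N. \<forall>i j. N \<le> i \<or> N \<le> j \<longrightarrow> ent A i j = 0"
  using ent[of A] by simp

instantiation fmat :: (comm_ring_1) ring
begin

lift_definition zero_fmat :: "'a fmat" is "\<lambda>i j. 0" by simp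

lift_definition plus_fmat :: "'a fmat \<Rightarrow> 'a fmat \<Rightarrow> 'a fmat" is "\<lambda>A B i j. A i j + B i j"
proof -
  fix A B :: "nat \<Rightarrow> nat \<Rightarrow> 'a"
  assume "\<exists>N. \<forall>i j. N \<le> i \<or> N \<le> j \<longrightarrow> A i j = 0" "\<exists>N. \<forall>i j. N \<le> i \<or> N \<le> j \<longrightarrow> B i j = 0"
  then obtain N N' where "\<forall>i j. N \<le> i \<or> N \<le> j \<longrightarrow> A i j = 0"
    "\<forall>i j. N' \<le> i \<or> N' \<le> j \<longrightarrow> B i j = 0" by blast
  then show "\<exists>N. \<forall>i j. N \<le> i \<or> N \<le> j \<longrightarrow> A i j + B i j = 0"
    by (intro exI[of _ "max N N'"]) auto
qed

lift_definition uminus_fmat :: "'a fmat \<Rightarrow> 'a fmat" is "\<lambda>A i j. - A i j" by simp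

definition minus_fmat :: "'a fmat \<Rightarrow> 'a fmat \<Rightarrow> 'a fmat" where
  "minus_fmat A B = A + - B"

text \<open>The sum runs over the support of a row of the left factor, which is finite, so no bound
  has to be chosen. \<open>ent_times\<close> replaces the support by any bound beyond which the
  summands vanish.\<close>

lift_definition times_fmat :: "'a fmat \<Rightarrow> 'a fmat \<Rightarrow> 'a fmat"
  is "\<lambda>A B i j. \<Sum>l | A i l \<noteq> 0. A i l * B l j"
proof -
  fix A B :: "nat \<Rightarrow> nat \<Rightarrow> 'a"
  assume "\<exists>N. \<forall>i j. N \<le> i \<or> N \<le> j \<longrightarrow> A i j = 0" "\<exists>N. \<forall>i j. N \<le> i \<or> N \<le> j \<longrightarrow> B i j = 0"
  then obtain N N' where "\<forall>i j. N \<le> i \<or> N \<le> j \<longrightarrow> A i j = 0"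
    "\<forall>i j. N' \<le> i \<or> N' \<le> j \<longrightarrow> B i j = 0" by blast
  then show "\<exists>N. \<forall>i j. N \<le> i \<or> N \<le> j \<longrightarrow> (\<Sum>l | A i l \<noteq> 0. A i l * B l j) = 0"
    by (intro exI[of _ "max N N'"]) (auto intro!: sum.neutral)
qed

lemma ent_times:
  assumes "\<And>l. N \<le> l \<Longrightarrow> ent A i l = 0 \<or> ent B l j = 0"
  shows "ent (A * B) i j = (\<Sum>l<N. ent A i l * ent B l j)"
proof -
  obtain N0 where N0: "\<forall>i j. N0 \<le> i \<or> N0 \<le> j \<longrightarrow> ent A i j = 0" using ent_bound by blast
  have "ent (A * B) i j = (\<Sum>l | ent A i l \<noteq> 0. ent A i l * ent B l j)"
    by (simp add: times_fmat.rep_eq)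
  also have "\<dots> = (\<Sum>l<max N N0. ent A i l * ent B l j)"
    using N0 by (intro sum.mono_neutral_left) (auto simp: not_le[symmetric])
  also have "\<dots> = (\<Sum>l<N. ent A i l * ent B l j)"
  proof (intro sum.mono_neutral_right ballI)
    fix l assume "l \<in> {..<max N N0} - {..<N}"
    then show "ent A i l * ent B l j = 0" using assms[of l] by auto
  qed (use N0 in \<open>auto intro: le_less_trans\<close>)
  finally show ?thesis .
qed

instance
proof
  fix A B C :: "'a fmat"
  obtain N1 N2 N3 where *: "\<forall>i j. N1 \<le> i \<or> N1 \<le> j \<longrightarrow> ent A i j = 0"
    "\<forall>i j. N2 \<le> i \<or> N2 \<le> j \<longrightarrow> ent B i j = 0" "\<forall>i j. N3 \<le> i \<or> N3 \<le> j \<longrightarrow> ent C i j = 0"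
    using ent_bound by metis
  define N where "N = max N1 (max N2 N3)"
  have b: "N \<le> i \<or> N \<le> j \<Longrightarrow> ent A i j = 0" "N \<le> i \<or> N \<le> j \<Longrightarrow> ent B i j = 0"
    "N \<le> i \<or> N \<le> j \<Longrightarrow> ent C i j = 0" for i j
    using * by (auto simp: N_def)
  have AB: "ent (A * B) i j = (\<Sum>l<N. ent A i l * ent B l j)" for i j
    by (intro ent_times) (auto simp: b)
  have bc: "ent (B * C) i j = (\<Sum>l<N. ent B i l * ent C l j)" for i j
    by (intro ent_times) (auto simp: b)
  show "A * B * C = A * (B * C)"
  proof (rule fmat_eqI)
    fix i j
    have "ent (A * B * C) i j = (\<Sum>l<N. ent (A * B) i l * ent C l j)"
      by (intro ent_times) (auto simp: b)
    also have "\<dots> = (\<Sum>l<N. \<Sum>l'<N. ent A i l' * ent B l' l * ent C l j)"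
      by (simp add: AB sum_distrib_right)
    also have "\<dots> = (\<Sum>l'<N. \<Sum>l<N. ent A i l' * ent B l' l * ent C l j)"
      by (rule sum.swap)
    also have "\<dots> = (\<Sum>l'<N. ent A i l' * ent (B * C) l' j)"
      by (simp add: bc sum_distrib_left mult.assoc)
    also have "\<dots> = ent (A * (B * C)) i j"
      by (intro ent_times[symmetric]) (auto simp: b)
    finally show "ent (A * B * C) i j = ent (A * (B * C)) i j" .
  qed
  have e: "ent (A + B) i j = ent A i j + ent B i j" "ent (B + C) i j = ent B i j + ent C i j" for i j
    by (simp_all add: plus_fmat.rep_eq)
  show "(A + B) * C = A * C + B * C"
  proof (rule fmat_eqI)
    fix i j
    have "ent (A * C + B * C) i j = ent (A * C) i j + ent (B * C) i j" by (rule plus_fmat.rep_eq[THEN fun_cong, THEN fun_cong])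
    then show "ent ((A + B) * C) i j = ent (A * C + B * C) i j"
      by (simp add: ent_times[of N] b e distrib_right sum.distrib)
  qed
  show "A * (B + C) = A * B + A * C"
  proof (rule fmat_eqI)
    fix i j
    have "ent (A * B + A * C) i j = ent (A * B) i j + ent (A * C) i j" by (rule plus_fmat.rep_eq[THEN fun_cong, THEN fun_cong])
    then show "ent (A * (B + C)) i j = ent (A * B + A * C) i j"
      by (simp add: ent_times[of N] b e distrib_left sum.distrib)
  qed
  show "A + B + C = A + (B + C)" by (rule fmat_eqI) (simp add: plus_fmat.rep_eq add.assoc)
  show "A + B = B + A" by (rule fmat_eqI) (simp add: plus_fmat.rep_eq add.commute)
  show "0 + A = A" by (rule fmat_eqI) (simp add: plus_fmat.rep_eq zero_fmat.rep_eq)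
  show "- A + A = 0"
    by (rule fmat_eqI) (simp add: plus_fmat.rep_eq zero_fmat.rep_eq uminus_fmat.rep_eq)
  show "A - B = A + - B" by (simp add: minus_fmat_def)
qed

end

lemma ent_simps [simp]:
  "ent 0 i j = 0" "ent (A + B) i j = ent A i j + ent B i j" "ent (- A) i j = - ent A i j"
  "ent (A - B) i j = ent A i j - ent B i j"
  for A B :: "'a::comm_ring_1 fmat"
proof -
  show "ent (0 :: 'b::comm_ring_1 fmat) i j = 0" by (simp add: zero_fmat.rep_eq)
  show "ent (A + B) i j = ent A i j + ent B i j" by (simp add: plus_fmat.rep_eq)
  show "ent (- A) i j = - ent A i j" by (simp add: uminus_fmat.rep_eq)
  show "ent (A - B) i j = ent A i j - ent B i j"
    unfolding minus_fmat_def plus_fmat.rep_eq uminus_fmat.rep_eq by simp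
qed

lift_definition idn :: "nat \<Rightarrow> 'a::comm_ring_1 fmat" is "\<lambda>N i j. if i = j \<and> i < N then 1 else 0"
proof -
  fix N :: nat
  show "\<exists>N'. \<forall>i j. N' \<le> i \<or> N' \<le> j \<longrightarrow> (if i = j \<and> i < N then 1 else 0 :: 'a) = 0"
    by (rule exI[of _ N]) auto
qed

lift_definition munit :: "nat \<Rightarrow> nat \<Rightarrow> 'a::comm_ring_1 fmat"
  is "\<lambda>r c i j. if i = r \<and> j = c then 1 else 0"
proof -
  fix r c :: nat
  show "\<exists>N. \<forall>i j. N \<le> i \<or> N \<le> j \<longrightarrow> (if i = r \<and> j = c then 1 else 0 :: 'a) = 0"
    by (rule exI[of _ "Suc (max r c)"]) auto
qed

lift_definition scal :: "'a \<Rightarrow> 'a::comm_ring_1 fmat \<Rightarrow> 'a fmat" is "\<lambda>a A i j. a * A i j"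
proof -
  fix a :: 'a and A :: "nat \<Rightarrow> nat \<Rightarrow> 'a"
  assume "\<exists>N. \<forall>i j. N \<le> i \<or> N \<le> j \<longrightarrow> A i j = 0"
  then obtain N where "\<forall>i j. N \<le> i \<or> N \<le> j \<longrightarrow> A i j = 0" by blast
  then show "\<exists>N. \<forall>i j. N \<le> i \<or> N \<le> j \<longrightarrow> a * A i j = 0"
    by (intro exI[of _ N]) auto
qed

lift_definition emb :: "'a mat \<Rightarrow> 'a::comm_ring_1 fmat"
  is "\<lambda>A i j. if i < dim_row A \<and> j < dim_col A then A $$ (i, j) else 0"
proof -
  fix A :: "'a mat"
  show "\<exists>N. \<forall>i j. N \<le> i \<or> N \<le> j \<longrightarrow> (if i < dim_row A \<and> j < dim_col A then A $$ (i, j) else 0) = 0"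
    by (rule exI[of _ "max (dim_row A) (dim_col A)"]) auto
qed

definition unemb :: "nat \<Rightarrow> nat \<Rightarrow> 'a::comm_ring_1 fmat \<Rightarrow> 'a mat" where
  "unemb r c A = mat r c (\<lambda>(i, j). ent A i j)"

lemma ent_idn: "ent (idn N) i j = (if i = j \<and> i < N then 1 else 0)"
  and ent_munit: "ent (munit r c) i j = (if i = r \<and> j = c then 1 else 0)"
  and ent_scal [simp]: "ent (scal a A) i j = a * ent A i j"
  and ent_emb: "ent (emb B) i j = (if i < dim_row B \<and> j < dim_col B then B $$ (i, j) else 0)"
  by (simp_all add: idn.rep_eq munit.rep_eq scal.rep_eq emb.rep_eq)

lemma ent_times_single:
  assumes "\<And>l. l \<noteq> p \<Longrightarrow> ent A i l = 0 \<or> ent B l j = 0"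
  shows "ent (A * B) i j = ent A i p * ent B p j"
proof -
  have "ent (A * B) i j = (\<Sum>l<Suc p. ent A i l * ent B l j)"
    by (rule ent_times) (use assms in auto)
  also have "\<dots> = (\<Sum>l\<in>{p}. ent A i l * ent B l j)"
  proof (rule sum.mono_neutral_right)
    show "\<forall>l\<in>{..<Suc p} - {p}. ent A i l * ent B l j = 0"
    proof
      fix l assume "l \<in> {..<Suc p} - {p}"
      then show "ent A i l * ent B l j = 0" using assms[of l] by auto
    qed
  qed auto
  finally show ?thesis by simp
qed

lemma ent_idn_mult [simp]: "ent (idn N * A) i j = (if i < N then ent A i j else 0)"
  using ent_times_single[of i "idn N" i A j] by (simp add: ent_idn)

lemma ent_mult_idn [simp]: "ent (A * idn N) i j = (if j < N then ent A i j else 0)"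
  using ent_times_single[of j A i "idn N" j] by (simp add: ent_idn)

lemma ent_munit_mult [simp]: "ent (munit r c * A) i j = (if i = r then ent A c j else 0)"
  using ent_times_single[of c "munit r c" i A j] by (simp add: ent_munit)

lemma ent_mult_munit [simp]: "ent (A * munit r c) i j = (if j = c then ent A i r else 0)"
  using ent_times_single[of r A i "munit r c" j] by (simp add: ent_munit)

lemma scal_mult_left: "scal a A * B = scal a (A * B)"
proof (rule fmat_eqI)
  fix i j
  obtain N where "\<forall>i j. N \<le> i \<or> N \<le> j \<longrightarrow> ent A i j = 0" using ent_bound by blast
  then show "ent (scal a A * B) i j = ent (scal a (A * B)) i j"
    by (simp add: ent_times[of N] sum_distrib_left mult.assoc)
qed

lemma scal_mult_right: "A * scal a B = scal a (A * B)"
proof (rule fmat_eqI)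
  fix i j
  obtain N where "\<forall>i j. N \<le> i \<or> N \<le> j \<longrightarrow> ent A i j = 0" using ent_bound by blast
  then show "ent (A * scal a B) i j = ent (scal a (A * B)) i j"
    by (simp add: ent_times[of N] sum_distrib_left mult.left_commute)
qed

lemma idn_mult_idn [simp]: "idn N * idn N' = idn (min N N')"
  by (rule fmat_eqI) (simp add: ent_idn)

lemma idn_mult_munit [simp]: "idn N * munit i j = (if i < N then munit i j else 0)"
  by (rule fmat_eqI) (auto simp: ent_munit ent_idn)

lemma munit_mult_idn [simp]: "munit i j * idn N = (if j < N then munit i j else 0)"
  by (rule fmat_eqI) (auto simp: ent_munit ent_idn)

lemma munit_mult_munit [simp]: "munit i j * munit l m = (if j = l then munit i m else 0)"
  by (rule fmat_eqI) (auto simp: ent_munit)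

lemma idn_Suc: "idn (Suc N) = idn N + munit N N"
  by (rule fmat_eqI) (auto simp: ent_idn ent_munit)

lemma idn_0 [simp]: "idn 0 = 0"
  by (rule fmat_eqI) (simp add: ent_idn)

lemma emb_mult: "dim_col A = dim_row B \<Longrightarrow> emb (A * B) = emb A * emb B"
proof (rule fmat_eqI)
  fix i j assume d: "dim_col A = dim_row B"
  have "ent (emb A * emb B) i j = (\<Sum>l<dim_col A. ent (emb A) i l * ent (emb B) l j)"
    by (rule ent_times) (simp add: ent_emb)
  then show "ent (emb (A * B)) i j = ent (emb A * emb B) i j"
    by (auto simp: ent_emb d scalar_prod_def lessThan_atLeast0)
qed

lemma emb_idn: "emb (1\<^sub>m N) = idn N"
  by (rule fmat_eqI) (auto simp: ent_emb ent_idn)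

lemma emb_smult: "emb (a \<cdot>\<^sub>m A) = scal a (emb A)"
  by (rule fmat_eqI) (auto simp: ent_emb)

lemma emb_minus: "A \<in> carrier_mat r c \<Longrightarrow> B \<in> carrier_mat r c \<Longrightarrow> emb (A - B) = emb A - emb B"
  by (rule fmat_eqI) (auto simp: ent_emb)

lemma emb_carrier: "A \<in> carrier_mat r c \<Longrightarrow> idn r * emb A = emb A"
  "A \<in> carrier_mat r c \<Longrightarrow> emb A * idn c = emb A"
  by (rule fmat_eqI; auto simp: ent_emb)+

lemma emb_inject:
  assumes "A \<in> carrier_mat r c" "B \<in> carrier_mat r c" "emb A = emb B"
  shows "A = B"
proof (rule eq_matI)
  fix i j assume "i < dim_row B" "j < dim_col B"
  moreover have "ent (emb A) i j = ent (emb B) i j" using assms by simp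
  ultimately show "A $$ (i, j) = B $$ (i, j)" using assms(1,2) by (auto simp: ent_emb)
qed (use assms in auto)

lemma unemb_carrier [simp]: "unemb r c A \<in> carrier_mat r c"
  "dim_row (unemb r c A) = r" "dim_col (unemb r c A) = c"
  by (auto simp: unemb_def)

lemma emb_unemb:
  assumes "idn r * A = A" "A * idn c = A"
  shows "emb (unemb r c A) = A"
proof (rule fmat_eqI)
  fix i j
  have "ent A i j = (if i < r then ent A i j else 0)" "ent A i j = (if j < c then ent A i j else 0)"
    using ent_idn_mult[of r A i j] ent_mult_idn[of A c i j] unfolding assms by auto
  then have "r \<le> i \<or> c \<le> j \<Longrightarrow> ent A i j = 0"
    by (meson not_less)
  then show "ent (emb (unemb r c A)) i j = ent A i j"
    by (simp add: ent_emb unemb_def not_less[symmetric])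
qed

text \<open>Over a local ring a unimodular row can be completed to a basis: if \<open>g\<close> has a unit entry at
  \<open>i\<close>, clearing with it turns \<open>idn N - h * g\<close> into a projection onto the other coordinates.\<close>

lemma split_row:
  fixes g h :: "complex fps fmat"
  assumes g: "idn (Suc 0) * g = g" "g * idn N = g" and h: "idn N * h = h" "h * idn (Suc 0) = h"
    and gh: "g * h = idn (Suc 0)"
  shows "\<exists>m V W. idn m * V = V \<and> V * idn N = V \<and> idn N * W = W \<and> W * idn m = W \<and>
           V * W = idn m \<and> W * V = idn N - h * g"
proof -
  have g0: "ent g r l = 0" if "r \<noteq> 0 \<or> N \<le> l" for r l
  proof -
    have "ent g r l = ent (idn (Suc 0) * g) r l" "ent g r l = ent (g * idn N) r l" using g by simp_all
    then show ?thesis using that by auto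
  qed
  have "(\<Sum>l<N. ent g 0 l * ent h l 0) = ent (g * h) 0 0"
    by (rule ent_times[symmetric]) (simp add: g0)
  also have "\<dots> = 1" by (simp add: gh ent_idn)
  finally have "(\<Sum>l<N. fps_nth (ent g 0 l * ent h l 0) 0) \<noteq> 0"
    by (metis fps_sum_nth fps_one_nth zero_neq_one)
  \<comment> \<open>The constant terms in \<open>g * h = 1\<close> add up to 1, so some entry of
    \<open>g\<close> has a nonzero constant term and is a unit. Here it matters that power series
    form a local ring.\<close>
  then obtain i where i: "i < N" "fps_nth (ent g 0 i) 0 \<noteq> 0"
    by (metis (no_types, lifting) fps_mult_nth_0 lessThan_iff mult_eq_0_iff sum.neutral)
  define c where "c = inverse (ent g 0 i)"
  have c: "c * ent g 0 i = 1" unfolding c_def using i by (intro inverse_mult_eq_1)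
  define m where "m = N - 1"
  have Nm: "N = Suc m" using i by (simp add: m_def)
  \<comment> \<open>\<open>s'\<close> includes the \<open>m\<close> coordinates other than
    \<open>i\<close>, the last one being renumbered as \<open>i\<close>; \<open>s\<close> is the
    projection back.\<close>
  define s :: "complex fps fmat" where "s = (if i = m then idn m else idn m - munit i i + munit i m)"
  define s' :: "complex fps fmat" where "s' = (if i = m then idn m else idn m - munit i i + munit m i)"
  have im: "i < m" if "i \<noteq> m" using i that by (simp add: Nm)
  have ss: "s * s' = idn m" "s' * s = idn N - munit i i"
    "idn m * s = s" "s * idn N = s" "idn N * s' = s'" "s' * idn m = s'" "s * munit i 0 = 0"
    using im by (auto simp: s_def s'_def algebra_simps Nm idn_Suc)
  define b :: "complex fps fmat" where "b = munit i 0"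
  have gb: "scal c (g * b) = idn (Suc 0)"
    by (rule fmat_eqI) (auto simp: b_def ent_idn c g0)
  have idb: "idn N * b = b" "b * idn (Suc 0) = b" using i by (simp_all add: b_def)
  have bb: "b * munit 0 i = munit i i" by (simp add: b_def)
  define f :: "complex fps fmat" where "f = idn N - munit i i"
  \<comment> \<open>\<open>K\<close> projects onto the kernel of \<open>g\<close> along coordinate
    \<open>i\<close>, and \<open>u\<close> does so along \<open>h\<close>. Having the same image
    they satisfy \<open>K * u = u\<close> and \<open>u * K = K\<close>, so the coordinates other
    than \<open>i\<close> parametrise the kernel.\<close>
  define K where "K = f - scal c (b * (g * f))"
  define u where "u = idn N - h * g"
  have gu: "g * u = 0" by (simp add: u_def algebra_simps g) (simp add: mult.assoc[symmetric] gh g)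
  have iu: "idn N * u = u" by (simp add: u_def algebra_simps) (simp add: mult.assoc[symmetric] h)
  have ui: "u * idn N = u" by (simp add: u_def algebra_simps g)
  have gK: "g * K = 0"
  proof -
    have "g * scal c (b * (g * f)) = scal c (g * b) * (g * f)"
      by (simp add: scal_mult_left scal_mult_right mult.assoc)
    also have "\<dots> = g * f" by (simp add: gb mult.assoc[symmetric] g)
    finally show ?thesis by (simp add: K_def algebra_simps)
  qed
  have sf: "s * f = s" "f * s' = s'"
    using ss(3-7) im by (auto simp: f_def algebra_simps s'_def s_def Nm)
  have sb: "s * b = 0" using ss by (simp add: b_def)
  have sK: "s * K = s"
    by (simp add: K_def right_diff_distrib sf scal_mult_right mult.assoc[symmetric] sb)
       (simp add: fmat_eqI)
  have Kf: "K * f = K"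
  proof -
    have "f * f = f" using i by (simp add: f_def algebra_simps)
    then show ?thesis by (simp add: K_def left_diff_distrib scal_mult_left mult.assoc)
  qed
  have Ku: "K * u = u"
  proof -
    have "g * f * u = g * (idn N * u) - g * munit i i * u" by (simp add: f_def algebra_simps)
    also have "\<dots> = - (g * b * (munit 0 i * u))" by (simp add: iu gu bb[symmetric] mult.assoc)
    finally have "scal c (b * (g * f * u)) = - (b * (scal c (g * b) * (munit 0 i * u)))"
      by (simp add: scal_mult_left scal_mult_right) (rule fmat_eqI; simp)
    also have "\<dots> = - (munit i i * u)" using idb bb by (simp add: gb mult.assoc[symmetric])
    finally have "K * u = f * u + munit i i * u"
      by (simp add: K_def left_diff_distrib scal_mult_left mult.assoc)
    then show ?thesis by (simp add: f_def left_diff_distrib iu)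
  qed
  define V where "V = s * u"
  define W where "W = K * s'"
  have uK: "u * K = K" by (simp add: u_def left_diff_distrib mult.assoc gK)
    (simp add: K_def right_diff_distrib f_def scal_mult_right mult.assoc[symmetric] idb i)
  have "V * W = s * (u * K) * s'" by (simp add: V_def W_def mult.assoc)
  then have "V * W = idn m" by (simp add: uK sK ss)
  moreover have "W * V = K * (s' * s) * u" by (simp add: V_def W_def mult.assoc)
  then have "W * V = u" by (simp add: ss(2) f_def[symmetric] Kf Ku)
  moreover have "idn m * V = V" "V * idn N = V" "W * idn m = W"
    by (simp_all add: V_def W_def mult.assoc ui ss) (simp add: mult.assoc[symmetric] ss)
  moreover have "idn N * W = W"
    unfolding W_def mult.assoc[symmetric]
    by (simp add: K_def right_diff_distrib f_def scal_mult_right mult.assoc[symmetric] idb i)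
  ultimately show ?thesis
    by (intro exI[of _ m] exI[of _ V] exI[of _ W]) (simp add: u_def)
qed

text \<open>Induction on the rows of \<open>G\<close>. The last row \<open>g\<close> has the section
  \<open>h\<close>, and \<open>split_row\<close> makes its kernel free of rank \<open>m1\<close>.
  Restricted to this kernel the other rows still form a split epimorphism, because
  \<open>idn r * G\<close> vanishes on the image of \<open>h * g\<close>. The result supplies
  kernels with the bases that a module record requires.\<close>

lemma split_epi:
  fixes G H :: "complex fps fmat"
  assumes "idn r * G = G" "G * idn N = G" "idn N * H = H" "H * idn r = H" "G * H = idn r"
  shows "\<exists>m V W. idn m * V = V \<and> V * idn N = V \<and> idn N * W = W \<and> W * idn m = W \<and>
           V * W = idn m \<and> W * V = idn N - H * G"
  using assms
proof (induction r arbitrary: G H N)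
  case 0
  have "G = 0" using 0(1) by simp
  then show ?case by (intro exI[of _ N] exI[of _ "idn N"]) simp
next
  case (Suc r)
  note GH = Suc.prems
  define g where "g = munit 0 r * G"
  define h where "h = H * munit r 0"
  have "g * h = munit 0 r * (G * H) * munit r 0" by (simp add: g_def h_def mult.assoc)
  also have "\<dots> = idn (Suc 0)" by (simp add: GH(5) idn_Suc distrib_left distrib_right)
  finally have gh: "g * h = idn (Suc 0)" .
  obtain m1 V1 W1 where 1: "idn m1 * V1 = V1" "V1 * idn N = V1" "idn N * W1 = W1" "W1 * idn m1 = W1"
    "V1 * W1 = idn m1" "W1 * V1 = idn N - h * g"
    using split_row[of g N h] gh GH
    by (auto simp: g_def h_def mult.assoc) (auto simp: mult.assoc[symmetric])
  define G2 where "G2 = idn r * G * W1"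
  define H2 where "H2 = V1 * H * idn r"
  have hg: "h * g = H * munit r r * G" by (simp add: h_def g_def mult.assoc)
    (simp add: mult.assoc[symmetric])
  have a: "h * g * H * idn r = 0"
  proof -
    have "h * g * H * idn r = H * (munit r r * (G * H) * idn r)" by (simp add: hg mult.assoc)
    then show ?thesis by (simp add: GH)
  qed
  have b: "idn r * G * (h * g) = 0"
  proof -
    have "idn r * G * (h * g) = (idn r * (G * H) * munit r r) * G" by (simp add: hg mult.assoc)
    then show ?thesis by (simp add: GH)
  qed
  have WVH: "W1 * V1 * H * idn r = H * idn r"
    using a by (simp add: 1 left_diff_distrib GH)
  have GWV: "idn r * G * (W1 * V1) = idn r * G"
    using b by (simp add: 1 right_diff_distrib GH mult.assoc)
  have "G2 * H2 = idn r * G * (W1 * V1 * H * idn r)" by (simp add: G2_def H2_def mult.assoc)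
  also have "\<dots> = idn r * (G * H) * idn r" by (simp add: WVH) (simp add: mult.assoc)
  finally have G2H2: "G2 * H2 = idn r" by (simp add: GH)
  have "idn r * G2 = G2" unfolding G2_def mult.assoc[symmetric] by simp
  moreover have "G2 * idn m1 = G2" unfolding G2_def by (simp add: mult.assoc 1)
  moreover have "idn m1 * H2 = H2" unfolding H2_def mult.assoc[symmetric] by (simp add: 1)
  moreover have "H2 * idn r = H2" unfolding H2_def by (simp add: mult.assoc)
  ultimately obtain m V2 W2 where 2: "idn m * V2 = V2" "V2 * idn m1 = V2" "idn m1 * W2 = W2" "W2 * idn m = W2"
    "V2 * W2 = idn m" "W2 * V2 = idn m1 - H2 * G2"
    using Suc.IH[of G2 m1 H2] G2H2 by blast
  define V where "V = V2 * V1"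
  define W where "W = W1 * W2"
  have "V * W = V2 * (V1 * W1) * W2" by (simp add: V_def W_def mult.assoc)
  then have VW: "V * W = idn m" by (simp add: 1 2)
  have "W1 * H2 = H * idn r" unfolding H2_def mult.assoc[symmetric] by (rule WVH)
  moreover have "G2 * V1 = idn r * G" using GWV by (simp add: G2_def mult.assoc)
  moreover
  have "W * V = W1 * (idn m1 - H2 * G2) * V1"
    by (simp add: V_def W_def mult.assoc 2(6)[symmetric])
  then have "W * V = W1 * V1 - (W1 * H2) * (G2 * V1)"
    by (simp add: right_diff_distrib left_diff_distrib 1(4)) (simp add: mult.assoc)
  ultimately have "W * V = idn N - h * g - H * idn r * (idn r * G)" by (simp only: 1(6))
  then have "W * V = idn N - H * munit r r * G - H * (idn r * idn r) * G"
    by (simp only: hg mult.assoc)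
  then have "W * V = idn N - H * (idn (Suc r)) * G"
    by (simp add: idn_Suc algebra_simps)
  then have "W * V = idn N - H * G" by (simp add: GH)
  moreover note VW
  moreover have "idn m * V = V" "V * idn N = V" "idn N * W = W" "W * idn m = W"
    unfolding V_def W_def by (simp_all add: mult.assoc 1 2) (simp_all add: mult.assoc[symmetric] 1 2)
  ultimately show ?case
    by (intro exI[of _ m] exI[of _ V] exI[of _ W]) simp
qed

section \<open>Modules and homomorphisms\<close>

type_synonym zfam = "int \<Rightarrow> complex fps fmat"

definition sc :: "complex fps \<Rightarrow> zfam \<Rightarrow> zfam" where
  "sc a F = (\<lambda>j. scal a (F j))"

lemma sc_apply [simp]: "sc a F j = scal a (F j)"
  by (simp add: sc_def)

lemma scal_ring:
  "scal a (A + B) = scal a A + scal a B" "scal a (A - B) = scal a A - scal a B"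
  "scal a (- A) = - scal a A" "scal a 0 = 0" "scal 1 A = A" "scal 0 A = 0"
  "scal a (scal b A) = scal (a * b) A" "scal (a + b) A = scal a A + scal b A"
  "scal (a - b) A = scal a A - scal b A"
  for A B :: "'a::comm_ring_1 fmat"
  by (rule fmat_eqI; simp add: algebra_simps)+

lemma sc_ring:
  "sc a (F + G) = sc a F + sc a G" "sc a (F - G) = sc a F - sc a G" "sc a (- F) = - sc a F"
  "sc a 0 = 0" "sc 1 F = F" "sc 0 F = 0" "sc a (sc b F) = sc (a * b) F"
  "sc (a + b) F = sc a F + sc b F" "sc (a - b) F = sc a F - sc b F"
  by (rule ext; simp add: scal_ring)+

lemma sc_mult_left: "sc a F * G = sc a (F * G)"
  and sc_mult_right: "F * sc a G = sc a (F * G)"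
  by (rule ext; simp add: scal_mult_left scal_mult_right)+

lemma scal_cancel: "a \<noteq> 0 \<Longrightarrow> scal a A = scal a B \<longleftrightarrow> A = B" for A :: "complex fps fmat"
proof
  assume a: "a \<noteq> 0" and *: "scal a A = scal a B"
  show "A = B"
  proof (rule fmat_eqI)
    fix i j have "ent (scal a A) i j = ent (scal a B) i j" by (simp only: *)
    then show "ent A i j = ent B i j" using a by simp
  qed
qed simp

lemma sc_cancel: "a \<noteq> 0 \<Longrightarrow> sc a F = sc a G \<longleftrightarrow> F = G"
  by (metis scal_cancel ext sc_apply)

locale quiver =
  fixes k n :: nat
  assumes k_pos: "0 < k" and k_less: "k < n"
begin

abbreviation "V \<equiv> verts n"
abbreviation "c \<equiv> cyc n"

lemma n_pos: "0 < int n" using k_less by simp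

lemma cyc_in [simp]: "c j \<in> V"
  using pos_mod_sign[OF n_pos, of "j - 1"] pos_mod_bound[OF n_pos, of "j - 1"]
  by (simp add: cyc_def verts_def) 

lemma cyc_id: "j \<in> V \<Longrightarrow> c j = j"
  by (simp add: cyc_def verts_def)

lemma cyc_add_mult: "c (j + int n * z) = c j"
  by (simp add: cyc_def algebra_simps)
    (metis (no_types, lifting) add_diff_eq diff_add_eq mod_mult_self2 mult.commute)

lemma cyc_add: "c (c i + j) = c (i + j)"
  by (simp add: cyc_def) (metis (no_types) add.commute add_diff_eq diff_add_eq mod_add_left_eq)

lemma cyc_diff: "c (c i - j) = c (i - j)"
  using cyc_add[of i "- j"] by simp

text \<open>Zero away from the vertices, so that equality of functions replaces
  \<open>fam_eq\<close>.\<close>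

definition fm :: "fam \<Rightarrow> zfam" where
  "fm f = (\<lambda>j. if j \<in> V then emb (f j) else 0)"

text \<open>The arrow \<open>x_j\<close> starts at \<open>j - 1\<close>; with this shift, naturality
  at all vertices is the single equation \<open>F * X M = X N * sh F\<close>.\<close>

definition sh :: "zfam \<Rightarrow> zfam" where
  "sh F = (\<lambda>j. if j \<in> V then F (c (j - 1)) else 0)"

definition one :: "bmod \<Rightarrow> zfam" where
  "one M = (\<lambda>j. if j \<in> V then idn (rk M j) else 0)"

definition X :: "bmod \<Rightarrow> zfam" where "X M = fm (xm M)"
definition Y :: "bmod \<Rightarrow> zfam" where "Y M = fm (ym M)"

lemma fm_id: "fm (fam_id M) = one M"
  by (rule ext) (simp add: fm_def fam_id_def one_def emb_idn)

lemma sh_simps: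
  "sh (F * G) = sh F * sh G" "sh (F + G) = sh F + sh G" "sh (F - G) = sh F - sh G"
  "sh (- F) = - sh F" "sh 0 = 0" "sh (sc a F) = sc a (sh F)"
  by (rule ext; simp add: sh_def scal_ring)+

definition zmap :: "bmod \<Rightarrow> bmod \<Rightarrow> zfam \<Rightarrow> bool" where
  "zmap M N F \<longleftrightarrow> one N * F = F \<and> F * one M = F"

text \<open>Compatibility with y follows from compatibility with x, see \<open>hom_commY\<close>:
  both composites of x and y are t, which can be cancelled.\<close>

definition hom :: "bmod \<Rightarrow> bmod \<Rightarrow> zfam \<Rightarrow> bool" where
  "hom M N F \<longleftrightarrow> zmap M N F \<and> F * X M = X N * sh F"

lemma one_idem [simp]: "one M * one M = one M"
  by (rule ext) (simp add: one_def)

lemma zmapD: "zmap M N F \<Longrightarrow> one N * F = F" "zmap M N F \<Longrightarrow> F * one M = F"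
  by (simp_all add: zmap_def)

lemma zmap_one [simp]: "zmap M M (one M)" by (simp add: zmap_def)
lemma zmap_zero [simp]: "zmap M N 0" by (simp add: zmap_def)
lemma zmap_mult: "zmap M N F \<Longrightarrow> zmap L M G \<Longrightarrow> zmap L N (F * G)"
  unfolding zmap_def by (metis mult.assoc)
lemma zmap_add: "zmap M N F \<Longrightarrow> zmap M N G \<Longrightarrow> zmap M N (F + G)"
  by (simp add: zmap_def algebra_simps)
lemma zmap_diff: "zmap M N F \<Longrightarrow> zmap M N G \<Longrightarrow> zmap M N (F - G)"
  by (simp add: zmap_def algebra_simps)
lemma zmap_uminus: "zmap M N F \<Longrightarrow> zmap M N (- F)"
  by (simp add: zmap_def)
lemma zmap_sc: "zmap M N F \<Longrightarrow> zmap M N (sc a F)"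
  by (simp add: zmap_def sc_mult_left sc_mult_right)

lemma zmap_outside: "zmap M N F \<Longrightarrow> j \<notin> V \<Longrightarrow> F j = 0"
  by (metis one_def mult_zero_left times_fun_apply zmap_def)

lemma hom_zmap: "hom M N F \<Longrightarrow> zmap M N F" by (simp add: hom_def)
lemma hom_comm: "hom M N F \<Longrightarrow> F * X M = X N * sh F" by (simp add: hom_def)
lemma homD: "hom M N F \<Longrightarrow> one N * F = F" "hom M N F \<Longrightarrow> F * one M = F"
  by (simp_all add: hom_def zmap_def)
lemma hom_zero [simp]: "hom M N 0" by (simp add: hom_def sh_simps)
lemma hom_mult: "hom M N F \<Longrightarrow> hom L M G \<Longrightarrow> hom L N (F * G)"
  unfolding hom_def by (auto intro: zmap_mult simp: sh_simps) (metis mult.assoc)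
lemma hom_add: "hom M N F \<Longrightarrow> hom M N G \<Longrightarrow> hom M N (F + G)"
  by (simp add: hom_def zmap_add sh_simps algebra_simps)
lemma hom_diff: "hom M N F \<Longrightarrow> hom M N G \<Longrightarrow> hom M N (F - G)"
  by (simp add: hom_def zmap_diff sh_simps algebra_simps)
lemma hom_uminus: "hom M N F \<Longrightarrow> hom M N (- F)"
  by (simp add: hom_def zmap_uminus sh_simps)
lemma hom_sc: "hom M N F \<Longrightarrow> hom M N (sc a F)"
  by (simp add: hom_def zmap_sc sh_simps sc_mult_left sc_mult_right)

text \<open>All conditions on an object except x^k = y^(n-k). New modules are built with this
  property first and then inherit the remaining relation through \<open>hom_defect\<close>.\<close>

definition pre :: "bmod \<Rightarrow> bool" where
  "pre M \<longleftrightarrow> (\<forall>j\<in>V.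
      xm M j \<in> carrier_mat (rk M j) (rk M (c (j - 1))) \<and>
      ym M j \<in> carrier_mat (rk M (c (j - 1))) (rk M j) \<and>
      xm M j * ym M j = fps_X \<cdot>\<^sub>m 1\<^sub>m (rk M j) \<and>
      ym M j * xm M j = fps_X \<cdot>\<^sub>m 1\<^sub>m (rk M (c (j - 1))))"

lemma cm_pre: "cm k n M \<Longrightarrow> pre M"
  by (simp add: cm_def pre_def)

lemma X_simps:
  assumes "pre M"
  shows "one M * X M = X M" "X M * sh (one M) = X M" "sh (one M) * Y M = Y M" "Y M * one M = Y M"
    "X M * Y M = sc fps_X (one M)" "Y M * X M = sc fps_X (sh (one M))"
  using assms
  by (intro ext; auto simp: pre_def one_def X_def Y_def fm_def sh_def emb_carrier emb_mult[symmetric]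
      emb_smult emb_idn carrier_matD scal_ring)+

lemma hom_one: "pre M \<Longrightarrow> hom M M (one M)"
  by (simp add: hom_def X_simps)

lemma sh_zmap: "zmap M N F \<Longrightarrow> sh (one N) * sh F = sh F" "zmap M N F \<Longrightarrow> sh F * sh (one M) = sh F"
  by (simp_all add: zmap_def sh_simps(1)[symmetric])

lemma hom_commY:
  assumes "pre M" "pre N" "hom M N F"
  shows "sh F * Y M = Y N * F"
proof -
  have "Y N * (F * X M) * Y M = Y N * (X N * sh F) * Y M" using assms by (simp add: hom_comm)
  then have "Y N * F * (X M * Y M) = Y N * X N * (sh F * Y M)" by (simp add: mult.assoc)
  then have "sc fps_X (Y N * F) = sc fps_X (sh F * Y M)"
    using assms hom_zmap[OF assms(3)]
    by (simp add: X_simps sc_mult_left sc_mult_right mult.assoc zmapD)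
       (simp add: mult.assoc[symmetric] sh_zmap)
  then show ?thesis by (simp add: sc_cancel)
qed

text \<open>If the difference \<open>D\<close> vanishes at \<open>j - 1\<close>, it vanishes at
  \<open>j\<close>: t times \<open>D j\<close> is \<open>D j\<close> composed with xy, which factors
  through \<open>D (j - 1)\<close>, and t can be cancelled.\<close>

lemma hom_ext:
  assumes "pre M" "pre N" "hom M N F" "hom M N G" "a \<in> V" "F a = G a"
  shows "F = G"
proof -
  define D where "D = F - G"
  have D: "hom M N D" "D a = 0" using assms by (simp_all add: D_def hom_diff)
  have "D (c (a + int p)) = 0" for p
  proof (induction p)
    case 0 then show ?case using D assms by (simp add: cyc_id)
  next
    case (Suc p)
    let ?j = "c (a + int (Suc p))"
    have "D * (X M * Y M) = X N * sh D * Y M"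
      by (simp add: mult.assoc[symmetric] hom_comm[OF D(1)])
    then have "sc fps_X D = X N * sh D * Y M"
      using assms zmapD(2)[OF hom_zmap[OF D(1)]] by (simp add: X_simps sc_mult_right)
    then have "scal fps_X (D ?j) = (X N * sh D * Y M) ?j" by (metis sc_apply)
    moreover have "sh D ?j = D (c (a + int p))" by (simp add: sh_def cyc_diff)
    ultimately have "scal fps_X (D ?j) = scal fps_X 0" by (simp add: Suc scal_ring)
    then show ?case by (simp add: scal_cancel)
  qed
  moreover have "\<exists>p. c (a + int p) = j" if "j \<in> V" for j
  proof
    have "a + int (nat (j - a + int n)) = j + int n * 1" using that assms(5) by (simp add: verts_def)
    then show "c (a + int (nat (j - a + int n))) = j" using that cyc_add_mult cyc_id by metis
  qed
  ultimately have "D j = 0" for j using zmap_outside[OF hom_zmap[OF D(1)]] by metis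
  then show "F = G" by (auto simp: D_def fun_eq_iff)
qed

lemma Hom_hom:
  assumes "f \<in> Hom n M N" "pre M" "pre N"
  shows "hom M N (fm f)"
proof -
  have *: "f j \<in> carrier_mat (rk N j) (rk M j)" "f j * xm M j = xm N j * f (c (j - 1))" if "j \<in> V" for j
    using that assms(1) by (auto simp: Hom_def)
  have "one N * fm f = fm f" "fm f * one M = fm f"
    by (rule ext; auto simp: fm_def one_def emb_carrier[OF *(1)])+
  moreover have "fm f * X M = X N * sh (fm f)"
  proof (rule ext)
    fix j
    show "(fm f * X M) j = (X N * sh (fm f)) j"
    proof (cases "j \<in> V")
      case True
      have "xm M j \<in> carrier_mat (rk M j) (rk M (c (j - 1)))" "xm N j \<in> carrier_mat (rk N j) (rk N (c (j - 1)))"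
        using assms True by (auto simp: pre_def)
      then have "emb (f j) * emb (xm M j) = emb (xm N j) * emb (f (c (j - 1)))"
        using *[OF True] *(1)[OF cyc_in, of "j - 1"]
        by (simp add: emb_mult[symmetric] carrier_matD)
      then show ?thesis using True by (simp add: fm_def X_def sh_def)
    qed (simp add: fm_def X_def)
  qed
  ultimately show ?thesis by (simp add: hom_def zmap_def)
qed

lemma fm_eq_iff:
  assumes "\<And>j. j \<in> V \<Longrightarrow> f j \<in> carrier_mat (r j) (s j)" "\<And>j. j \<in> V \<Longrightarrow> g j \<in> carrier_mat (r j) (s j)"
  shows "fm f = fm g \<longleftrightarrow> fam_eq n f g"
proof
  assume *: "fm f = fm g"
  show "fam_eq n f g"
    unfolding fam_eq_def
  proof
    fix j assume j: "j \<in> V"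
    have "fm f j = fm g j" by (simp add: *)
    then have "emb (f j) = emb (g j)" using j by (simp add: fm_def)
    then show "f j = g j" using assms[OF j] emb_inject by blast
  qed
qed (auto simp: fam_eq_def fm_def fun_eq_iff)

lemma Hom_carrier: "f \<in> Hom n M N \<Longrightarrow> j \<in> V \<Longrightarrow> f j \<in> carrier_mat (rk N j) (rk M j)"
  by (simp add: Hom_def)

lemma fm_comp: "f \<in> Hom n L M \<Longrightarrow> g \<in> Hom n M N \<Longrightarrow> fm (g \<circ>\<^sub>f f) = fm g * fm f"
  by (rule ext) (auto simp: fm_def fcomp_def emb_mult dest!: Hom_carrier)

lemma fm_diff: "f \<in> Hom n L M \<Longrightarrow> g \<in> Hom n L M \<Longrightarrow> fm (\<lambda>j. f j - g j) = fm f - fm g"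
  by (rule ext) (auto simp: fm_def intro!: emb_minus Hom_carrier)

definition un :: "bmod \<Rightarrow> bmod \<Rightarrow> zfam \<Rightarrow> fam" where
  "un M N F = (\<lambda>j. unemb (rk N j) (rk M j) (F j))"

lemma fm_un: "zmap M N F \<Longrightarrow> fm (un M N F) = F"
proof
  fix j assume F: "zmap M N F"
  show "fm (un M N F) j = F j"
  proof (cases "j \<in> V")
    case True
    have "(one N * F) j = F j" "(F * one M) j = F j" using F by (simp_all add: zmapD)
    then show ?thesis using True by (simp add: fm_def un_def one_def emb_unemb)
  next
    case False
    then show ?thesis using zmap_outside[OF F] by (simp add: fm_def)
  qed
qed

lemma un_Hom:
  assumes "pre M" "pre N" "hom M N F"
  shows "un M N F \<in> Hom n M N"
  unfolding Hom_def
proof (intro CollectI ballI conjI)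
  fix j assume j: "j \<in> V"
  let ?f = "un M N F"
  have e: "emb (?f i) = F i" if "i \<in> V" for i
    using fm_un[OF hom_zmap[OF assms(3)]] that by (metis fm_def)
  show d: "?f j \<in> carrier_mat (rk N j) (rk M j)" by (simp add: un_def)
  have d': "?f (c (j - 1)) \<in> carrier_mat (rk N (c (j - 1))) (rk M (c (j - 1)))" by (simp add: un_def)
  have dx: "xm M j \<in> carrier_mat (rk M j) (rk M (c (j - 1)))" "ym M j \<in> carrier_mat (rk M (c (j - 1))) (rk M j)"
    "xm N j \<in> carrier_mat (rk N j) (rk N (c (j - 1)))" "ym N j \<in> carrier_mat (rk N (c (j - 1))) (rk N j)"
    using assms j by (auto simp: pre_def)
  have "(F * X M) j = (X N * sh F) j" "(sh F * Y M) j = (Y N * F) j"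
    using assms by (simp_all add: hom_comm hom_commY)
  then have *: "F j * emb (xm M j) = emb (xm N j) * F (c (j - 1))"
    "F (c (j - 1)) * emb (ym M j) = emb (ym N j) * F j"
    using j by (simp_all add: X_def Y_def fm_def sh_def)
  show "?f j * xm M j = xm N j * ?f (c (j - 1))"
  proof (rule emb_inject)
    show "emb (?f j * xm M j) = emb (xm N j * ?f (c (j - 1)))"
      using d d' dx * e[OF j] e[OF cyc_in] by (simp add: emb_mult carrier_matD)
  qed (use d d' dx in auto)
  show "?f (c (j - 1)) * ym M j = ym N j * ?f j"
  proof (rule emb_inject)
    show "emb (?f (c (j - 1)) * ym M j) = emb (ym N j * ?f j)"
      using d d' dx * e[OF j] e[OF cyc_in] by (simp add: emb_mult carrier_matD)
  qed (use d d' dx in auto)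
qed

end

section \<open>Short exact sequences\<close>

lemma emb_plus: "A \<in> carrier_mat r s \<Longrightarrow> B \<in> carrier_mat r s \<Longrightarrow> emb (A + B) = emb A + emb B"
  by (rule fmat_eqI) (auto simp: ent_emb)

lemma mat_of_columns:
  assumes "\<And>l. l < q \<Longrightarrow> \<exists>s \<in> carrier_vec p. P l s"
  shows "\<exists>S \<in> carrier_mat p q. \<forall>l<q. P l (col S l)"
proof -
  obtain s where s: "\<And>l. l < q \<Longrightarrow> s l \<in> carrier_vec p \<and> P l (s l)" using assms by metis
  define S where "S = mat p q (\<lambda>(i, l). s l $ i)"
  have "col S l = s l" if "l < q" for l
    using that s[OF that] by (intro eq_vecI) (auto simp: S_def)
  then show ?thesis using s by (intro bexI[of _ S]) (auto simp: S_def)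
qed

lemma mult_mat_eqI:
  assumes "A \<in> carrier_mat p q" "B \<in> carrier_mat q r" "C \<in> carrier_mat p r"
    and "\<And>l. l < r \<Longrightarrow> A *\<^sub>v col B l = col C l"
  shows "A * B = C"
proof (rule mat_col_eqI)
  fix l assume "l < dim_col C"
  then have "l < r" using assms by simp
  then show "col (A * B) l = col C l" using assms(4) col_mult2[OF assms(1,2)] by simp
qed (use assms in auto)

text \<open>Surjections onto free modules split. Preimages of the unit vectors are the columns of
  \<open>S\<close>; the columns of \<open>1 - S * G\<close> lie in the kernel of \<open>G\<close>,
  and their preimages under \<open>F\<close> are the columns of \<open>R\<close>. Exactness thus
  becomes three matrix equations.\<close>

lemma exact_iff_split:
  fixes F G :: "'a::comm_ring_1 mat"
  assumes F: "F \<in> carrier_mat e a" and G: "G \<in> carrier_mat q e"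
  shows "inj_on (\<lambda>v. F *\<^sub>v v) (carrier_vec a) \<and>
      (\<lambda>v. F *\<^sub>v v) ` carrier_vec a = {v \<in> carrier_vec e. G *\<^sub>v v = 0\<^sub>v q} \<and>
      (\<lambda>v. G *\<^sub>v v) ` carrier_vec e = carrier_vec q \<longleftrightarrow>
    (\<exists>R\<in>carrier_mat a e. \<exists>S\<in>carrier_mat e q. R * F = 1\<^sub>m a \<and> G * S = 1\<^sub>m q \<and> F * R + S * G = 1\<^sub>m e)"
    (is "?inj \<and> ?ker \<and> ?sur \<longleftrightarrow> ?split")
proof
  assume *: "?inj \<and> ?ker \<and> ?sur"
  have "\<exists>s\<in>carrier_vec e. G *\<^sub>v s = unit_vec q l" if "l < q" for l
  proof -
    have "unit_vec q l \<in> (\<lambda>v. G *\<^sub>v v) ` carrier_vec e" using * by simp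
    then show ?thesis by auto
  qed
  then obtain S where S: "S \<in> carrier_mat e q" "\<And>l. l < q \<Longrightarrow> G *\<^sub>v col S l = unit_vec q l"
    using mat_of_columns[of q e "\<lambda>l s. G *\<^sub>v s = unit_vec q l"] by auto
  have GS: "G * S = 1\<^sub>m q"
    using G S by (intro mult_mat_eqI) auto
  have GF: "G *\<^sub>v (F *\<^sub>v v) = 0\<^sub>v q" if "v \<in> carrier_vec a" for v
    using * that by blast
  define Q where "Q = 1\<^sub>m e - S * G"
  have Q: "Q \<in> carrier_mat e e"
    unfolding Q_def using S G by (intro minus_carrier_mat mult_carrier_mat)
  have "G * Q = G * 1\<^sub>m e - G * (S * G)"
    unfolding Q_def by (rule mult_minus_distrib_mat[OF G one_carrier_mat mult_carrier_mat[OF S(1) G]])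
  also have "G * 1\<^sub>m e = G" using G by simp
  also have "G * (S * G) = G" using G S GS by (metis assoc_mult_mat left_mult_one_mat)
  finally have GQ: "G * Q = 0\<^sub>m q e" using G by auto
  have "\<exists>r\<in>carrier_vec a. F *\<^sub>v r = col Q l" if "l < e" for l
  proof -
    have "G *\<^sub>v col Q l = col (G * Q) l" using col_mult2[OF G Q that] by simp
    also have "\<dots> = 0\<^sub>v q" using that by (simp add: GQ)
    finally have "col Q l \<in> {v \<in> carrier_vec e. G *\<^sub>v v = 0\<^sub>v q}"
      using Q that by (auto intro: col_carrier_vec)
    then show ?thesis using * by (metis (no_types, lifting) image_iff)
  qed
  then obtain R where R: "R \<in> carrier_mat a e" "\<And>l. l < e \<Longrightarrow> F *\<^sub>v col R l = col Q l"
    using mat_of_columns[of e a "\<lambda>l r. F *\<^sub>v r = col Q l"] by auto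
  have FR: "F * R = Q"
    using F R Q by (intro mult_mat_eqI) auto
  have sum: "F * R + S * G = 1\<^sub>m e"
    unfolding FR Q_def using S G by (intro eq_matI) auto
  have "G * F = 0\<^sub>m q a"
  proof (rule mult_mat_eqI[OF G F zero_carrier_mat])
    fix l assume l: "l < a"
    have "col F l = F *\<^sub>v unit_vec a l" using F l col_mult2[OF F one_carrier_mat l] by simp
    then show "G *\<^sub>v col F l = col (0\<^sub>m q a) l" using l GF by simp
  qed
  have "S * G * F = 0\<^sub>m e a" using \<open>G * F = 0\<^sub>m q a\<close> S G F by (simp add: assoc_mult_mat[OF S(1) G F])
  moreover have "Q * F = 1\<^sub>m e * F - S * G * F"
    unfolding Q_def by (rule minus_mult_distrib_mat[OF one_carrier_mat mult_carrier_mat[OF S(1) G] F])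
  ultimately have "Q * F = F" using F by auto
  then have FRF: "F * (R * F) = F" using F R FR by (metis assoc_mult_mat)
  have RF: "R * F = 1\<^sub>m a"
  proof (rule mat_col_eqI)
    fix l assume "l < dim_col (1\<^sub>m a :: 'a mat)"
    then have l: "l < a" by simp
    have "F *\<^sub>v col (R * F) l = col (F * (R * F)) l"
      using F R l by (metis col_mult2 mult_carrier_mat)
    also have "\<dots> = F *\<^sub>v col (1\<^sub>m a) l"
      using F l unfolding FRF by (metis col_mult2 one_carrier_mat right_mult_one_mat)
    finally show "col (R * F) l = col (1\<^sub>m a) l"
      using * F R l by (auto dest!: inj_onD simp: col_carrier_vec)
  qed (use F R in auto)
  show ?split using R S RF GS sum by blast
next
  assume ?split
  then obtain R S where R: "R \<in> carrier_mat a e" and S: "S \<in> carrier_mat e q"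
    and RF: "R * F = 1\<^sub>m a" and GS: "G * S = 1\<^sub>m q" and sum: "F * R + S * G = 1\<^sub>m e" by blast
  have RFv: "R *\<^sub>v (F *\<^sub>v v) = v" if "v \<in> carrier_vec a" for v
    using that R F RF by (metis assoc_mult_mat_vec one_mult_mat_vec)
  have GSv: "G *\<^sub>v (S *\<^sub>v v) = v" if "v \<in> carrier_vec q" for v
    using that G S GS by (metis assoc_mult_mat_vec one_mult_mat_vec)
  have sv: "F *\<^sub>v (R *\<^sub>v v) + S *\<^sub>v (G *\<^sub>v v) = v" if v: "v \<in> carrier_vec e" for v
  proof -
    have "(F * R + S * G) *\<^sub>v v = (F * R) *\<^sub>v v + (S * G) *\<^sub>v v"
      using F R S G v by (intro add_mult_distrib_mat_vec[of _ e e]) auto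
    then show ?thesis using F R S G v by (simp add: sum assoc_mult_mat_vec[of _ e])
  qed
  have GF: "G *\<^sub>v (F *\<^sub>v v) = 0\<^sub>v q" if v: "v \<in> carrier_vec a" for v
  proof -
    have Fv: "F *\<^sub>v v \<in> carrier_vec e" using F v by auto
    then have Gv: "G *\<^sub>v (F *\<^sub>v v) \<in> carrier_vec q" using G by auto
    then have c: "S *\<^sub>v (G *\<^sub>v (F *\<^sub>v v)) \<in> carrier_vec e" using S by auto
    have "F *\<^sub>v v + S *\<^sub>v (G *\<^sub>v (F *\<^sub>v v)) = F *\<^sub>v v" using sv[OF Fv] RFv[OF v] by simp
    moreover have "w = 0\<^sub>v e" if "u + w = u" "u \<in> carrier_vec e" "w \<in> carrier_vec e" for u w :: "'a vec"
    proof (rule eq_vecI)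
      fix i assume "i < dim_vec (0\<^sub>v e :: 'a vec)"
      then have i: "i < e" by simp
      then have "u $ i + w $ i = u $ i" using that by (metis carrier_vecD index_add_vec(1))
      then show "w $ i = 0\<^sub>v e $ i" using i by simp
    qed (use that in auto)
    ultimately have "S *\<^sub>v (G *\<^sub>v (F *\<^sub>v v)) = 0\<^sub>v e" using Fv c by blast
    then have "G *\<^sub>v (0\<^sub>v e) = G *\<^sub>v (F *\<^sub>v v)" using GSv[OF Gv] by simp
    moreover have "G *\<^sub>v (0\<^sub>v e) = 0\<^sub>v q" using G by (intro eq_vecI) (auto intro!: scalar_prod_right_zero)
    ultimately show ?thesis by simp
  qed
  have ?inj by (rule inj_onI) (metis RFv)
  moreover have ?ker
  proof (intro equalityI subsetI)
    fix v assume "v \<in> {v \<in> carrier_vec e. G *\<^sub>v v = 0\<^sub>v q}"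
    then have v: "v \<in> carrier_vec e" "G *\<^sub>v v = 0\<^sub>v q" by auto
    have "S *\<^sub>v 0\<^sub>v q = 0\<^sub>v e" using S by (intro eq_vecI) (auto intro!: scalar_prod_right_zero)
    then have "v = F *\<^sub>v (R *\<^sub>v v)" using sv[OF v(1)] v F R by simp
    then show "v \<in> (\<lambda>v. F *\<^sub>v v) ` carrier_vec a" using R v by (auto intro!: image_eqI)
  qed (use GF F in auto)
  moreover have ?sur
  proof (intro equalityI subsetI)
    fix v :: "'a vec" assume "v \<in> carrier_vec q"
    then show "v \<in> (\<lambda>v. G *\<^sub>v v) ` carrier_vec e"
      using GSv S by (intro image_eqI[of _ _ "S *\<^sub>v v"]) auto
  qed (use G in auto)
  ultimately show "?inj \<and> ?ker \<and> ?sur" by blast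
qed

context quiver
begin

lemma zmap_fm:
  assumes "\<And>j. j \<in> V \<Longrightarrow> f j \<in> carrier_mat (rk N j) (rk M j)"
  shows "zmap M N (fm f)"
  unfolding zmap_def
  by (intro conjI ext; simp add: fm_def one_def emb_carrier[OF assms])

text \<open>\<open>r\<close> and \<open>s\<close> are families of linear maps that need not commute
  with x; they witness exactness vertex by vertex.\<close>

definition splits :: "bmod \<Rightarrow> zfam \<Rightarrow> bmod \<Rightarrow> zfam \<Rightarrow> bmod \<Rightarrow> zfam \<Rightarrow> zfam \<Rightarrow> bool" where
  "splits A f E g C r s \<longleftrightarrow> zmap E A r \<and> zmap C E s \<and> r * f = one A \<and> g * s = one C \<and>
     f * r + s * g = one E"

definition sexact :: "bmod \<Rightarrow> zfam \<Rightarrow> bmod \<Rightarrow> zfam \<Rightarrow> bmod \<Rightarrow> bool" where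
  "sexact A f E g C \<longleftrightarrow> cm k n A \<and> cm k n E \<and> cm k n C \<and> hom A E f \<and> hom E C g \<and>
     (\<exists>r s. splits A f E g C r s)"

lemma un_zmap: "zmap M N F \<Longrightarrow> j \<in> V \<Longrightarrow> emb (un M N F j) = F j"
  using fm_un[of M N F] by (metis fm_def)

lemma splits_iff:
  assumes f: "\<And>j. j \<in> V \<Longrightarrow> f j \<in> carrier_mat (rk E j) (rk A j)"
    and g: "\<And>j. j \<in> V \<Longrightarrow> g j \<in> carrier_mat (rk C j) (rk E j)"
  shows "(\<forall>j\<in>V. \<exists>R\<in>carrier_mat (rk A j) (rk E j). \<exists>S\<in>carrier_mat (rk E j) (rk C j).
      R * f j = 1\<^sub>m (rk A j) \<and> g j * S = 1\<^sub>m (rk C j) \<and> f j * R + S * g j = 1\<^sub>m (rk E j)) \<longleftrightarrow>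
    (\<exists>r s. splits A (fm f) E (fm g) C r s)" (is "?L \<longleftrightarrow> ?R")
proof
  assume ?L
  then obtain R S where RS: "\<And>j. j \<in> V \<Longrightarrow> R j \<in> carrier_mat (rk A j) (rk E j) \<and> S j \<in> carrier_mat (rk E j) (rk C j) \<and>
      R j * f j = 1\<^sub>m (rk A j) \<and> g j * S j = 1\<^sub>m (rk C j) \<and> f j * R j + S j * g j = 1\<^sub>m (rk E j)"
    by metis
  have *: "emb (R j) * emb (f j) = idn (rk A j)" "emb (g j) * emb (S j) = idn (rk C j)"
    "emb (f j) * emb (R j) + emb (S j) * emb (g j) = idn (rk E j)" if "j \<in> V" for j
  proof -
    note rs = RS[OF that] and fg = f[OF that] g[OF that]
    show "emb (R j) * emb (f j) = idn (rk A j)" "emb (g j) * emb (S j) = idn (rk C j)"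
      using rs fg emb_mult[of "R j" "f j"] emb_mult[of "g j" "S j"] by (auto simp: emb_idn)
    have "emb (f j * R j + S j * g j) = emb (f j) * emb (R j) + emb (S j) * emb (g j)"
      using rs fg by (subst emb_plus[of _ "rk E j" "rk E j"]) (auto simp: emb_mult)
    then show "emb (f j) * emb (R j) + emb (S j) * emb (g j) = idn (rk E j)"
      using rs by (simp add: emb_idn)
  qed
  have "splits A (fm f) E (fm g) C (fm R) (fm S)"
    unfolding splits_def using RS *
    by (intro conjI zmap_fm ext) (auto simp: fm_def one_def)
  then show ?R by blast
next
  assume ?R
  then obtain r s where rs: "splits A (fm f) E (fm g) C r s" by blast
  show ?L
  proof
    fix j assume j: "j \<in> V"
    let ?R = "un E A r j" and ?S = "un C E s j"
    have c: "?R \<in> carrier_mat (rk A j) (rk E j)" "?S \<in> carrier_mat (rk E j) (rk C j)"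
      by (simp_all add: un_def)
    have e: "emb ?R = r j" "emb ?S = s j" using rs j by (simp_all add: splits_def un_zmap)
    have *: "(r * fm f) j = one A j" "(fm g * s) j = one C j" "(fm f * r + s * fm g) j = one E j"
      using rs by (simp_all add: splits_def)
    note fg = f[OF j] g[OF j]
    have "?R * f j = 1\<^sub>m (rk A j)"
      by (rule emb_inject) (use c fg * j e in \<open>auto simp: emb_mult emb_idn one_def fm_def\<close>)
    moreover have "g j * ?S = 1\<^sub>m (rk C j)"
      by (rule emb_inject) (use c fg * j e in \<open>auto simp: emb_mult emb_idn one_def fm_def\<close>)
    moreover have "f j * ?R + ?S * g j = 1\<^sub>m (rk E j)"
    proof (rule emb_inject)
      show "emb (f j * ?R + ?S * g j) = emb (1\<^sub>m (rk E j))"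
        using c fg * j e
        by (subst emb_plus[of _ "rk E j" "rk E j"]) (auto simp: emb_mult emb_idn one_def fm_def)
    qed (use c fg in auto)
    ultimately show "\<exists>R\<in>carrier_mat (rk A j) (rk E j). \<exists>S\<in>carrier_mat (rk E j) (rk C j).
      R * f j = 1\<^sub>m (rk A j) \<and> g j * S = 1\<^sub>m (rk C j) \<and> f j * R + S * g j = 1\<^sub>m (rk E j)"
      using c by blast
  qed
qed

lemma short_exact_iff:
  "short_exact k n A f E g C \<longleftrightarrow> f \<in> Hom n A E \<and> g \<in> Hom n E C \<and> sexact A (fm f) E (fm g) C"
proof -
  have "short_exact k n A f E g C \<longleftrightarrow> cm k n A \<and> cm k n E \<and> cm k n C \<and> f \<in> Hom n A E \<and> g \<in> Hom n E C \<and>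
      (\<exists>r s. splits A (fm f) E (fm g) C r s)"
    unfolding short_exact_def
  proof (intro conj_cong refl)
    assume "f \<in> Hom n A E" "g \<in> Hom n E C"
    note fg = Hom_carrier[OF this(1)] Hom_carrier[OF this(2)]
    show "(\<forall>j\<in>V. inj_on (\<lambda>v. f j *\<^sub>v v) (carrier_vec (rk A j)) \<and>
        (\<lambda>v. f j *\<^sub>v v) ` carrier_vec (rk A j) = {v \<in> carrier_vec (rk E j). g j *\<^sub>v v = 0\<^sub>v (rk C j)} \<and>
        (\<lambda>v. g j *\<^sub>v v) ` carrier_vec (rk E j) = carrier_vec (rk C j)) \<longleftrightarrow>
      (\<exists>r s. splits A (fm f) E (fm g) C r s)"
      by (rule trans[OF ball_cong[OF refl exact_iff_split[OF fg]] splits_iff[OF fg]])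
  qed
  then show ?thesis by (auto simp: sexact_def Hom_hom cm_pre)
qed

lemma sexact_short_exact:
  assumes "sexact A f E g C"
  shows "short_exact k n A (un A E f) E (un E C g) C"
  using assms by (auto simp: short_exact_iff sexact_def fm_un hom_zmap intro!: un_Hom cm_pre)

lemma splits_zero:
  assumes "splits A f E g C r s"
  shows "g * f = 0 \<or> \<not> zmap A E f \<or> \<not> zmap E C g" "r * s = 0"
proof -
  note d = assms[unfolded splits_def]
  have "f * r * s + s * g * s = s" using d by (metis distrib_right zmapD(1))
  moreover have "s * g * s = s" using d by (metis mult.assoc zmapD(2))
  ultimately have "f * r * s = 0" by simp
  then have "r * f * r * s = 0" by (simp add: mult.assoc)
  then show "r * s = 0" using d by (metis zmapD(1))
  show "g * f = 0 \<or> \<not> zmap A E f \<or> \<not> zmap E C g"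
  proof (cases "zmap A E f \<and> zmap E C g")
    case True
    have "g * (f * r + s * g) = g" using d True by (simp add: zmap_def)
    then have "g * f * r + g * s * g = g" by (simp add: distrib_left mult.assoc)
    moreover have "g * s * g = g" using d True by (simp add: zmap_def)
    ultimately have "g * f * r = 0" by simp
    then have "g * (f * (r * f)) = 0" by (simp add: mult.assoc[symmetric])
    moreover have "f * (r * f) = f" using d True by (simp add: zmap_def)
    ultimately show ?thesis by simp
  qed auto
qed

lemma sexactE:
  assumes "sexact A f E g C"
  obtains r s where "cm k n A" "cm k n E" "cm k n C" "hom A E f" "hom E C g"
    "zmap E A r" "zmap C E s" "r * f = one A" "g * s = one C" "f * r + s * g = one E"
    "g * f = 0" "r * s = 0"
proof -
  from assms obtain r s where *: "cm k n A" "cm k n E" "cm k n C" "hom A E f" "hom E C g"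
    and sp: "splits A f E g C r s" unfolding sexact_def by blast
  have "g * f = 0" "r * s = 0" using splits_zero[OF sp] *(4,5) hom_zmap by blast+
  then show ?thesis using that[of r s] * sp by (simp add: splits_def)
qed

text \<open>The only candidate is \<open>r * h\<close>. It commutes with x because
  \<open>f * (r * h) = h\<close> does and \<open>r\<close> cancels \<open>f\<close>.\<close>

lemma sexact_lift:
  assumes se: "sexact A f E g C" and h: "hom L E h" and gh: "g * h = 0" and L: "pre L"
  shows "\<exists>h'. hom L A h' \<and> f * h' = h"
proof -
  from se obtain r s where *: "cm k n A" "cm k n E" "hom A E f" "hom E C g"
    "zmap E A r" "r * f = one A" "f * r + s * g = one E" by (rule sexactE)
  have "(f * r + s * g) * h = h" using * h by (simp add: homD)
  then have fr: "f * (r * h) = h" by (simp add: distrib_right mult.assoc gh)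
  have "r * f * (r * h * X L) = r * (h * X L)" by (metis fr mult.assoc)
  also have "\<dots> = r * (X E * sh (f * (r * h)))" using h fr by (simp add: hom_comm)
  also have "\<dots> = r * (X E * sh f) * sh (r * h)" by (simp add: sh_simps mult.assoc)
  also have "\<dots> = r * f * X A * sh (r * h)" by (simp only: hom_comm[OF *(3), symmetric] mult.assoc)
  finally have "one A * (r * h * X L) = one A * X A * sh (r * h)" by (simp only: *(6))
  then have "r * h * X L = X A * sh (r * h)"
    using * by (simp add: X_simps cm_pre mult.assoc[symmetric] zmapD)
  then have "hom L A (r * h)" using * h by (auto simp: hom_def intro: zmap_mult)
  then show ?thesis using fr by blast
qed

lemma sexact_colift:
  assumes se: "sexact A f E g C" and h: "hom E L h" and hf: "h * f = 0" and L: "pre L"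
  shows "\<exists>h'. hom C L h' \<and> h' * g = h"
proof -
  from se obtain r s where *: "cm k n A" "cm k n E" "cm k n C" "hom A E f" "hom E C g"
    "zmap C E s" "g * s = one C" "f * r + s * g = one E" by (rule sexactE)
  have "h * (f * r + s * g) = h" using * h by (simp add: homD)
  then have sg: "h * s * g = h" by (simp add: distrib_left mult.assoc[symmetric] hf)
  have "h * s * X C * sh (g * s) = h * s * (X C * sh g) * sh s" by (simp add: sh_simps mult.assoc)
  also have "\<dots> = h * s * g * X E * sh s" by (simp only: hom_comm[OF *(5), symmetric] mult.assoc)
  also have "\<dots> = X L * sh (h * s * g) * sh s" using h sg by (simp add: hom_comm)
  also have "\<dots> = X L * sh (h * s) * sh (g * s)" by (simp add: sh_simps mult.assoc)
  finally have "h * s * (X C * sh (one C)) = X L * (sh (h * s) * sh (one C))"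
    by (simp add: * mult.assoc)
  then have "h * s * X C = X L * sh (h * s)"
    using * h zmap_mult[of E L h C s] by (simp add: X_simps cm_pre hom_zmap sh_zmap)
  then have "hom C L (h * s)" using * h by (auto simp: hom_def intro: zmap_mult)
  then show ?thesis using sg by blast
qed

lemma sexact_mono: "sexact A f E g C \<Longrightarrow> zmap L A a \<Longrightarrow> zmap L A b \<Longrightarrow> f * a = f * b \<Longrightarrow> a = b"
  by (erule sexactE) (metis mult.assoc zmapD(1))

lemma sexact_epi: "sexact A f E g C \<Longrightarrow> zmap C L a \<Longrightarrow> zmap C L b \<Longrightarrow> a * g = b * g \<Longrightarrow> a = b"
  by (erule sexactE) (metis mult.assoc zmapD(2))

text \<open>Turns identities in the ring of families back into a module record; kernels and
  cokernels are constructed through it.\<close>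

lemma mk_module:
  assumes I: "I = (\<lambda>j. if j \<in> V then idn (r j) else 0)"
    and "I * Xr = Xr" "Xr * sh I = Xr" "sh I * Yr = Yr" "Yr * I = Yr"
    and "Xr * Yr = sc fps_X I" "Yr * Xr = sc fps_X (sh I)"
  shows "\<exists>M. rk M = r \<and> one M = I \<and> X M = Xr \<and> Y M = Yr \<and> pre M"
proof -
  define M where "M = \<lparr> rk = r, xm = \<lambda>j. unemb (r j) (r (c (j - 1))) (Xr j),
    ym = \<lambda>j. unemb (r (c (j - 1))) (r j) (Yr j) \<rparr>"
  have I_V: "I j = idn (r j)" "sh I j = idn (r (c (j - 1)))" if "j \<in> V" for j
    using that by (simp_all add: I sh_def)
  have e: "emb (xm M j) = Xr j" "emb (ym M j) = Yr j" if "j \<in> V" for j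
    using that fun_cong[OF assms(2), of j] fun_cong[OF assms(3), of j] fun_cong[OF assms(4), of j] fun_cong[OF assms(5), of j]
    by (simp_all add: M_def emb_unemb I_V)
  have "Xr j = 0" "Yr j = 0" if "j \<notin> V" for j
    using that fun_cong[OF assms(2), of j] fun_cong[OF assms(5), of j] by (simp_all add: I)
  then have XY: "X M = Xr" "Y M = Yr" using e by (auto simp: X_def Y_def fm_def fun_eq_iff)
  have "pre M" unfolding pre_def
  proof (intro ballI conjI)
    fix j assume j: "j \<in> V"
    show 1: "xm M j \<in> carrier_mat (rk M j) (rk M (c (j - 1)))"
      and 2: "ym M j \<in> carrier_mat (rk M (c (j - 1))) (rk M j)" by (simp_all add: M_def)
    show "xm M j * ym M j = fps_X \<cdot>\<^sub>m 1\<^sub>m (rk M j)"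
      using fun_cong[OF assms(6), of j] 1 2 j e
      by (intro emb_inject[of _ "rk M j" "rk M j"]) (auto simp: emb_mult emb_smult emb_idn I_V M_def)
    show "ym M j * xm M j = fps_X \<cdot>\<^sub>m 1\<^sub>m (rk M (c (j - 1)))"
      using fun_cong[OF assms(7), of j] 1 2 j e
      by (intro emb_inject[of _ "rk M (c (j - 1))" "rk M (c (j - 1))"])
         (auto simp: emb_mult emb_smult emb_idn I_V M_def)
  qed
  then show ?thesis using XY by (intro exI[of _ M]) (auto simp: one_def I M_def)
qed

end

section \<open>Kernels and cokernels\<close>

text \<open>The form of \<open>a * b = d\<close> that the simplifier can apply inside a product
  already bracketed to the right.\<close>

lemma asc: "a * b = d \<Longrightarrow> a * (b * e) = d * e" for a b d e :: "'a::semigroup_mult"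
  by (simp add: mult.assoc[symmetric])

lift_definition shift :: "nat \<Rightarrow> nat \<Rightarrow> 'a::comm_ring_1 fmat"
  is "\<lambda>p q i j. if i = p + j \<and> j < q then 1 else 0"
proof -
  fix p q :: nat
  show "\<exists>N. \<forall>i j. N \<le> i \<or> N \<le> j \<longrightarrow> (if i = p + j \<and> j < q then 1 else 0 :: 'a) = 0"
    by (rule exI[of _ "p + q"]) auto
qed

lift_definition unshift :: "nat \<Rightarrow> nat \<Rightarrow> 'a::comm_ring_1 fmat"
  is "\<lambda>p q i j. if j = p + i \<and> i < q then 1 else 0"
proof -
  fix p q :: nat
  show "\<exists>N. \<forall>i j. N \<le> i \<or> N \<le> j \<longrightarrow> (if j = p + i \<and> i < q then 1 else 0 :: 'a) = 0"
    by (rule exI[of _ "p + q"]) auto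
qed

lemma ent_shift: "ent (shift p q) i j = (if i = p + j \<and> j < q then 1 else 0)"
  and ent_unshift: "ent (unshift p q) i j = (if j = p + i \<and> i < q then 1 else 0)"
  by (simp_all add: shift.rep_eq unshift.rep_eq)

lemma ent_shift_mult: "ent (shift p q * A) i j = (if p \<le> i \<and> i < p + q then ent A (i - p) j else 0)"
  by (subst ent_times_single[of "i - p"]) (auto simp: ent_shift)

lemma ent_mult_unshift: "ent (A * unshift p q) i j = (if p \<le> j \<and> j < p + q then ent A i (j - p) else 0)"
  by (subst ent_times_single[of "j - p"]) (auto simp: ent_unshift)

lemma ent_unshift_mult: "ent (unshift p q * A) i j = (if i < q then ent A (p + i) j else 0)"
  using ent_times_single[of "p + i" "unshift p q" i A j] by (simp add: ent_unshift)

lemma shift_simps: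
  "unshift p q * shift p q = idn q" "shift p q * unshift p q = idn (p + q) - idn p"
  "idn p * shift p q = 0" "unshift p q * idn p = 0"
  "idn (p + q) * shift p q = shift p q" "unshift p q * idn (p + q) = unshift p q"
  "shift p q * idn q = shift p q" "idn q * unshift p q = unshift p q"
  by (rule fmat_eqI; auto simp: ent_shift ent_unshift ent_idn ent_shift_mult ent_unshift_mult)+

context quiver
begin

definition XP :: "bmod \<Rightarrow> int \<Rightarrow> nat \<Rightarrow> complex fps fmat" where
  "XP M j p = emb (xpath n M j p)"

definition YP :: "bmod \<Rightarrow> int \<Rightarrow> nat \<Rightarrow> complex fps fmat" where
  "YP M j p = emb (ypath n M j p)"

lemma xpath_carrier:
  assumes "pre M" "j \<in> V"
  shows "xpath n M j p \<in> carrier_mat (rk M (c (j + int p))) (rk M j)"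
proof (induction p)
  case (Suc p)
  have "xm M (c (j + int p + 1)) \<in> carrier_mat (rk M (c (j + int p + 1))) (rk M (c (c (j + int p + 1) - 1)))"
    using assms(1) by (simp add: pre_def)
  then show ?case using Suc by (simp add: cyc_diff algebra_simps)
qed (use assms in \<open>simp add: cyc_id\<close>)

lemma ypath_carrier:
  assumes "pre M" "j \<in> V"
  shows "ypath n M j p \<in> carrier_mat (rk M (c (j - int p))) (rk M j)"
proof (induction p)
  case (Suc p)
  have "ym M (c (j - int p)) \<in> carrier_mat (rk M (c (c (j - int p) - 1))) (rk M (c (j - int p)))"
    using assms(1) by (simp add: pre_def)
  then show ?case using Suc by (simp add: cyc_diff algebra_simps)
qed (use assms in \<open>simp add: cyc_id\<close>)

lemma XP_simps:
  assumes "pre M" "j \<in> V"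
  shows "XP M j 0 = one M j" "XP M j (Suc p) = X M (c (j + int p + 1)) * XP M j p"
    "YP M j 0 = one M j" "YP M j (Suc p) = Y M (c (j - int p)) * YP M j p"
proof -
  show "XP M j 0 = one M j" "YP M j 0 = one M j"
    using assms by (simp_all add: XP_def YP_def one_def emb_idn)
  have "xm M (c (j + int p + 1)) \<in> carrier_mat (rk M (c (j + int p + 1))) (rk M (c (c (j + int p + 1) - 1)))"
    using assms(1) by (simp add: pre_def)
  then show "XP M j (Suc p) = X M (c (j + int p + 1)) * XP M j p"
    using xpath_carrier[OF assms, of p] by (simp add: XP_def X_def fm_def emb_mult cyc_diff)
  have "ym M (c (j - int p)) \<in> carrier_mat (rk M (c (c (j - int p) - 1))) (rk M (c (j - int p)))"
    using assms(1) by (simp add: pre_def)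
  then show "YP M j (Suc p) = Y M (c (j - int p)) * YP M j p"
    using ypath_carrier[OF assms, of p] by (simp add: YP_def Y_def fm_def emb_mult cyc_diff)
qed

lemma XP_one:
  assumes "pre M" "j \<in> V"
  shows "one M (c (j + int p)) * XP M j p = XP M j p" "XP M j p * one M j = XP M j p"
    "one M (c (j - int p)) * YP M j p = YP M j p" "YP M j p * one M j = YP M j p"
  using xpath_carrier[OF assms, of p] ypath_carrier[OF assms, of p] assms
  by (auto simp: XP_def YP_def one_def emb_carrier)

lemma XP_front:
  assumes "pre M" "j \<in> V"
  shows "XP M (c (j - 1)) (Suc p) = XP M j p * X M j"
    and "YP M j (Suc p) = YP M (c (j - 1)) p * Y M j"
proof (induction p)
  case 0
  have "(one M * X M) j = X M j" "(X M * sh (one M)) j = X M j"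
    "(sh (one M) * Y M) j = Y M j" "(Y M * one M) j = Y M j"
    using assms by (simp_all add: X_simps)
  then show "XP M (c (j - 1)) (Suc 0) = XP M j 0 * X M j" "YP M j (Suc 0) = YP M (c (j - 1)) 0 * Y M j"
    using assms by (simp_all add: XP_simps sh_def cyc_add cyc_id)
next
  case (Suc p)
  have "c (c (j - 1) + int (Suc p) + 1) = c (j + int p + 1)"
    by (simp add: cyc_add add.assoc) (simp add: algebra_simps)
  then show "XP M (c (j - 1)) (Suc (Suc p)) = XP M j (Suc p) * X M j"
    using assms Suc(1) by (simp add: XP_simps(2)[of M "c (j - 1)" "Suc p"] XP_simps(2)[of M j p] mult.assoc)
  have "c (c (j - 1) - int p) = c (j - int (Suc p))"
    by (simp add: cyc_diff) (simp add: algebra_simps)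
  then show "YP M j (Suc (Suc p)) = YP M (c (j - 1)) (Suc p) * Y M j"
    using assms Suc(2) by (simp add: XP_simps(4)[of M "c (j - 1)" p] XP_simps(4)[of M j "Suc p"] mult.assoc)
qed

lemma hom_XP:
  assumes "pre M" "pre N" "hom M N F" "j \<in> V"
  shows "F (c (j + int p)) * XP M j p = XP N j p * F j"
    and "F (c (j - int p)) * YP M j p = YP N j p * F j"
proof (induction p)
  case 0
  have "(one N * F) j = F j" "(F * one M) j = F j" using assms by (simp_all add: homD)
  then show "F (c (j + int 0)) * XP M j 0 = XP N j 0 * F j" "F (c (j - int 0)) * YP M j 0 = YP N j 0 * F j"
    using assms by (simp_all add: XP_simps cyc_id)
next
  case (Suc p)
  let ?j = "c (j + int p + 1)"
  have "(F * X M) ?j = (X N * sh F) ?j" using assms by (simp add: hom_comm)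
  then have "F ?j * X M ?j = X N ?j * F (c (j + int p))" by (simp add: sh_def cyc_diff)
  then have "F ?j * XP M j (Suc p) = X N ?j * (F (c (j + int p)) * XP M j p)"
    using assms by (simp add: XP_simps mult.assoc[symmetric])
  then show "F (c (j + int (Suc p))) * XP M j (Suc p) = XP N j (Suc p) * F j"
    unfolding Suc(1) using assms by (simp add: XP_simps mult.assoc algebra_simps)
  let ?i = "c (j - int p)"
  have "(sh F * Y M) ?i = (Y N * F) ?i" using assms by (simp add: hom_commY)
  then have "F (c (j - int (Suc p))) * Y M ?i = Y N ?i * F ?i" by (simp add: sh_def cyc_diff algebra_simps)
  then have "F (c (j - int (Suc p))) * YP M j (Suc p) = Y N ?i * (F ?i * YP M j p)"
    using assms by (simp add: XP_simps mult.assoc[symmetric])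
  then show "F (c (j - int (Suc p))) * YP M j (Suc p) = YP N j (Suc p) * F j"
    unfolding Suc(2) using assms by (simp add: XP_simps mult.assoc)
qed

text \<open>Both paths run from \<open>j\<close> to \<open>j + k\<close> modulo n, and their
  difference is natural in the module. Hence x^k = y^(n-k) passes to kernels, cokernels and direct
  sums without computing paths there.\<close>

definition defect :: "bmod \<Rightarrow> int \<Rightarrow> complex fps fmat" where
  "defect M j = XP M j k - YP M j (n - k)"

lemma cyc_k: "c (j - int (n - k)) = c (j + int k)"
  using cyc_add_mult[of "j - int (n - k)" 1] k_less by (simp add: of_nat_diff algebra_simps)

lemma cm_iff: "cm k n M \<longleftrightarrow> pre M \<and> (\<forall>j\<in>V. defect M j = 0)"
proof -
  have "xpath n M j k = ypath n M j (n - k) \<longleftrightarrow> defect M j = 0" if "pre M" "j \<in> V" for j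
    using xpath_carrier[OF that, of k] ypath_carrier[OF that, of "n - k"]
    by (auto simp: defect_def XP_def YP_def cyc_k intro: emb_inject)
  then show ?thesis unfolding cm_def pre_def by blast
qed

lemma hom_defect:
  assumes "pre M" "pre N" "hom M N F" "j \<in> V"
  shows "F (c (j + int k)) * defect M j = defect N j * F j"
  using hom_XP[OF assms, of k] hom_XP(2)[OF assms, of "n - k"]
  by (simp add: defect_def algebra_simps cyc_k)

lemma cm_sub:
  assumes "pre K" "cm k n M" "hom K M F" "zmap M K R" "R * F = one K"
  shows "cm k n K"
  unfolding cm_iff
proof (intro conjI ballI assms)
  fix j assume j: "j \<in> V"
  have "F (c (j + int k)) * defect K j = 0"
    using hom_defect[OF assms(1) _ assms(3) j] assms(2) j by (simp add: cm_iff)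
  then have "(R * F) (c (j + int k)) * defect K j = 0" by (simp add: mult.assoc)
  then show "defect K j = 0"
    using XP_one[OF assms(1) j, of k] XP_one[OF assms(1) j, of "n - k"]
    by (simp add: assms(5) defect_def right_diff_distrib cyc_k)
qed

lemma cm_quot:
  assumes "pre K" "cm k n M" "hom M K F" "zmap K M R" "F * R = one K"
  shows "cm k n K"
  unfolding cm_iff
proof (intro conjI ballI assms)
  fix j assume j: "j \<in> V"
  have "defect K j * F j = 0"
    using hom_defect[OF _ assms(1,3) j] assms(2) j by (simp add: cm_iff)
  then have "defect K j * (F * R) j = 0" by (simp add: mult.assoc[symmetric])
  then show "defect K j = 0"
    using XP_one[OF assms(1) j, of k] XP_one[OF assms(1) j, of "n - k"]
    by (simp add: assms(5) defect_def left_diff_distrib)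
qed

lemma zmap_split:
  assumes "zmap F Q g" "zmap Q F s" "g * s = one Q"
  shows "\<exists>r Vf Wf. let I = (\<lambda>j. if j \<in> V then idn (r j) else 0) in
    I * Vf = Vf \<and> Vf * one F = Vf \<and> one F * Wf = Wf \<and> Wf * I = Wf \<and> Vf * Wf = I \<and>
    Wf * Vf = one F - s * g"
proof -
  have "\<exists>m V' W'. idn m * V' = V' \<and> V' * idn (rk F j) = V' \<and> idn (rk F j) * W' = W' \<and> W' * idn m = W' \<and>
      V' * W' = idn m \<and> W' * V' = idn (rk F j) - s j * g j" if "j \<in> V" for j
  proof (rule split_epi)
    show "idn (rk Q j) * g j = g j" "g j * idn (rk F j) = g j" "idn (rk F j) * s j = s j"
      "s j * idn (rk Q j) = s j" "g j * s j = idn (rk Q j)"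
      using that fun_cong[OF zmapD(1)[OF assms(1)], of j] fun_cong[OF zmapD(2)[OF assms(1)], of j]
        fun_cong[OF zmapD(1)[OF assms(2)], of j] fun_cong[OF zmapD(2)[OF assms(2)], of j]
        fun_cong[OF assms(3), of j]
      by (simp_all add: one_def)
  qed
  then obtain m V' W' where *: "\<And>j. j \<in> V \<Longrightarrow> idn (m j) * V' j = V' j \<and> V' j * idn (rk F j) = V' j \<and>
      idn (rk F j) * W' j = W' j \<and> W' j * idn (m j) = W' j \<and>
      V' j * W' j = idn (m j) \<and> W' j * V' j = idn (rk F j) - s j * g j"
    by metis
  have o: "s j = 0" if "j \<notin> V" for j using zmap_outside[OF assms(2) that] .
  show ?thesis
    by (intro exI[of _ m] exI[of _ "\<lambda>j. if j \<in> V then V' j else 0"] exI[of _ "\<lambda>j. if j \<in> V then W' j else 0"])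
       (auto simp: Let_def fun_eq_iff * o one_def)
qed

text \<open>At each vertex the columns of \<open>Wf\<close> are a basis of the kernel and
  \<open>Vf\<close> reads off coordinates, \<open>Wf * Vf\<close> being the projection
  \<open>one F - s * g\<close>. The arrows of the kernel are those of \<open>F\<close> in these
  coordinates.\<close>

lemma kernel_module:
  assumes F: "cm k n F" and Q: "cm k n Q" and g: "hom F Q g" and s: "zmap Q F s" "g * s = one Q"
  shows "\<exists>K i. sexact K i F g Q"
proof -
  obtain r Vf Wf I where I: "I = (\<lambda>j. if j \<in> V then idn (r j) else 0)" and
    *: "I * Vf = Vf" "Vf * one F = Vf" "one F * Wf = Wf" "Wf * I = Wf" "Vf * Wf = I"
    "Wf * Vf = one F - s * g"
    using zmap_split[OF hom_zmap[OF g] s] by (auto simp: Let_def)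
  note F' = X_simps[OF cm_pre[OF F]] and Q' = X_simps[OF cm_pre[OF Q]]
  have gs: "g * one F = g" "one Q * g = g" "s * one Q = s" "one F * s = s" using g s by (simp_all add: homD zmapD)
  have "g * (Wf * Vf) = 0" unfolding *(6) by (simp add: right_diff_distrib gs s(2)[THEN asc])
  then have "g * (Wf * (Vf * Wf)) = 0" by (simp add: mult.assoc[symmetric])
  then have gW: "g * Wf = 0" by (simp add: * )
  have shI: "sh Vf * sh Wf = sh I" "sh Wf * sh I = sh Wf" "sh I * sh Vf = sh Vf" "sh g * sh Wf = 0"
    "sh (one F) * sh Wf = sh Wf" "sh Vf * sh (one F) = sh Vf"
    by (simp_all only: sh_simps(1)[symmetric] * gW sh_simps(5))
  have shWV: "sh Wf * sh Vf = sh (one F) - sh s * sh g"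
    by (simp only: sh_simps(1)[symmetric] * sh_simps(3))
  \<comment> \<open>The kernel is stable under x because \<open>g\<close> is a homomorphism, so the
    projection onto it acts as the identity here.\<close>
  have XW: "Wf * (Vf * (X F * sh Wf)) = X F * sh Wf"
    unfolding mult.assoc[symmetric, of Wf] *(6)
    by (simp add: left_diff_distrib mult.assoc F'[THEN asc] hom_comm[OF g, THEN asc] shI)
  have "\<exists>K. rk K = r \<and> one K = I \<and> X K = Vf * X F * sh Wf \<and> Y K = sh Vf * Y F * Wf \<and> pre K"
  proof (rule mk_module[OF I])
    have "Vf * X F * sh Wf * (sh Vf * Y F * Wf) = Vf * X F * (sh Wf * sh Vf) * Y F * Wf"
      by (simp add: mult.assoc)
    also have "\<dots> = Vf * (X F * sh (one F)) * Y F * Wf - Vf * X F * sh s * (sh g * Y F) * Wf"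
      unfolding shWV by (simp add: algebra_simps)
    also have "\<dots> = Vf * (X F * Y F) * Wf - Vf * X F * sh s * Y Q * (g * Wf)"
      using cm_pre[OF F] cm_pre[OF Q] by (simp add: hom_commY[OF _ _ g] F' mult.assoc)
    also have "\<dots> = sc fps_X I" by (simp add: gW F' sc_mult_left sc_mult_right mult.assoc *)
    finally show "Vf * X F * sh Wf * (sh Vf * Y F * Wf) = sc fps_X I" .
    have "sh Vf * Y F * Wf * (Vf * X F * sh Wf) = sh Vf * Y F * (Wf * (Vf * (X F * sh Wf)))"
      by (simp add: mult.assoc)
    also have "\<dots> = sc fps_X (sh I)"
      unfolding XW by (simp add: F'(6)[THEN asc] mult.assoc sc_mult_left sc_mult_right shI)
    finally show "sh Vf * Y F * Wf * (Vf * X F * sh Wf) = sc fps_X (sh I)" .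
  qed (simp_all add: mult.assoc shI shI(3)[THEN asc] * *(1)[THEN asc])
  then obtain K where K: "one K = I" "X K = Vf * X F * sh Wf" "pre K" by blast
  have W: "hom K F Wf" using XW by (simp add: hom_def zmap_def K * mult.assoc)
  have Vz: "zmap F K Vf" by (simp add: zmap_def K *)
  have "cm k n K" by (rule cm_sub[OF K(3) F W Vz]) (simp add: * K)
  moreover have "splits K Wf F g Q Vf s" using Vz s by (simp add: splits_def * K)
  ultimately show ?thesis using W F Q g unfolding sexact_def by blast
qed

text \<open>The cokernel is realised on the kernel of the retraction \<open>s\<close>, a linear
  complement of the image of \<open>f\<close>, to which \<open>Vf\<close> projects.\<close>

lemma cokernel_module:
  assumes A: "cm k n A" and F: "cm k n F" and f: "hom A F f" and s: "zmap F A s" "s * f = one A"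
  shows "\<exists>Q g. sexact A f F g Q"
proof -
  obtain r Vf Wf I where I: "I = (\<lambda>j. if j \<in> V then idn (r j) else 0)" and
    *: "I * Vf = Vf" "Vf * one F = Vf" "one F * Wf = Wf" "Wf * I = Wf" "Vf * Wf = I"
    "Wf * Vf = one F - f * s"
    using zmap_split[OF s(1) hom_zmap[OF f] s(2)] by (auto simp: Let_def)
  note F' = X_simps[OF cm_pre[OF F]] and A' = X_simps[OF cm_pre[OF A]]
  have gs: "f * one A = f" "one F * f = f" "s * one F = s" "one A * s = s" using f s by (simp_all add: homD zmapD)
  have "Wf * Vf * f = 0" unfolding *(6) by (simp add: left_diff_distrib gs s mult.assoc)
  then have "Vf * Wf * Vf * f = 0" by (simp add: mult.assoc)
  then have Vf: "Vf * f = 0" by (simp add: * )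
  have shI: "sh Vf * sh Wf = sh I" "sh Wf * sh I = sh Wf" "sh I * sh Vf = sh Vf"
    "sh (one F) * sh Wf = sh Wf" "sh Vf * sh (one F) = sh Vf" "sh Vf * sh f = 0"
    by (simp_all only: sh_simps(1)[symmetric] * Vf sh_simps(5))
  have shWV: "sh Wf * sh Vf = sh (one F) - sh f * sh s"
    by (simp only: sh_simps(1)[symmetric] * sh_simps(3))
  have XV: "Vf * (X F * (sh Wf * sh Vf)) = Vf * X F"
  proof -
    have "Vf * (X F * (sh Wf * sh Vf)) = Vf * (X F * sh (one F)) - Vf * (X F * sh f) * sh s"
      unfolding shWV by (simp add: algebra_simps)
    also have "\<dots> = Vf * X F - (Vf * f) * X A * sh s"
      by (simp add: F' hom_comm[OF f, symmetric] mult.assoc)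
    finally show ?thesis by (simp add: Vf)
  qed
  have "\<exists>K. rk K = r \<and> one K = I \<and> X K = Vf * X F * sh Wf \<and> Y K = sh Vf * Y F * Wf \<and> pre K"
  proof (rule mk_module[OF I])
    have "Vf * X F * sh Wf * (sh Vf * Y F * Wf) = Vf * (X F * (sh Wf * sh Vf)) * Y F * Wf"
      by (simp add: mult.assoc)
    also have "\<dots> = Vf * (X F * Y F) * Wf" unfolding XV by (simp add: mult.assoc)
    also have "\<dots> = sc fps_X I" by (simp add: F' sc_mult_left sc_mult_right mult.assoc *)
    finally show "Vf * X F * sh Wf * (sh Vf * Y F * Wf) = sc fps_X I" .
    have "sh Vf * Y F * Wf * (Vf * X F * sh Wf) = sh Vf * Y F * (Wf * Vf) * X F * sh Wf"
      by (simp add: mult.assoc)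
    also have "\<dots> = sh Vf * (Y F * one F) * X F * sh Wf - sh Vf * (Y F * f) * s * X F * sh Wf"
      unfolding *(6) by (simp add: algebra_simps)
    also have "\<dots> = sh Vf * (Y F * X F) * sh Wf - (sh Vf * sh f) * Y A * s * X F * sh Wf"
      using cm_pre[OF F] cm_pre[OF A] by (simp add: hom_commY[OF _ _ f, symmetric] F' mult.assoc)
    also have "\<dots> = sc fps_X (sh I)"
      by (simp add: F' mult.assoc sc_mult_left sc_mult_right shI)
    finally show "sh Vf * Y F * Wf * (Vf * X F * sh Wf) = sc fps_X (sh I)" .
  qed (simp_all add: mult.assoc shI shI(3)[THEN asc] * *(1)[THEN asc])
  then obtain K where K: "one K = I" "X K = Vf * X F * sh Wf" "pre K" by blast
  have W: "hom F K Vf" using XV by (simp add: hom_def zmap_def K * mult.assoc)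
  have Wz: "zmap K F Wf" by (simp add: zmap_def K *)
  have "cm k n K" by (rule cm_quot[OF K(3) F W Wz]) (simp add: * K)
  moreover have "splits A f F Vf K s Wf" using Wz s by (simp add: splits_def * K)
  ultimately show ?thesis using W F A f unfolding sexact_def by blast
qed

end

lemma emb_four_block:
  assumes "A \<in> carrier_mat a b" "D \<in> carrier_mat p q"
  shows "emb (four_block_mat A (0\<^sub>m a q) (0\<^sub>m p b) D) = emb A + shift a p * emb D * unshift b q"
  by (rule fmat_eqI) (use assms in \<open>auto simp: ent_emb ent_shift_mult ent_mult_unshift\<close>)

section \<open>Direct sums, pullbacks and pushouts\<close>

context quiver
begin

text \<open>The first summand occupies the leading coordinates, and the infinite matrices carry no
  size, so both its inclusion and its projection are the idempotent of \<open>M\<close>.\<close>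

definition in1 :: "bmod \<Rightarrow> bmod \<Rightarrow> zfam" where
  "in1 M N = one M"
definition pr1 :: "bmod \<Rightarrow> bmod \<Rightarrow> zfam" where
  "pr1 M N = one M"
definition in2 :: "bmod \<Rightarrow> bmod \<Rightarrow> zfam" where
  "in2 M N = (\<lambda>j. if j \<in> V then shift (rk M j) (rk N j) else 0)"
definition pr2 :: "bmod \<Rightarrow> bmod \<Rightarrow> zfam" where
  "pr2 M N = (\<lambda>j. if j \<in> V then unshift (rk M j) (rk N j) else 0)"

lemma one_dsum: "one (dsum n M N) = (\<lambda>j. if j \<in> V then idn (rk M j + rk N j) else 0)"
  by (rule ext) (simp add: one_def dsum_def)

lemma dsum_simps:
  "pr1 M N * in1 M N = one M" "pr2 M N * in2 M N = one N" "pr1 M N * in2 M N = 0" "pr2 M N * in1 M N = 0"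
  "in1 M N * pr1 M N + in2 M N * pr2 M N = one (dsum n M N)"
  by (rule ext; simp add: in1_def pr1_def in2_def pr2_def shift_simps one_dsum; simp add: one_def shift_simps)+

lemma dsum_zmap:
  "zmap M (dsum n M N) (in1 M N)" "zmap N (dsum n M N) (in2 M N)"
  "zmap (dsum n M N) M (pr1 M N)" "zmap (dsum n M N) N (pr2 M N)"
  unfolding zmap_def one_dsum
  by (intro conjI ext; simp add: in1_def pr1_def in2_def pr2_def one_def shift_simps min_absorb1 min_absorb2)+

lemma dsum_X:
  assumes "pre M" "pre N"
  shows "X (dsum n M N) = in1 M N * X M * sh (pr1 M N) + in2 M N * X N * sh (pr2 M N)"
    and "Y (dsum n M N) = sh (in1 M N) * Y M * pr1 M N + sh (in2 M N) * Y N * pr2 M N"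
proof -
  show "X (dsum n M N) = in1 M N * X M * sh (pr1 M N) + in2 M N * X N * sh (pr2 M N)"
  proof
    fix j
    show "X (dsum n M N) j = (in1 M N * X M * sh (pr1 M N) + in2 M N * X N * sh (pr2 M N)) j"
    proof (cases "j \<in> V")
      case True
      then have c: "xm M j \<in> carrier_mat (rk M j) (rk M (c (j - 1)))" "xm N j \<in> carrier_mat (rk N j) (rk N (c (j - 1)))"
        using assms by (auto simp: pre_def)
      then show ?thesis using True
        by (simp add: X_def fm_def dsum_def emb_four_block in1_def pr1_def in2_def pr2_def sh_def one_def emb_carrier)
    qed (simp add: X_def fm_def in1_def in2_def one_def)
  qed
  show "Y (dsum n M N) = sh (in1 M N) * Y M * pr1 M N + sh (in2 M N) * Y N * pr2 M N"
  proof
    fix j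
    show "Y (dsum n M N) j = (sh (in1 M N) * Y M * pr1 M N + sh (in2 M N) * Y N * pr2 M N) j"
    proof (cases "j \<in> V")
      case True
      then have c: "ym M j \<in> carrier_mat (rk M (c (j - 1))) (rk M j)" "ym N j \<in> carrier_mat (rk N (c (j - 1))) (rk N j)"
        using assms by (auto simp: pre_def)
      then show ?thesis using True
        by (simp add: Y_def fm_def dsum_def emb_four_block in1_def pr1_def in2_def pr2_def sh_def one_def emb_carrier)
    qed (simp add: Y_def fm_def sh_def)
  qed
qed

lemma preI:
  assumes "\<And>j. j \<in> V \<Longrightarrow> xm M j \<in> carrier_mat (rk M j) (rk M (c (j - 1)))"
    "\<And>j. j \<in> V \<Longrightarrow> ym M j \<in> carrier_mat (rk M (c (j - 1))) (rk M j)"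
    "X M * Y M = sc fps_X (one M)" "Y M * X M = sc fps_X (sh (one M))"
  shows "pre M"
  unfolding pre_def
proof (intro ballI conjI assms)
  fix j assume j: "j \<in> V"
  note c = assms(1,2)[OF j]
  show "xm M j * ym M j = fps_X \<cdot>\<^sub>m 1\<^sub>m (rk M j)"
    using fun_cong[OF assms(3), of j] c j
    by (intro emb_inject[of _ "rk M j" "rk M j"]) (auto simp: emb_mult emb_smult emb_idn X_def Y_def fm_def one_def)
  show "ym M j * xm M j = fps_X \<cdot>\<^sub>m 1\<^sub>m (rk M (c (j - 1)))"
    using fun_cong[OF assms(4), of j] c j
    by (intro emb_inject[of _ "rk M (c (j - 1))" "rk M (c (j - 1))"])
       (auto simp: emb_mult emb_smult emb_idn X_def Y_def fm_def one_def sh_def)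
qed

lemma dsum_sh:
  "sh (pr1 M N) * sh (in1 M N) = sh (one M)" "sh (pr2 M N) * sh (in2 M N) = sh (one N)"
  "sh (pr1 M N) * sh (in2 M N) = 0" "sh (pr2 M N) * sh (in1 M N) = 0"
  by (simp_all only: sh_simps(1)[symmetric] dsum_simps sh_simps(5))

lemma dsum_one:
  "in1 M N * one M = in1 M N" "in2 M N * one N = in2 M N" "one M * pr1 M N = pr1 M N" "one N * pr2 M N = pr2 M N"
  "one (dsum n M N) * in1 M N = in1 M N" "one (dsum n M N) * in2 M N = in2 M N"
  "pr1 M N * one (dsum n M N) = pr1 M N" "pr2 M N * one (dsum n M N) = pr2 M N"
  using dsum_zmap[where M=M and N=N] by (simp_all add: zmap_def)

lemma cm_dsum:
  assumes M: "cm k n M" and N: "cm k n N"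
  shows "cm k n (dsum n M N)" "hom M (dsum n M N) (in1 M N)" "hom N (dsum n M N) (in2 M N)"
    "hom (dsum n M N) M (pr1 M N)" "hom (dsum n M N) N (pr2 M N)"
proof -
  note p = cm_pre[OF M] cm_pre[OF N]
  let ?D = "dsum n M N"
  note xs = dsum_X[OF p] and sM = X_simps[OF p(1)] and sN = X_simps[OF p(2)]
  have "X ?D * Y ?D = sc fps_X (in1 M N * pr1 M N + in2 M N * pr2 M N)"
    by (simp add: xs distrib_left distrib_right mult.assoc dsum_sh dsum_sh[THEN asc] sM sN
        sM(3)[THEN asc] sN(3)[THEN asc] sM(5)[THEN asc] sN(5)[THEN asc] sc_mult_left sc_mult_right
        dsum_one dsum_one[THEN asc] sc_ring)
  then have xy: "X ?D * Y ?D = sc fps_X (one ?D)" by (simp only: dsum_simps)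
  have "Y ?D * X ?D = sc fps_X (sh (in1 M N) * sh (pr1 M N) + sh (in2 M N) * sh (pr2 M N))"
    by (simp add: xs distrib_left distrib_right mult.assoc dsum_simps(1-4) dsum_simps(1-4)[THEN asc] sM sN
        sM(1)[THEN asc] sN(1)[THEN asc] sM(6)[THEN asc] sN(6)[THEN asc] sc_mult_left sc_mult_right
        sh_simps(1)[symmetric] dsum_one sc_ring)
  also have "\<dots> = sc fps_X (sh (in1 M N * pr1 M N + in2 M N * pr2 M N))" by (simp add: sh_simps)
  finally have yx: "Y ?D * X ?D = sc fps_X (sh (one ?D))" by (simp only: dsum_simps)
  have pre: "pre ?D"
    by (rule preI[OF _ _ xy yx]) (use p in \<open>auto simp: pre_def dsum_def\<close>)
  show h: "hom M ?D (in1 M N)" "hom N ?D (in2 M N)" "hom ?D M (pr1 M N)" "hom ?D N (pr2 M N)"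
    using dsum_zmap[where M=M and N=N]
    by (simp_all add: hom_def xs distrib_left distrib_right mult.assoc dsum_sh dsum_simps(1-4)
        dsum_simps(1-4)[THEN asc] sM sN sM(1)[THEN asc] sN(1)[THEN asc])
  have "defect ?D j = 0" if j: "j \<in> V" for j
  proof -
    have "pr1 M N (c (j + int k)) * defect ?D j = 0" "pr2 M N (c (j + int k)) * defect ?D j = 0"
      using hom_defect[OF pre p(1) h(3) j] hom_defect[OF pre p(2) h(4) j] M N j by (simp_all add: cm_iff)
    then have "(in1 M N * pr1 M N + in2 M N * pr2 M N) (c (j + int k)) * defect ?D j = 0"
      by (simp add: distrib_right mult.assoc)
    then show ?thesis
      using XP_one[OF pre j, of k] XP_one[OF pre j, of "n - k"]
      by (simp only: dsum_simps defect_def right_diff_distrib cyc_k)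
  qed
  then show "cm k n ?D" using pre by (simp add: cm_iff)
qed

text \<open>\<open>F\<close> is the kernel of the difference of \<open>p\<close> and
  \<open>h\<close> on \<open>I \<oplus> M\<close>, which is onto since \<open>p\<close> is; its
  universal property is \<open>sexact_lift\<close>.\<close>

lemma pullback:
  assumes se: "sexact A i I p S" and M: "cm k n M" and h: "hom M S h"
  shows "\<exists>F f g q. sexact A f F g M \<and> hom F I q \<and> q * f = i \<and> p * q = h * g \<and>
    (\<forall>L a b. pre L \<longrightarrow> hom L I a \<longrightarrow> hom L M b \<longrightarrow> p * a = h * b \<longrightarrow>
       (\<exists>e. hom L F e \<and> q * e = a \<and> g * e = b))"
proof -
  from se obtain r s where *: "cm k n A" "cm k n I" "cm k n S" "hom A I i" "hom I S p"
    "zmap I A r" "zmap S I s" "r * i = one A" "p * s = one S" "i * r + s * p = one I"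
    "p * i = 0" "r * s = 0" by (rule sexactE)
  let ?D = "dsum n I M"
  let ?i1 = "in1 I M" and ?i2 = "in2 I M" and ?p1 = "pr1 I M" and ?p2 = "pr2 I M"
  note D = cm_dsum[OF *(2) M] and ds = dsum_simps[where M=I and N=M] and d1 = dsum_one[where M=I and N=M]
  define d where "d = p * ?p1 - h * ?p2"
  have d: "hom ?D S d" unfolding d_def using D * h by (intro hom_diff hom_mult)
  have ones: "p * one I = p" "h * one M = h" "one S * h = h" "one I * i = i" "one A * r = r" "r * one I = r" "s * one S = s" "one I * s = s"
    using * h by (simp_all add: homD zmapD)
  have ds': "zmap S ?D (?i1 * s)" "d * (?i1 * s) = one S"
    using dsum_zmap[where M=I and N=M] *(7) by (auto intro: zmap_mult)
      (simp add: d_def left_diff_distrib mult.assoc ds(1-4)[THEN asc] ones ones[THEN asc] *)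
  obtain F e where F: "sexact F e ?D d S" using kernel_module[OF D(1) *(3) d ds'] by blast
  then obtain r' s' where F': "cm k n F" "hom F ?D e" "zmap ?D F r'" "r' * e = one F" "e * r' + s' * d = one ?D" "d * e = 0"
    by (rule sexactE)
  define q where "q = ?p1 * e"
  define g where "g = ?p2 * e"
  have qg: "hom F I q" "hom F M g" unfolding q_def g_def using D F' by (auto intro: hom_mult)
  have pq: "p * q = h * g" using F'(6) by (simp add: q_def g_def d_def left_diff_distrib mult.assoc)
  have e: "e = ?i1 * q + ?i2 * g"
    using ds(5) homD(1)[OF F'(2)] by (metis q_def g_def distrib_right mult.assoc)
  have univ: "\<exists>x. hom L F x \<and> q * x = a \<and> g * x = b"
    if L: "pre L" "hom L I a" "hom L M b" and ab: "p * a = h * b" for L a b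
  proof -
    have "hom L ?D (?i1 * a + ?i2 * b)" using D L by (intro hom_add hom_mult)
    moreover have "d * (?i1 * a + ?i2 * b) = 0"
      by (simp add: d_def algebra_simps ds(1-4)[THEN asc] ds(1-4) ones homD[OF L(2)] homD[OF L(3)] ab)
    ultimately obtain x where x: "hom L F x" "e * x = ?i1 * a + ?i2 * b"
      using sexact_lift[OF F _ _ L(1)] by blast
    then have "q * x = a" "g * x = b"
      by (simp_all add: q_def g_def mult.assoc distrib_left ds(1-4)[THEN asc] homD[OF L(2)] homD[OF L(3)])
    then show ?thesis using x by blast
  qed
  obtain f where f: "hom A F f" "q * f = i" "g * f = 0"
    using univ[of A i 0] * cm_pre[OF *(1)] by auto
  \<comment> \<open>A linear section over \<open>M\<close>: the pair with components
    \<open>s * h\<close> and the identity lies in the kernel of \<open>d\<close>, and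
    \<open>r'\<close> moves it into \<open>F\<close>.\<close>
  define y where "y = ?i1 * s * h + ?i2"
  define sg where "sg = r' * y"
  have dz: "d * y = 0"
    by (simp add: y_def d_def algebra_simps ds(1-4)[THEN asc] ds(1-4) ones ones[THEN asc] *(9)[THEN asc])
  have "one ?D * y = y" by (simp add: y_def distrib_left d1 mult.assoc d1[THEN asc])
  then have "(e * r' + s' * d) * y = y" unfolding F'(5) .
  then have esg: "e * sg = y"
    by (simp add: sg_def distrib_right mult.assoc dz)
  have "g * sg = ?p2 * (e * sg)" by (simp add: g_def mult.assoc)
  then have gsg: "g * sg = one M" by (simp add: esg y_def distrib_left mult.assoc ds(1-4)[THEN asc] ds)
  have zsg: "zmap M F sg" unfolding sg_def y_def
    using F'(3) dsum_zmap[where M=I and N=M] *(7) h by (intro zmap_mult[OF F'(3)] zmap_add zmap_mult[OF dsum_zmap(1)] zmap_mult[OF *(7)])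
      (auto intro: hom_zmap zmap_mult)
  have zrq: "zmap F A (r * q)" using *(6) qg(1) by (auto intro: zmap_mult hom_zmap)
  have "e * (f * (r * q) + sg * g) = (?i1 * (q * f) + ?i2 * (g * f)) * (r * q) + (e * sg) * g"
    by (simp add: e distrib_left distrib_right mult.assoc)
  also have "\<dots> = ?i1 * ((i * r) * q + s * (h * g)) + ?i2 * g"
    by (simp add: f esg y_def distrib_left distrib_right mult.assoc)
  also have "(i * r) * q + s * (h * g) = (i * r + s * p) * q"
    by (simp add: pq[symmetric] distrib_right mult.assoc)
  also have "\<dots> = q" using *(10) homD[OF qg(1)] by simp
  also have "?i1 * q + ?i2 * g = e * one F" by (simp only: e[symmetric] homD(2)[OF F'(2)])
  finally have "e * (f * (r * q) + sg * g) = e * one F" .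
  moreover have "zmap F F (f * (r * q) + sg * g)"
    by (intro zmap_add zmap_mult[OF hom_zmap[OF f(1)] zrq] zmap_mult[OF zsg hom_zmap[OF qg(2)]])
  ultimately have sum: "f * (r * q) + sg * g = one F" using sexact_mono[OF F _ zmap_one] by blast
  have "splits A f F g M (r * q) sg"
    unfolding splits_def using zrq zsg gsg sum f * by (simp add: mult.assoc)
  then have "sexact A f F g M" unfolding sexact_def using * F' M f qg by blast
  then show ?thesis using qg f pq univ by blast
qed

text \<open>\<open>E\<close> is the cokernel of the map from \<open>A\<close> to
  \<open>F \<oplus> N\<close> with components \<open>f\<close> and \<open>- h\<close>.\<close>

lemma pushout:
  assumes se: "sexact A f F g M" and N: "cm k n N" and h: "hom A N h"
  shows "\<exists>E u w v. sexact N u E v M \<and> hom F E w \<and> w * f = u * h"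
proof -
  from se obtain r s where *: "cm k n A" "cm k n F" "cm k n M" "hom A F f" "hom F M g"
    "zmap F A r" "zmap M F s" "r * f = one A" "g * s = one M" "f * r + s * g = one F"
    "g * f = 0" "r * s = 0" by (rule sexactE)
  let ?D = "dsum n F N"
  let ?i1 = "in1 F N" and ?i2 = "in2 F N" and ?p1 = "pr1 F N" and ?p2 = "pr2 F N"
  note D = cm_dsum[OF *(2) N] and ds = dsum_simps[where M=F and N=N] and d1 = dsum_one[where M=F and N=N]
  define d where "d = ?i1 * f - ?i2 * h"
  have d: "hom A ?D d" unfolding d_def using D * h by (intro hom_diff hom_mult)
  have ones: "one F * f = f" "one N * h = h" "h * one A = h" "g * one F = g" "one A * r = r" "r * one F = r" "s * one M = s" "one F * s = s"
    using * h by (simp_all add: homD zmapD)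
  have ds': "zmap ?D A (r * ?p1)" "r * ?p1 * d = one A"
    using dsum_zmap[where M=F and N=N] *(6) by (auto intro: zmap_mult)
      (simp add: d_def right_diff_distrib mult.assoc ds(1-4)[THEN asc] ones ones[THEN asc] *)
  obtain E e where E: "sexact A d ?D e E" using cokernel_module[OF *(1) D(1) d ds'] by blast
  then obtain r' s' where E': "cm k n E" "hom ?D E e" "zmap E ?D s'" "e * s' = one E" "d * r' + s' * e = one ?D" "e * d = 0"
    by (rule sexactE)
  define w where "w = e * ?i1"
  define u where "u = e * ?i2"
  have wu: "hom F E w" "hom N E u" unfolding w_def u_def using D E' by (auto intro: hom_mult)
  have wf: "w * f = u * h" using E'(6) by (simp add: w_def u_def d_def right_diff_distrib mult.assoc)
  have "hom ?D M (g * ?p1)" using D * by (auto intro: hom_mult)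
  moreover have "g * ?p1 * d = 0"
    by (simp add: d_def right_diff_distrib mult.assoc ds(1-4)[THEN asc] ones ones[THEN asc] *)
  ultimately obtain v where v: "hom E M v" "v * e = g * ?p1"
    using sexact_colift[OF E _ _ cm_pre[OF *(3)]] by blast
  have vw: "v * w = g" "v * u = 0"
    by (simp_all add: w_def u_def v(2)[THEN asc] mult.assoc ds(1-4) ones)
  \<comment> \<open>A linear retraction onto \<open>N\<close> that kills the image of
    \<open>d\<close>, hence descends to the cokernel \<open>E\<close> and retracts
    \<open>u\<close>.\<close>
  define b where "b = ?p2 + h * r * ?p1"
  have bd: "b * d = 0"
    by (simp add: b_def d_def algebra_simps ds(1-4)[THEN asc] ds(1-4) ones ones[THEN asc] *(8)[THEN asc] *)
  have b1: "zmap ?D N b" unfolding b_def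
    by (intro zmap_add dsum_zmap zmap_mult[OF zmap_mult[OF hom_zmap[OF h] *(6)] dsum_zmap(3)])
  have "b * (d * r' + s' * e) = b" unfolding E'(5) using b1 by (simp add: zmapD)
  then have bs: "b * s' * e = b" by (simp add: distrib_left bd mult.assoc[symmetric])
  have bsu: "b * s' * u = one N"
    unfolding u_def mult.assoc[symmetric] bs by (simp add: b_def distrib_right mult.assoc ds)
  have zb: "zmap E N (b * s')" using b1 E'(3) by (rule zmap_mult)
  have zw: "zmap M E (w * s)" using wu *(7) by (auto intro: zmap_mult hom_zmap)
  have "(u * (b * s') + w * s * v) * e = u * (b * s' * e) + w * s * (v * e)"
    by (simp add: distrib_right mult.assoc)
  also have "\<dots> = u * b + w * s * (g * ?p1)" unfolding bs v(2) ..
  also have "\<dots> = u * ?p2 + (u * h) * r * ?p1 + w * (s * g) * ?p1"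
    by (simp add: b_def distrib_left mult.assoc)
  also have "\<dots> = u * ?p2 + w * (f * r + s * g) * ?p1"
    unfolding wf[symmetric] by (simp add: distrib_left distrib_right mult.assoc)
  also have "\<dots> = e * (?i1 * ?p1 + ?i2 * ?p2)"
    using homD[OF wu(1)] unfolding *(10) by (simp add: w_def u_def distrib_left mult.assoc)
  also have "\<dots> = one E * e" unfolding ds(5) using homD[OF E'(2)] by simp
  finally have "(u * (b * s') + w * s * v) * e = one E * e" .
  moreover have "zmap E E (u * (b * s') + w * s * v)"
    by (intro zmap_add zmap_mult[OF hom_zmap[OF wu(2)] zb] zmap_mult[OF zw hom_zmap[OF v(1)]])
  ultimately have sum: "u * (b * s') + w * s * v = one E" using sexact_epi[OF E _ zmap_one] by blast
  have "splits N u E v M (b * s') (w * s)"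
    unfolding splits_def using zb zw bsu sum * by (simp add: mult.assoc[symmetric] vw)
  then have "sexact N u E v M" unfolding sexact_def using * E' N wu v by blast
  then show ?thesis using wu wf by blast
qed

section \<open>Projectives, injectives and the stable category\<close>

definition proj :: "bmod \<Rightarrow> bool" where
  "proj P \<longleftrightarrow> cm k n P \<and> (\<forall>A f E g C h. sexact A f E g C \<longrightarrow> hom P C h \<longrightarrow> (\<exists>h'. hom P E h' \<and> g * h' = h))"

definition inj_mod :: "bmod \<Rightarrow> bool" where
  "inj_mod I \<longleftrightarrow> cm k n I \<and> (\<forall>A f E g C h. sexact A f E g C \<longrightarrow> hom A I h \<longrightarrow> (\<exists>h'. hom E I h' \<and> h' * f = h))"

lemma proj_cm: "proj P \<Longrightarrow> cm k n P" and inj_cm: "inj_mod I \<Longrightarrow> cm k n I"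
  by (simp_all add: proj_def inj_mod_def)

lemma proj_lift: "proj P \<Longrightarrow> sexact A f E g C \<Longrightarrow> hom P C h \<Longrightarrow> \<exists>h'. hom P E h' \<and> g * h' = h"
  unfolding proj_def by blast

lemma inj_extend: "inj_mod I \<Longrightarrow> sexact A f E g C \<Longrightarrow> hom A I h \<Longrightarrow> \<exists>h'. hom E I h' \<and> h' * f = h"
  unfolding inj_mod_def by blast

lemma fam_eq_comp_iff:
  assumes "f \<in> Hom n L M" "g \<in> Hom n M N" "h \<in> Hom n L N"
  shows "fam_eq n (g \<circ>\<^sub>f f) h \<longleftrightarrow> fm g * fm f = fm h"
proof -
  have "(g \<circ>\<^sub>f f) j \<in> carrier_mat (rk N j) (rk L j)" "h j \<in> carrier_mat (rk N j) (rk L j)" if "j \<in> V" for j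
    using assms[THEN Hom_carrier, OF that] by (auto simp: fcomp_def)
  then have "fm (g \<circ>\<^sub>f f) = fm h \<longleftrightarrow> fam_eq n (g \<circ>\<^sub>f f) h" by (rule fm_eq_iff)
  then show ?thesis using fm_comp[OF assms(1,2)] by simp
qed

lemma fam_eq_comp2_iff:
  assumes "f \<in> Hom n L M" "g \<in> Hom n M N" "f' \<in> Hom n L M'" "g' \<in> Hom n M' N"
  shows "fam_eq n (g \<circ>\<^sub>f f) (g' \<circ>\<^sub>f f') \<longleftrightarrow> fm g * fm f = fm g' * fm f'"
proof -
  have "(g \<circ>\<^sub>f f) j \<in> carrier_mat (rk N j) (rk L j)" "(g' \<circ>\<^sub>f f') j \<in> carrier_mat (rk N j) (rk L j)" if "j \<in> V" for j
    using assms[THEN Hom_carrier, OF that] by (auto simp: fcomp_def)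
  then have "fm (g \<circ>\<^sub>f f) = fm (g' \<circ>\<^sub>f f') \<longleftrightarrow> fam_eq n (g \<circ>\<^sub>f f) (g' \<circ>\<^sub>f f')" by (rule fm_eq_iff)
  then show ?thesis using fm_comp[OF assms(1,2)] fm_comp[OF assms(3,4)] by simp
qed

lemma fam_id_Hom: "pre M \<Longrightarrow> fam_id M \<in> Hom n M M"
  by (auto simp: Hom_def fam_id_def pre_def)

lemma Hom_comp:
  assumes f: "f \<in> Hom n L M" and g: "g \<in> Hom n M N" and p: "pre L" "pre M" "pre N"
  shows "g \<circ>\<^sub>f f \<in> Hom n L N"
  unfolding Hom_def
proof (intro CollectI ballI conjI)
  fix j assume j: "j \<in> V"
  let ?i = "c (j - 1)"
  note fc = Hom_carrier[OF f j] Hom_carrier[OF f cyc_in, of "j - 1"]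
  note gc = Hom_carrier[OF g j] Hom_carrier[OF g cyc_in, of "j - 1"]
  have x: "xm L j \<in> carrier_mat (rk L j) (rk L ?i)" "xm M j \<in> carrier_mat (rk M j) (rk M ?i)"
    "xm N j \<in> carrier_mat (rk N j) (rk N ?i)"
    and y: "ym L j \<in> carrier_mat (rk L ?i) (rk L j)" "ym M j \<in> carrier_mat (rk M ?i) (rk M j)"
    "ym N j \<in> carrier_mat (rk N ?i) (rk N j)"
    using p j by (auto simp: pre_def)
  have fx: "f j * xm L j = xm M j * f ?i" "f ?i * ym L j = ym M j * f j"
    and gx: "g j * xm M j = xm N j * g ?i" "g ?i * ym M j = ym N j * g j"
    using f g j by (auto simp: Hom_def)
  show "(g \<circ>\<^sub>f f) j \<in> carrier_mat (rk N j) (rk L j)" using fc gc by (auto simp: fcomp_def)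
  show "(g \<circ>\<^sub>f f) j * xm L j = xm N j * (g \<circ>\<^sub>f f) ?i"
    unfolding fcomp_def assoc_mult_mat[OF gc(1) fc(1) x(1)] fx assoc_mult_mat[OF x(3) gc(2) fc(2), symmetric]
      gx(1)[symmetric] assoc_mult_mat[OF gc(1) x(2) fc(2)] ..
  show "(g \<circ>\<^sub>f f) ?i * ym L j = ym N j * (g \<circ>\<^sub>f f) j"
    unfolding fcomp_def assoc_mult_mat[OF gc(2) fc(2) y(1)] fx assoc_mult_mat[OF y(3) gc(1) fc(1), symmetric]
      gx(2)[symmetric] assoc_mult_mat[OF gc(2) y(2) fc(1)] ..
qed

lemma projective_iff: "projective k n P \<longleftrightarrow> proj P"
proof
  assume P: "projective k n P"
  show "proj P" unfolding proj_def
  proof (intro conjI allI impI)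
    show "cm k n P" using P by (simp add: projective_def)
    fix A f E g C h assume se: "sexact A f E g C" and h: "hom P C h"
    have p: "pre P" "pre E" "pre C" and g: "hom E C g"
      using se P by (auto simp: sexact_def projective_def intro: cm_pre)
    have "\<exists>h'\<in>Hom n P E. fam_eq n (un E C g \<circ>\<^sub>f h') (un P C h)"
      using P sexact_short_exact[OF se] un_Hom[OF p(1,3) h] unfolding projective_def by blast
    then obtain h' where "h' \<in> Hom n P E" "fm (un E C g) * fm h' = fm (un P C h)"
      using fam_eq_comp_iff un_Hom[OF p(2,3) g] un_Hom[OF p(1,3) h] by blast
    then show "\<exists>h'. hom P E h' \<and> g * h' = h" using p g h by (metis Hom_hom fm_un hom_zmap)
  qed
next
  assume P: "proj P"
  show "projective k n P" unfolding projective_def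
  proof (intro conjI allI impI ballI)
    show "cm k n P" using P by (rule proj_cm)
    fix A f E g C h assume se: "short_exact k n A f E g C" and h: "h \<in> Hom n P C"
    have se': "sexact A (fm f) E (fm g) C" "g \<in> Hom n E C" using se by (auto simp: short_exact_iff)
    then have p: "pre P" "pre E" "pre C" using P by (auto simp: sexact_def proj_def intro: cm_pre)
    obtain h' where h': "hom P E h'" "fm g * h' = fm h"
      using proj_lift[OF P se'(1) Hom_hom[OF h p(1,3)]] by blast
    then show "\<exists>h'\<in>Hom n P E. fam_eq n (g \<circ>\<^sub>f h') h"
      using fam_eq_comp_iff[OF un_Hom[OF p(1,2) h'(1)] se'(2) h] fm_un[OF hom_zmap[OF h'(1)]] un_Hom[OF p(1,2) h'(1)]
      by auto
  qed
qed

lemma injective_iff: "injective k n I \<longleftrightarrow> inj_mod I"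
proof
  assume P: "injective k n I"
  show "inj_mod I" unfolding inj_mod_def
  proof (intro conjI allI impI)
    show "cm k n I" using P by (simp add: injective_def)
    fix A f E g C h assume se: "sexact A f E g C" and h: "hom A I h"
    have p: "pre I" "pre E" "pre A" and f: "hom A E f"
      using se P by (auto simp: sexact_def injective_def intro: cm_pre)
    have "\<exists>h'\<in>Hom n E I. fam_eq n (h' \<circ>\<^sub>f un A E f) (un A I h)"
      using P sexact_short_exact[OF se] un_Hom[OF p(3,1) h] unfolding injective_def by blast
    then obtain h' where "h' \<in> Hom n E I" "fm h' * fm (un A E f) = fm (un A I h)"
      using fam_eq_comp_iff un_Hom[OF p(3,2) f] un_Hom[OF p(3,1) h] by blast
    then show "\<exists>h'. hom E I h' \<and> h' * f = h" using p f h by (metis Hom_hom fm_un hom_zmap)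
  qed
next
  assume P: "inj_mod I"
  show "injective k n I" unfolding injective_def
  proof (intro conjI allI impI ballI)
    show "cm k n I" using P by (rule inj_cm)
    fix A f E g C h assume se: "short_exact k n A f E g C" and h: "h \<in> Hom n A I"
    have se': "sexact A (fm f) E (fm g) C" "f \<in> Hom n A E" using se by (auto simp: short_exact_iff)
    then have p: "pre I" "pre E" "pre A" using P by (auto simp: sexact_def inj_mod_def intro: cm_pre)
    obtain h' where h': "hom E I h'" "h' * fm f = fm h"
      using inj_extend[OF P se'(1) Hom_hom[OF h p(3,1)]] by blast
    then show "\<exists>h'\<in>Hom n E I. fam_eq n (h' \<circ>\<^sub>f f) h"
      using fam_eq_comp_iff[OF se'(2) un_Hom[OF p(2,1) h'(1)] h] fm_un[OF hom_zmap[OF h'(1)]] un_Hom[OF p(2,1) h'(1)]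
      by auto
  qed
qed

lemma proj_dsum:
  assumes "proj P" "proj Q"
  shows "proj (dsum n P Q)"
  unfolding proj_def
proof (intro conjI allI impI)
  note D = cm_dsum[OF assms[THEN proj_cm]]
  show "cm k n (dsum n P Q)" by (rule D)
  fix A f E g C h assume se: "sexact A f E g C" and h: "hom (dsum n P Q) C h"
  obtain a b where ab: "hom P E a" "g * a = h * in1 P Q" "hom Q E b" "g * b = h * in2 P Q"
    using proj_lift[OF assms(1) se hom_mult[OF h D(2)]] proj_lift[OF assms(2) se hom_mult[OF h D(3)]] by blast
  have "g * (a * pr1 P Q + b * pr2 P Q) = h * (in1 P Q * pr1 P Q + in2 P Q * pr2 P Q)"
    by (simp add: distrib_left mult.assoc[symmetric] ab)
  also have "\<dots> = h" unfolding dsum_simps using homD[OF h] by simp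
  finally show "\<exists>h'. hom (dsum n P Q) E h' \<and> g * h' = h"
    using ab D by (intro exI[of _ "a * pr1 P Q + b * pr2 P Q"]) (auto intro!: hom_add hom_mult)
qed

lemma inj_dsum:
  assumes "inj_mod P" "inj_mod Q"
  shows "inj_mod (dsum n P Q)"
  unfolding inj_mod_def
proof (intro conjI allI impI)
  note D = cm_dsum[OF assms[THEN inj_cm]]
  show "cm k n (dsum n P Q)" by (rule D)
  fix A f E g C h assume se: "sexact A f E g C" and h: "hom A (dsum n P Q) h"
  obtain a b where ab: "hom E P a" "a * f = pr1 P Q * h" "hom E Q b" "b * f = pr2 P Q * h"
    using inj_extend[OF assms(1) se hom_mult[OF D(4) h]] inj_extend[OF assms(2) se hom_mult[OF D(5) h]] by blast
  have "(in1 P Q * a + in2 P Q * b) * f = (in1 P Q * pr1 P Q + in2 P Q * pr2 P Q) * h"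
    by (simp add: distrib_right mult.assoc ab)
  also have "\<dots> = h" unfolding dsum_simps using homD[OF h] by simp
  finally show "\<exists>h'. hom E (dsum n P Q) h' \<and> h' * f = h"
    using ab D by (intro exI[of _ "in1 P Q * a + in2 P Q * b"]) (auto intro!: hom_add hom_mult)
qed

section \<open>The ideal of maps that factor through a projective\<close>

definition stable0 :: "bmod \<Rightarrow> bmod \<Rightarrow> zfam \<Rightarrow> bool" where
  "stable0 M N F \<longleftrightarrow> (\<exists>P a b. proj P \<and> hom M P a \<and> hom P N b \<and> F = b * a)"

lemma stable0I: "proj P \<Longrightarrow> hom M P a \<Longrightarrow> hom P N b \<Longrightarrow> stable0 M N (b * a)"
  unfolding stable0_def by blast

lemma stable0_hom: "stable0 M N F \<Longrightarrow> hom M N F"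
  unfolding stable0_def by (auto intro: hom_mult)

lemma stable0_left: "stable0 M N F \<Longrightarrow> hom N L G \<Longrightarrow> stable0 M L (G * F)"
  unfolding stable0_def by (metis hom_mult mult.assoc)

lemma stable0_right: "stable0 M N F \<Longrightarrow> hom L M G \<Longrightarrow> stable0 L N (F * G)"
  unfolding stable0_def by (metis hom_mult mult.assoc)

lemma stable0_uminus: "stable0 M N F \<Longrightarrow> stable0 M N (- F)"
  unfolding stable0_def by (metis hom_uminus mult_minus_left)

text \<open>Two factorisations combine into one through the direct sum of the projectives.\<close>

lemma stable0_add:
  assumes "stable0 M N F" "stable0 M N G"
  shows "stable0 M N (F + G)"
proof -
  obtain P a b Q a' b' where *: "proj P" "hom M P a" "hom P N b" "F = b * a"
    "proj Q" "hom M Q a'" "hom Q N b'" "G = b' * a'" using assms unfolding stable0_def by blast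
  note D = cm_dsum[OF proj_cm[OF *(1)] proj_cm[OF *(5)]]
  have "(b * pr1 P Q + b' * pr2 P Q) * (in1 P Q * a + in2 P Q * a') = F + G"
    using homD[OF *(2)] homD[OF *(6)]
    by (simp add: * distrib_left distrib_right mult.assoc dsum_simps(1-4)[THEN asc])
  moreover have "stable0 M N ((b * pr1 P Q + b' * pr2 P Q) * (in1 P Q * a + in2 P Q * a'))"
    by (rule stable0I[OF proj_dsum[OF *(1,5)]]) (use * D in \<open>auto intro!: hom_add hom_mult\<close>)
  ultimately show ?thesis by simp
qed

lemma stable0_diff: "stable0 M N F \<Longrightarrow> stable0 M N G \<Longrightarrow> stable0 M N (F - G)"
  using stable0_add[of M N F "- G"] stable0_uminus[of M N G] by simp

lemma stable_eq_iff:
  assumes f: "f \<in> Hom n M N" and g: "g \<in> Hom n M N" and p: "pre M" "pre N"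
  shows "stable_eq k n M N f g \<longleftrightarrow> stable0 M N (fm f - fm g)"
proof -
  have *: "fam_eq n (\<lambda>j. f j - g j) (b \<circ>\<^sub>f a) \<longleftrightarrow> fm f - fm g = fm b * fm a"
    if ab: "a \<in> Hom n M P" "b \<in> Hom n P N" for a b P
  proof -
    have "f j - g j \<in> carrier_mat (rk N j) (rk M j)" "(b \<circ>\<^sub>f a) j \<in> carrier_mat (rk N j) (rk M j)" if j: "j \<in> V" for j
      using Hom_carrier[OF f j] Hom_carrier[OF g j] Hom_carrier[OF ab(1) j] Hom_carrier[OF ab(2) j]
      by (auto simp: fcomp_def intro!: minus_carrier_mat)
    then have "fm (\<lambda>j. f j - g j) = fm (b \<circ>\<^sub>f a) \<longleftrightarrow> fam_eq n (\<lambda>j. f j - g j) (b \<circ>\<^sub>f a)" by (rule fm_eq_iff)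
    then show ?thesis using fm_diff[OF f g] fm_comp[OF ab] by simp
  qed
  show ?thesis
  proof
    assume "stable_eq k n M N f g"
    then obtain P a b where P: "proj P" and ab: "a \<in> Hom n M P" "b \<in> Hom n P N" "fam_eq n (\<lambda>j. f j - g j) (b \<circ>\<^sub>f a)"
      unfolding stable_eq_def projective_iff by blast
    then show "stable0 M N (fm f - fm g)"
      using * p cm_pre[OF proj_cm[OF P]] by (auto intro!: stable0I[OF P] Hom_hom)
  next
    assume "stable0 M N (fm f - fm g)"
    then obtain P a b where P: "proj P" and ab: "hom M P a" "hom P N b" "fm f - fm g = b * a"
      unfolding stable0_def by blast
    have q: "pre P" using P by (auto intro: cm_pre proj_cm)
    have "fm (un P N b) * fm (un M P a) = b * a" using ab by (simp add: fm_un hom_zmap)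
    then have "fam_eq n (\<lambda>j. f j - g j) (un P N b \<circ>\<^sub>f un M P a)"
      using *[OF un_Hom[OF p(1) q ab(1)] un_Hom[OF q p(2) ab(2)]] ab(3) by simp
    then show "stable_eq k n M N f g"
      unfolding stable_eq_def projective_iff using P un_Hom[OF p(1) q ab(1)] un_Hom[OF q p(2) ab(2)] by blast
  qed
qed

definition stable_inv :: "bmod \<Rightarrow> bmod \<Rightarrow> zfam \<Rightarrow> zfam \<Rightarrow> bool" where
  "stable_inv M N f g \<longleftrightarrow> hom M N f \<and> hom N M g \<and> stable0 M M (g * f - one M) \<and> stable0 N N (f * g - one N)"

lemma stable_iso_iff:
  assumes "pre M" "pre N"
  shows "stable_iso k n M N f \<longleftrightarrow> f \<in> Hom n M N \<and> (\<exists>g. stable_inv M N (fm f) g)"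
proof -
  have *: "stable_eq k n M M (g \<circ>\<^sub>f f) (fam_id M) \<and> stable_eq k n N N (f \<circ>\<^sub>f g) (fam_id N) \<longleftrightarrow> stable_inv M N (fm f) (fm g)"
    if "f \<in> Hom n M N" "g \<in> Hom n N M" for g
  proof -
    have c: "g \<circ>\<^sub>f f \<in> Hom n M M" "f \<circ>\<^sub>f g \<in> Hom n N N"
      using Hom_comp that assms by blast+
    show ?thesis
      using Hom_hom[OF that(1) assms] Hom_hom[OF that(2) assms(2,1)]
      by (simp add: stable_eq_iff[OF c(1) fam_id_Hom] stable_eq_iff[OF c(2) fam_id_Hom] assms stable_inv_def
          fm_comp[OF that] fm_comp[OF that(2,1)] fm_id)
  qed
  have "stable_inv M N (fm f) g \<Longrightarrow> \<exists>g'\<in>Hom n N M. stable_inv M N (fm f) (fm g')" for g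
    using un_Hom[OF assms(2,1), of g] by (intro bexI[of _ "un N M g"]) (auto simp: stable_inv_def fm_un hom_zmap)
  then show ?thesis unfolding stable_iso_def using * by blast
qed

section \<open>Rank one modules\<close>

lemma rank_one_simps:
  "one (rank_one I) = (\<lambda>j. if j \<in> V then idn (Suc 0) else 0)"
  "X (rank_one I) = (\<lambda>j. if j \<in> V then (if j \<in> I then idn (Suc 0) else scal fps_X (idn (Suc 0))) else 0)"
  "Y (rank_one I) = (\<lambda>j. if j \<in> V then (if j \<in> I then scal fps_X (idn (Suc 0)) else idn (Suc 0)) else 0)"
  by (rule ext; simp add: one_def X_def Y_def fm_def rank_one_def emb_idn emb_smult)+

lemma pre_rank_one [simp]: "pre (rank_one I)"
proof (rule preI)
  show "X (rank_one I) * Y (rank_one I) = sc fps_X (one (rank_one I))"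
    "Y (rank_one I) * X (rank_one I) = sc fps_X (sh (one (rank_one I)))"
    by (rule ext; simp add: rank_one_simps sh_def scal_mult_left scal_mult_right scal_ring)+
qed (auto simp: rank_one_def)

text \<open>On the vertices, \<open>I\<close> is the cyclic interval of length \<open>k\<close> that
  starts after \<open>a\<close>. Its rank one module is both the projective generated at
  \<open>a\<close> and the injective cogenerated at \<open>a + k\<close>.\<close>

definition itv :: "int \<Rightarrow> int set \<Rightarrow> bool" where
  "itv a I \<longleftrightarrow> (\<forall>j\<in>V. j \<in> I \<longleftrightarrow> (j - a - 1) mod int n < int k)"

lemma vertex_offset:
  assumes "j \<in> V"
  obtains p where "0 < p" "p \<le> n" "j = c (a + int p)" "nat ((j - a - 1) mod int n) + 1 = p"
proof -
  let ?p = "nat ((j - a - 1) mod int n) + 1"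
  have b: "0 \<le> (j - a - 1) mod int n" "(j - a - 1) mod int n < int n"
    using n_pos by simp_all
  have "(j - 1) mod int n = (a + int ?p - 1) mod int n"
    using b by (simp add: algebra_simps) (metis (no_types) add.commute add_diff_cancel_left' diff_diff_eq mod_add_right_eq diff_add_cancel)
  then have "j = c (a + int ?p)" using cyc_id[OF assms] by (simp add: cyc_def)
  then show ?thesis using that[of ?p] b by auto
qed

lemma offset_cyc: "0 < p \<Longrightarrow> p \<le> n \<Longrightarrow> nat ((c (a + int p) - a - 1) mod int n) + 1 = p"
proof -
  assume p: "0 < p" "p \<le> n"
  have "(c (a + int p) - a - 1) mod int n = (int p - 1) mod int n"
    by (simp add: cyc_def algebra_simps) (simp add: mod_diff_left_eq mod_diff_right_eq algebra_simps mod_add_left_eq)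
  also have "\<dots> = int p - 1" using p by (intro mod_pos_pos_trivial) auto
  finally show ?thesis using p by auto
qed

lemma itv_cyc:
  assumes "itv a I" "0 < p" "p \<le> n"
  shows "c (a + int p) \<in> I \<longleftrightarrow> p \<le> k"
proof -
  have "0 \<le> (c (a + int p) - a - 1) mod int n" using n_pos by simp
  then show ?thesis using offset_cyc[OF assms(2,3), of a] assms(1) unfolding itv_def
    by (metis cyc_in Suc_eq_plus1 Suc_le_eq nat_less_iff)
qed

lemma c_add_n: "c (a + int n) = c a"
  using cyc_add_mult[of a 1] by simp

text \<open>The image of the generator is transported along \<open>x\<close> for the first \<open>k\<close> steps and along \<open>y\<close> in the
  other direction.\<close>

lemma hom_from_itv:
  assumes M: "cm k n M" and I: "itv a I" and a: "a \<in> V" and m: "one M a * m = m" "m * idn (Suc 0) = m"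
  shows "\<exists>F. hom (rank_one I) M F \<and> F a = m"
proof -
  note pM = cm_pre[OF M]
  define G where "G p = (if p \<le> k then XP M a p * m else YP M a (n - p) * m)" for p
  define F where "F = (\<lambda>j. if j \<in> V then G (nat ((j - a - 1) mod int n) + 1) else 0)"
  have G0: "G 0 = m" "G n = m" using k_less m pM a by (simp_all add: G_def XP_simps)
  \<comment> \<open>At \<open>p = k\<close> the two descriptions agree by x^k = y^(n-k). The offsets
    0 and \<open>n\<close> name the same vertex, and there both give \<open>m\<close>.\<close>
  have Gk: "G p = YP M a (n - p) * m" if "k \<le> p" for p
    using that M a by (auto simp: G_def cm_iff defect_def)
  have F: "F (c (a + int p)) = G p" if "p \<le> n" for p
  proof (cases "p = 0")
    case True
    have "F (c (a + int n)) = G n" using offset_cyc[of n a] k_less by (simp add: F_def)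
    then show ?thesis using True G0 by (simp add: c_add_n)
  next
    case False then show ?thesis using offset_cyc[of p a] that by (simp add: F_def)
  qed
  have G1: "G p * idn (Suc 0) = G p" for p using m by (simp add: G_def mult.assoc)
  have oG: "one M (c (a + int p)) * G p = G p" if "p \<le> n" for p
  proof -
    have "c (a - int (n - p)) = c (a + int p)" using cyc_add_mult[of "a - int (n - p)" 1] that
      by (simp add: of_nat_diff algebra_simps)
    then show ?thesis using XP_one[OF pM a, of p] XP_one[OF pM a, of "n - p"] by (simp add: G_def mult.assoc[symmetric])
  qed
  have Fo: "F j = 0" if "j \<notin> V" for j using that by (simp add: F_def)
  have "one M * F = F"
  proof
    fix j show "(one M * F) j = F j"
    proof (cases "j \<in> V")
      case True
      then obtain p where "p \<le> n" "j = c (a + int p)" by (rule vertex_offset)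
      then show ?thesis using F oG by simp
    qed (simp add: Fo)
  qed
  moreover have "F * one (rank_one I) = F"
    by (rule ext) (simp add: rank_one_simps F_def G1)
  moreover have "F * X (rank_one I) = X M * sh F"
  proof
    fix j show "(F * X (rank_one I)) j = (X M * sh F) j"
    proof (cases "j \<in> V")
      case True
      then obtain p where p: "0 < p" "p \<le> n" "j = c (a + int p)" by (rule vertex_offset)
      then have prev: "sh F j = G (p - 1)"
        using F[of "p - 1"] True by (simp add: sh_def cyc_diff of_nat_diff algebra_simps)
      show ?thesis
      proof (cases "p \<le> k")
        case pk: True
        have "XP M a p = X M j * XP M a (p - 1)"
          using XP_simps(2)[OF pM a, of "p - 1"] p by (simp add: of_nat_diff)
        then have "G p = X M j * G (p - 1)" using pk by (auto simp: G_def mult.assoc)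
        then show ?thesis using pk p prev itv_cyc[OF I p(1,2)] True F[OF p(2)] G1[of p]
          by (simp add: rank_one_simps)
      next
        case pk: False
        have e: "n - (p - 1) = Suc (n - p)" using p by auto
        have "c (a - int (n - p)) = j" using cyc_add_mult[of "a - int (n - p)" 1] p
          by (simp add: of_nat_diff algebra_simps)
        \<comment> \<open>Beyond \<open>k\<close>, going back one vertex means applying y, so
          applying x afterwards yields t times \<open>G p\<close>; x acts on the rank one module by
          t there as well.\<close>
        then have "G (p - 1) = Y M j * (YP M a (n - p) * m)"
          using Gk[of "p - 1"] pk XP_simps(4)[OF pM a, of "n - p"] unfolding e by (simp add: mult.assoc)
        moreover have "(X M * Y M) j = sc fps_X (one M) j" by (simp add: X_simps[OF pM])
        ultimately have "X M j * G (p - 1) = scal fps_X (one M j * G p)"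
          using pk by (simp add: mult.assoc[symmetric] G_def scal_mult_left)
        then show ?thesis using pk p prev itv_cyc[OF I p(1,2)] True F[OF p(2)] G1 oG[OF p(2)]
          by (simp add: rank_one_simps scal_mult_right)
      qed
    qed (simp add: Fo sh_def)
  qed
  ultimately have "hom (rank_one I) M F" by (simp add: hom_def zmap_def)
  moreover have "F a = m" using F[of 0] G0 a by (simp add: cyc_id)
  ultimately show ?thesis by blast
qed

text \<open>Dual to \<open>hom_from_itv\<close>: a functional at the vertex \<open>a + k\<close> is
  pulled back along x from the vertices before it and along y from those after it.\<close>

lemma hom_to_itv:
  assumes M: "cm k n M" and I: "itv a I" and a: "a \<in> V"
    and m: "m * one M (c (a + int k)) = m" "idn (Suc 0) * m = m"
  shows "\<exists>F. hom M (rank_one I) F \<and> F (c (a + int k)) = m"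
proof -
  note pM = cm_pre[OF M]
  define G where "G p = (if p \<le> k then m * XP M (c (a + int p)) (k - p) else m * YP M (c (a + int p)) (p - k))" for p
  define F where "F = (\<lambda>j. if j \<in> V then G (nat ((j - a - 1) mod int n) + 1) else 0)"
  have Gk: "G p = m * YP M (c (a + int p)) (p - k)" if "k \<le> p" for p
    using that pM by (auto simp: G_def XP_simps)
  \<comment> \<open>Again the offsets 0 and \<open>n\<close> are one vertex; the paths x^k and
    y^(n-k) from it to \<open>a + k\<close> agree by the relation.\<close>
  have G0: "G n = G 0" using M k_less by (simp add: G_def c_add_n cm_iff defect_def)
  have F: "F (c (a + int p)) = G p" if "p \<le> n" for p
  proof (cases "p = 0")
    case True
    have "F (c (a + int n)) = G n" using offset_cyc[of n a] k_less by (simp add: F_def)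
    then show ?thesis using True G0 by (simp add: c_add_n)
  next
    case False then show ?thesis using offset_cyc[of p a] that by (simp add: F_def)
  qed
  have G1: "idn (Suc 0) * G p = G p" for p using m by (simp add: G_def mult.assoc[symmetric])
  have oG: "G p * one M (c (a + int p)) = G p" for p
    using XP_one[OF pM cyc_in] by (simp add: G_def mult.assoc)
  have Fo: "F j = 0" if "j \<notin> V" for j using that by (simp add: F_def)
  have "F * one M = F"
  proof
    fix j show "(F * one M) j = F j"
    proof (cases "j \<in> V")
      case True
      then obtain p where "p \<le> n" "j = c (a + int p)" by (rule vertex_offset)
      then show ?thesis using F oG by simp
    qed (simp add: Fo)
  qed
  moreover have "one (rank_one I) * F = F"
    by (rule ext) (simp add: rank_one_simps F_def G1)
  moreover have "F * X M = X (rank_one I) * sh F"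
  proof
    fix j show "(F * X M) j = (X (rank_one I) * sh F) j"
    proof (cases "j \<in> V")
      case True
      then obtain p where p: "0 < p" "p \<le> n" "j = c (a + int p)" by (rule vertex_offset)
      have pj: "c (a + int (p - 1)) = c (j - 1)" using p by (simp add: cyc_diff of_nat_diff algebra_simps)
      then have prev: "sh F j = G (p - 1)" using F[of "p - 1"] True p by (simp add: sh_def)
      show ?thesis
      proof (cases "p \<le> k")
        case pk: True
        have e: "k - (p - 1) = Suc (k - p)" using p pk by auto
        have "p - 1 \<le> k" using pk by simp
        then have "G (p - 1) = m * XP M (c (a + int (p - 1))) (k - (p - 1))" by (simp only: G_def if_True)
        then have "G (p - 1) = m * (XP M j (k - p) * X M j)"
          by (simp only: e pj XP_front(1)[OF pM True])
        then have "G p * X M j = G (p - 1)" using pk p by (auto simp: G_def mult.assoc)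
        then show ?thesis using pk p prev itv_cyc[OF I p(1,2)] True F[OF p(2)] G1[of "p - 1"]
          by (simp add: rank_one_simps)
      next
        case pk: False
        have e: "p - k = Suc (p - 1 - k)" using p pk by auto
        have "k \<le> p" using pk by simp
        then have "G p = m * (YP M (c (j - 1)) (p - 1 - k) * Y M j)"
          by (simp only: Gk e p(3)[symmetric] XP_front(2)[OF pM True])
        moreover have "(Y M * X M) j = sc fps_X (sh (one M)) j" by (simp add: X_simps[OF pM])
        ultimately have "G p * X M j = scal fps_X (m * (YP M (c (j - 1)) (p - 1 - k) * one M (c (j - 1))))"
          using True by (simp add: mult.assoc scal_mult_right sh_def)
        also have "\<dots> = scal fps_X (G (p - 1))"
          using Gk[of "p - 1", unfolded pj] pk XP_one(4)[OF pM cyc_in, of "j - 1" "p - 1 - k"] by simp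
        finally show ?thesis using pk p prev itv_cyc[OF I p(1,2)] True F[OF p(2)] G1[of "p - 1"]
          by (simp add: rank_one_simps scal_mult_left)
      qed
    qed (simp add: Fo sh_def)
  qed
  ultimately have "hom M (rank_one I) F" by (simp add: hom_def zmap_def)
  moreover have "F (c (a + int k)) = m" using F[of k] k_less pM m by (simp add: G_def XP_simps)
  ultimately show ?thesis by blast
qed

text \<open>A homomorphism can be prescribed freely at one vertex and is determined by it. At that
  vertex the linear splitting of the sequence solves the lifting or extension problem, and
  \<open>hom_ext\<close> spreads the equation.\<close>

lemma itv_proj:
  assumes I: "itv a I" and a: "a \<in> V" and cm: "cm k n (rank_one I)"
  shows "proj (rank_one I)" "inj_mod (rank_one I)"
proof -
  show "proj (rank_one I)" unfolding proj_def
  proof (intro conjI allI impI cm)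
    fix A f E g C h assume se: "sexact A f E g C" and h: "hom (rank_one I) C h"
    from se obtain r s where *: "cm k n E" "cm k n C" "hom E C g" "zmap C E s" "g * s = one C"
      by (rule sexactE)
    have "one E * s = s" "h * one (rank_one I) = h" using * homD[OF h] by (simp_all add: zmapD)
    then have "(one E * s) a = s a" "(h * one (rank_one I)) a = h a" by simp_all
    then obtain h' where h': "hom (rank_one I) E h'" "h' a = s a * h a"
      using hom_from_itv[OF *(1) I a, of "s a * h a"] a
      by (auto simp: mult.assoc[symmetric] rank_one_simps) (auto simp: mult.assoc)
    have "(g * h') a = ((g * s) * h) a" using h' by (simp add: mult.assoc)
    also have "\<dots> = h a" using *(5) homD[OF h] by simp
    finally have "g * h' = h"
      using hom_ext[OF _ _ hom_mult[OF *(3) h'(1)] h a] * cm_pre by auto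
    then show "\<exists>h'. hom (rank_one I) E h' \<and> g * h' = h" using h' by blast
  qed
  let ?b = "c (a + int k)"
  show "inj_mod (rank_one I)" unfolding inj_mod_def
  proof (intro conjI allI impI cm)
    fix A f E g C h assume se: "sexact A f E g C" and h: "hom A (rank_one I) h"
    from se obtain r s where *: "cm k n A" "cm k n E" "hom A E f" "zmap E A r" "r * f = one A"
      by (rule sexactE)
    have "r * one E = r" "one (rank_one I) * h = h" using * homD[OF h] by (simp_all add: zmapD)
    then have "(r * one E) ?b = r ?b" "(one (rank_one I) * h) ?b = h ?b" by simp_all
    then obtain h' where h': "hom E (rank_one I) h'" "h' ?b = h ?b * r ?b"
      using hom_to_itv[OF *(2) I a, of "h ?b * r ?b"]
      by (auto simp: mult.assoc rank_one_simps) (auto simp: mult.assoc[symmetric])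
    have "(h' * f) ?b = (h * (r * f)) ?b" using h' by (simp add: mult.assoc)
    also have "\<dots> = h ?b" using *(5) homD[OF h] by simp
    finally have "h' * f = h"
      using hom_ext[OF _ _ hom_mult[OF h'(1) *(3)] h cyc_in] * cm_pre by auto
    then show "\<exists>h'. hom E (rank_one I) h' \<and> h' * f = h" using h' by blast
  qed
qed

end

lemma sum_munit: "(\<Sum>l<r. munit l l) = idn r"
  by (induction r) (simp_all add: idn_Suc)

lemma one_by_one: "idn (Suc 0) * A = A \<Longrightarrow> A * idn (Suc 0) = A \<Longrightarrow> A = scal (ent A 0 0) (idn (Suc 0))"
proof (rule fmat_eqI)
  fix i j assume *: "idn (Suc 0) * A = A" "A * idn (Suc 0) = A"
  show "ent A i j = ent (scal (ent A 0 0) (idn (Suc 0))) i j"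
    using ent_idn_mult[of "Suc 0" A i j] ent_mult_idn[of A "Suc 0" i j] unfolding * by (auto simp: ent_idn split: if_splits)
qed

lemma scal_idn_eq_iff [simp]: "scal a (idn (Suc 0)) = scal b (idn (Suc 0)) \<longleftrightarrow> a = (b :: 'a::comm_ring_1)"
proof
  assume "scal a (idn (Suc 0)) = scal b (idn (Suc 0))"
  then have "ent (scal a (idn (Suc 0))) 0 0 = ent (scal b (idn (Suc 0))) 0 0" by simp
  then show "a = b" by (simp add: ent_idn)
qed simp

text \<open>Compare the traces of \<open>A * B\<close> and \<open>B * A\<close>.\<close>

lemma square_of_inverse:
  fixes A B :: "complex fps mat"
  assumes A: "A \<in> carrier_mat a b" and B: "B \<in> carrier_mat b a"
    and AB: "A * B = x \<cdot>\<^sub>m 1\<^sub>m a" and BA: "B * A = x \<cdot>\<^sub>m 1\<^sub>m b" and x: "x \<noteq> 0"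
  shows "a = b"
proof -
  have "(\<Sum>i<a. (A * B) $$ (i, i)) = (\<Sum>i<a. \<Sum>j<b. A $$ (i, j) * B $$ (j, i))"
    using A B by (auto intro!: sum.cong simp: scalar_prod_def lessThan_atLeast0)
  also have "\<dots> = (\<Sum>j<b. \<Sum>i<a. A $$ (i, j) * B $$ (j, i))" by (rule sum.swap)
  also have "\<dots> = (\<Sum>j<b. (B * A) $$ (j, j))"
    using A B by (auto intro!: sum.cong simp: scalar_prod_def lessThan_atLeast0 mult.commute)
  finally have "of_nat a * x = of_nat b * x" by (simp add: AB BA)
  then show "a = b" using x by simp
qed

lemma nat_eq_Suc: "0 \<le> a \<Longrightarrow> b = a + 1 \<Longrightarrow> nat b = Suc (nat a)" for a b :: int
  by simp

section \<open>Heights of lattice paths and canonical maps between rank one modules\<close>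

context quiver
begin

text \<open>The lattice path of a \<open>k\<close>-subset: \<open>x\<^sub>j\<close> acts on the rank one module as \<open>t\<close> to the power \<open>H j - H (j - 1)\<close>.\<close>

definition hgt :: "(int \<Rightarrow> int) \<Rightarrow> int set \<Rightarrow> bool" where
  "hgt H I \<longleftrightarrow> (\<forall>j. H j - H (j - 1) = (if c j \<in> I then 0 else 1)) \<and> (\<forall>j. H (j + int n) = H j + int (n - k))"

lemma hgt_step: "hgt H I \<Longrightarrow> H (j + 1) = H j + (if c (j + 1) \<in> I then 0 else 1)"
proof -
  assume "hgt H I"
  then have "H (j + 1) - H (j + 1 - 1) = (if c (j + 1) \<in> I then 0 else 1)" unfolding hgt_def by blast
  then show ?thesis by simp
qed

lemma cyc_eq: "c j = j - int n * ((j - 1) div int n)"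
  unfolding cyc_def by (simp add: minus_mult_div_eq_mod[symmetric] algebra_simps)

lemma hgt_shift:
  assumes "hgt H I"
  shows "H (j + int n * z) = H j + int (n - k) * z"
proof (induction z rule: int_induct[where k = 0])
  case (step1 i)
  have "H (j + int n * i + int n) = H (j + int n * i) + int (n - k)" using assms by (simp add: hgt_def)
  then show ?case using step1 by (simp add: algebra_simps)
next
  case (step2 i)
  have "H (j + int n * (i - 1) + int n) = H (j + int n * (i - 1)) + int (n - k)" using assms by (simp add: hgt_def)
  then show ?case using step2 by (simp add: algebra_simps)
qed simp

lemma hgt_diff_cyc: "hgt H I \<Longrightarrow> hgt H' I' \<Longrightarrow> H' (c j) - H (c j) = H' j - H j"
  using hgt_shift[of H I j "- ((j - 1) div int n)"] hgt_shift[of H' I' j "- ((j - 1) div int n)"]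
  by (simp add: cyc_eq)

text \<open>Along x the exponent of t is the rise of \<open>H\<close>; along y it is the number of
  steps that are not rises, since xy = t at every step.\<close>

lemma rank_one_paths:
  assumes H: "hgt H I" and j: "j \<in> V"
  shows "H j \<le> H (j + int p) \<and> XP (rank_one I) j p = scal (fps_X ^ nat (H (j + int p) - H j)) (idn (Suc 0))"
    and "H j - H (j - int p) \<le> int p \<and>
      YP (rank_one I) j p = scal (fps_X ^ nat (int p - (H j - H (j - int p)))) (idn (Suc 0))"
proof (induction p)
  case 0
  show "H j \<le> H (j + int 0) \<and> XP (rank_one I) j 0 = scal (fps_X ^ nat (H (j + int 0) - H j)) (idn (Suc 0))"
    "H j - H (j - int 0) \<le> int 0 \<and>
      YP (rank_one I) j 0 = scal (fps_X ^ nat (int 0 - (H j - H (j - int 0)))) (idn (Suc 0))"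
    using j by (simp_all add: XP_simps rank_one_simps scal_ring)
next
  case (Suc p)
  have s: "H (j + int (Suc p)) = H (j + int p) + (if c (j + int p + 1) \<in> I then 0 else 1)"
    using hgt_step[OF H, of "j + int p"] by (simp add: algebra_simps)
  show "H j \<le> H (j + int (Suc p)) \<and>
      XP (rank_one I) j (Suc p) = scal (fps_X ^ nat (H (j + int (Suc p)) - H j)) (idn (Suc 0))"
  proof (intro conjI)
    show "H j \<le> H (j + int (Suc p))" using s Suc(1) by simp
    have "XP (rank_one I) j (Suc p) = X (rank_one I) (c (j + int p + 1)) * XP (rank_one I) j p"
      using j by (simp add: XP_simps)
    also have "\<dots> = scal (fps_X ^ nat (H (j + int (Suc p)) - H j)) (idn (Suc 0))"
    proof (cases "c (j + int p + 1) \<in> I")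
      case True
      then show ?thesis using Suc(1) s by (simp add: rank_one_simps scal_mult_right)
    next
      case False
      then have "nat (H (j + int (Suc p)) - H j) = Suc (nat (H (j + int p) - H j))"
        using Suc(1) s by (intro nat_eq_Suc) simp_all
      then show ?thesis using Suc(1) False by (simp add: rank_one_simps scal_mult_left scal_mult_right scal_ring)
    qed
    finally show "XP (rank_one I) j (Suc p) = scal (fps_X ^ nat (H (j + int (Suc p)) - H j)) (idn (Suc 0))" .
  qed
  have s: "H (j - int p) = H (j - int (Suc p)) + (if c (j - int p) \<in> I then 0 else 1)"
    using hgt_step[OF H, of "j - int (Suc p)"] by (simp add: algebra_simps)
  show "H j - H (j - int (Suc p)) \<le> int (Suc p) \<and>
      YP (rank_one I) j (Suc p) = scal (fps_X ^ nat (int (Suc p) - (H j - H (j - int (Suc p))))) (idn (Suc 0))"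
  proof (intro conjI)
    show "H j - H (j - int (Suc p)) \<le> int (Suc p)" using s Suc(2) by (simp split: if_splits)
    have "YP (rank_one I) j (Suc p) = Y (rank_one I) (c (j - int p)) * YP (rank_one I) j p"
      using j by (simp add: XP_simps)
    also have "\<dots> = scal (fps_X ^ nat (int (Suc p) - (H j - H (j - int (Suc p))))) (idn (Suc 0))"
    proof (cases "c (j - int p) \<in> I")
      case False
      then show ?thesis using Suc(2) s by (simp add: rank_one_simps scal_mult_right)
    next
      case True
      then have "nat (int (Suc p) - (H j - H (j - int (Suc p)))) = Suc (nat (int p - (H j - H (j - int p))))"
        using Suc(2) s by (intro nat_eq_Suc) simp_all
      then show ?thesis using Suc(2) True
        by (simp add: rank_one_simps scal_mult_left scal_mult_right scal_ring del: nat_diff_distrib)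
    qed
    finally show "YP (rank_one I) j (Suc p) = scal (fps_X ^ nat (int (Suc p) - (H j - H (j - int (Suc p))))) (idn (Suc 0))" .
  qed
qed

lemma cm_rank_one: "hgt H I \<Longrightarrow> cm k n (rank_one I)"
  unfolding cm_iff
proof (intro conjI ballI pre_rank_one)
  fix j assume H: "hgt H I" and j: "j \<in> V"
  \<comment> \<open>Over a full period \<open>H\<close> rises by \<open>n - k\<close>, which equates
    the exponents of x^k and y^(n-k).\<close>
  have "H (j - int (n - k) + int n) = H (j - int (n - k)) + int (n - k)" using H unfolding hgt_def by blast
  moreover have "j - int (n - k) + int n = j + int k" using k_less by (simp add: of_nat_diff)
  ultimately have "H (j + int k) = H (j - int (n - k)) + int (n - k)" by simp
  then show "defect (rank_one I) j = 0"
    using rank_one_paths[OF H j, of k] rank_one_paths(2)[OF H j, of "n - k"] by (simp add: defect_def)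
qed

text \<open>After lifting the vertices to the integers and placing the generator at \<open>j\<close>
  at the power -\<open>H j\<close> of t among the Laurent series, x becomes the identity and this
  map an inclusion. Therefore such maps compose strictly.\<close>

definition can :: "(int \<Rightarrow> int) \<Rightarrow> (int \<Rightarrow> int) \<Rightarrow> zfam" where
  "can H H' = (\<lambda>j. if j \<in> V then scal (fps_X ^ nat (H' j - H j)) (idn (Suc 0)) else 0)"

lemma can_hom:
  assumes "hgt H I" "hgt H' I'" "\<And>j. H j \<le> H' j"
  shows "hom (rank_one I) (rank_one I') (can H H')"
proof -
  have "can H H' * X (rank_one I) = X (rank_one I') * sh (can H H')"
  proof
    fix j show "(can H H' * X (rank_one I)) j = (X (rank_one I') * sh (can H H')) j"
    proof (cases "j \<in> V")
      case True
      have e: "H' (c (j - 1)) - H (c (j - 1)) = H' (j - 1) - H (j - 1)" using hgt_diff_cyc assms by blast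
      have s: "H j = H (j - 1) + (if j \<in> I then 0 else 1)" "H' j = H' (j - 1) + (if j \<in> I' then 0 else 1)"
        using hgt_step[OF assms(1), of "j - 1"] hgt_step[OF assms(2), of "j - 1"] True by (simp_all add: cyc_id)
      have le: "H j \<le> H' j" "H (j - 1) \<le> H' (j - 1)" using assms(3) by auto
      define p where "p = nat (H' j - H j)"
      define q where "q = nat (H' (j - 1) - H (j - 1))"
      have pq: "(if j \<in> I then p else Suc p) = (if j \<in> I' then q else Suc q)"
      proof -
        have "int p = H' j - H j" "int q = H' (j - 1) - H (j - 1)" using le by (simp_all add: p_def q_def)
        then show ?thesis using s by (cases "j \<in> I"; cases "j \<in> I'") simp_all
      qed
      have "can H H' j = scal (fps_X ^ p) (idn (Suc 0))" "sh (can H H') j = scal (fps_X ^ q) (idn (Suc 0))"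
        using True by (simp_all add: can_def sh_def e p_def q_def)
      then have "(can H H' * X (rank_one I)) j = scal (fps_X ^ (if j \<in> I then p else Suc p)) (idn (Suc 0))"
        "(X (rank_one I') * sh (can H H')) j = scal (fps_X ^ (if j \<in> I' then q else Suc q)) (idn (Suc 0))"
        using True by (simp_all add: rank_one_simps scal_mult_left scal_mult_right scal_ring mult.commute)
      then show ?thesis by (simp only: pq)
    qed (simp add: can_def rank_one_simps)
  qed
  moreover have "zmap (rank_one I) (rank_one I') (can H H')"
    unfolding zmap_def by (intro conjI ext; simp add: can_def rank_one_simps scal_mult_left scal_mult_right)
  ultimately show ?thesis by (simp add: hom_def)
qed

lemma can_comp:
  assumes "\<And>j. H j \<le> H' j" "\<And>j. H' j \<le> H'' j"
  shows "can H' H'' * can H H' = can H H''"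
proof
  fix j
  have "nat (H'' j - H j) = nat (H'' j - H' j) + nat (H' j - H j)" using assms[of j] by simp
  then show "(can H' H'' * can H H') j = can H H'' j"
    by (simp add: can_def scal_mult_left scal_mult_right scal_ring power_add mult.commute)
qed

lemma can_self: "can H H = one (rank_one I)"
  by (rule ext) (simp add: can_def rank_one_simps scal_ring)

text \<open>Where the heights meet the canonical map is the identity, so \<open>f\<close> is a
  multiple of it at that vertex and, by \<open>hom_ext\<close>, everywhere.\<close>

lemma hom_scalar:
  assumes H: "hgt H I" "hgt H' I'" "\<And>j. H j \<le> H' j" and j0: "H j0 = H' j0"
    and f: "hom (rank_one I) (rank_one I') f"
  shows "\<exists>a. f = sc a (can H H')"
proof -
  let ?j = "c j0"
  have "H' ?j = H ?j" using hgt_diff_cyc[OF H(1,2), of j0] j0 by simp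
  then have can0: "can H H' ?j = idn (Suc 0)" by (simp add: can_def scal_ring)
  have "(one (rank_one I') * f) ?j = f ?j" "(f * one (rank_one I)) ?j = f ?j" using homD[OF f] by simp_all
  then have "f ?j = scal (ent (f ?j) 0 0) (idn (Suc 0))" by (intro one_by_one) (simp_all add: rank_one_simps)
  then have "f ?j = sc (ent (f ?j) 0 0) (can H H') ?j" using can0 by simp
  then have "f = sc (ent (f ?j) 0 0) (can H H')"
    by (rule hom_ext[OF pre_rank_one pre_rank_one f hom_sc[OF can_hom[OF H]] cyc_in])
  then show ?thesis by blast
qed

lemma sc_can_eq:
  assumes "sc a (can H H') = sc b (can H H')"
  shows "a = b"
proof -
  have "sc a (can H H') (c 1) = sc b (can H H') (c 1)" by (simp only: assms)
  then show ?thesis by (simp add: can_def scal_ring)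
qed

text \<open>If \<open>f\<close> lands in the module of height \<open>H'\<close>, lower than \<open>H\<close> somewhere, then \<open>f\<close> is not a unit
  multiple of the canonical rational map, hence neither is its composite with a canonical map.\<close>

lemma can_factor_dvd:
  assumes H: "hgt H I" "hgt Q J" and le: "\<And>j. Q j \<le> H' j" "H j \<le> H' j" and less: "Q j1 < H j1"
    and H': "hgt H' I'" and f: "hom (rank_one I) (rank_one J) f" and a: "can Q H' * f = sc a (can H H')"
    and le2: "\<And>j. H j \<le> H' j"
  shows "fps_X dvd a"
proof -
  let ?j = "c j1"
  have lt: "Q ?j < H ?j" using hgt_diff_cyc[OF H, of j1] less by simp
  have "(one (rank_one J) * f) ?j = f ?j" "(f * one (rank_one I)) ?j = f ?j" using homD[OF f] by simp_all
  then obtain b where b: "f ?j = scal b (idn (Suc 0))" using one_by_one by (metis cyc_in rank_one_simps(1) times_fun_apply)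
  have "(can Q H' * f) ?j = sc a (can H H') ?j" by (simp only: a)
  then have "fps_X ^ nat (H' ?j - Q ?j) * b = a * fps_X ^ nat (H' ?j - H ?j)"
    by (simp add: can_def b scal_mult_left scal_mult_right scal_ring mult.commute)
  moreover have "nat (H' ?j - Q ?j) = nat (H' ?j - H ?j) + Suc (nat (H ?j - Q ?j - 1))"
    using lt le(1)[of ?j] le2[of ?j] by simp
  ultimately have "fps_X ^ nat (H' ?j - H ?j) * (fps_X ^ Suc (nat (H ?j - Q ?j - 1)) * b) = fps_X ^ nat (H' ?j - H ?j) * a"
    by (simp add: power_add mult.assoc mult.commute mult.left_commute)
  then have "a = fps_X * (fps_X ^ nat (H ?j - Q ?j - 1) * b)" by (simp add: mult.assoc)
  then show ?thesis by simp
qed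

end

text \<open>\<open>cnt n P x\<close> counts the integers in \<open>{1..P} + n \<int>\<close> that are at most \<open>x\<close>, normalised by \<open>cnt n P 0 = 0\<close>.\<close>

definition cnt :: "int \<Rightarrow> int \<Rightarrow> int \<Rightarrow> int" where
  "cnt n P x = P * (x div n) + min P (x mod n)"

lemma cnt_period: "0 < n \<Longrightarrow> cnt n P (x + n) = cnt n P x + P"
  by (simp add: cnt_def algebra_simps)

lemma cnt_small: "0 \<le> x \<Longrightarrow> x \<le> n \<Longrightarrow> P \<le> n \<Longrightarrow> 0 < n \<Longrightarrow> 0 \<le> P \<Longrightarrow> cnt n P x = min P x"
  by (cases "x = n") (auto simp: cnt_def)

lemma cnt_step:
  assumes "0 < n" "0 \<le> P" "P \<le> n"
  shows "cnt n P x - cnt n P (x - 1) = (if (x - 1) mod n < P then 1 else 0)"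
proof -
  define d where "d = (x - 1) div n"
  define r where "r = (x - 1) mod n"
  have r: "0 \<le> r" "r < n" using assms by (simp_all add: r_def)
  have "x - 1 = n * d + r" unfolding d_def r_def by simp
  then have x: "x = n * d + (r + 1)" by simp
  have c1: "cnt n P (x - 1) = P * d + min P r" by (simp add: cnt_def d_def r_def)
  show ?thesis
  proof (cases "r = n - 1")
    case True
    then have "x = n * (d + 1)" using x by (simp add: algebra_simps)
    then have "x div n = d + 1" "x mod n = 0" using assms by simp_all
    then have "cnt n P x = P * d + P" using assms by (simp add: cnt_def algebra_simps)
    then show ?thesis using c1 True assms r_def by auto
  next
    case False
    then have "x mod n = r + 1" "x div n = d" using r x by simp_all
    then show ?thesis using c1 r unfolding r_def[symmetric] by (simp add: cnt_def)
  qed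
qed

lemma cnt_mono_nat: "0 < n \<Longrightarrow> 0 \<le> P \<Longrightarrow> P \<le> n \<Longrightarrow> cnt n P x \<le> cnt n P (x + int d)"
proof (induction d)
  case (Suc d)
  then show ?case using cnt_step[of n P "x + int d + 1"] by (simp add: algebra_simps split: if_splits)
qed simp

lemma cnt_mono: "0 < n \<Longrightarrow> 0 \<le> P \<Longrightarrow> P \<le> n \<Longrightarrow> x \<le> y \<Longrightarrow> cnt n P x \<le> cnt n P y"
  using cnt_mono_nat[of n P x "nat (y - x)"] by simp

text \<open>No integer is counted in the gap that follows block number \<open>z\<close>, so the
  count is constant there; \<open>z = -1\<close> gives 0 in the gap before the block
  \<open>{1..P}\<close>.\<close>

lemma cnt_flat:
  assumes "0 < n" "0 \<le> P" "P \<le> n" "P + n * z \<le> x" "x \<le> n + n * z"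
  shows "cnt n P x = P * (z + 1)"
proof -
  have shift: "cnt n P (y + n * z) = cnt n P y + P * z" for y
    using assms(1) by (simp add: cnt_def algebra_simps)
  show ?thesis using shift[of "x - n * z"] cnt_small[of "x - n * z" n P] assms by (simp add: algebra_simps)
qed

section \<open>Enough projectives, and projectives are injective\<close>

context quiver
begin

lemma itv_exists:
  obtains I where "itv a I" "cm k n (rank_one I)"
proof -
  let ?I = "{j \<in> V. (j - a - 1) mod int n < int k}"
  have "hgt (\<lambda>j. j - cnt (int n) (int k) (j - a)) ?I"
    unfolding hgt_def
  proof (intro conjI allI)
    fix j
    have "(c j - a - 1) mod int n = (j - a - 1) mod int n"
      by (simp add: cyc_def algebra_simps) (simp add: mod_diff_left_eq mod_diff_right_eq algebra_simps mod_add_left_eq)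
    then show "j - cnt (int n) (int k) (j - a) - (j - 1 - cnt (int n) (int k) (j - 1 - a)) = (if c j \<in> ?I then 0 else 1)"
      using cnt_step[of "int n" "int k" "j - a"] k_less k_pos by (simp add: algebra_simps)
    show "j + int n - cnt (int n) (int k) (j + int n - a) = j - cnt (int n) (int k) (j - a) + int (n - k)"
      using cnt_period[of "int n" "int k" "j - a"] k_less by (simp add: algebra_simps of_nat_diff)
  qed
  then show ?thesis using that[of ?I] cm_rank_one by (auto simp: itv_def)
qed

text \<open>An element of \<open>Q\<close> at the vertex \<open>a\<close> is a one-column matrix
  \<open>m\<close>. Each listed element costs one projective generated at its vertex. The empty list
  receives the zero map from an arbitrary one, so that the induction has a module to start
  from.\<close>

lemma free_cover:
  assumes Q: "cm k n Q" and "finite S"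
    and "\<And>a m. (a, m) \<in> S \<Longrightarrow> a \<in> V \<and> one Q a * m = m \<and> m * idn (Suc 0) = m"
  shows "\<exists>F g. proj F \<and> inj_mod F \<and> hom F Q g \<and>
    (\<forall>(a, m)\<in>S. \<exists>e. one F a * e = e \<and> e * idn (Suc 0) = e \<and> g a * e = m)"
  using assms(2,3)
proof (induction S)
  case empty
  obtain I where I: "itv 1 I" "cm k n (rank_one I)" by (rule itv_exists)
  have "1 \<in> V" using k_less by (simp add: verts_def)
  moreover have "hom (rank_one I) Q 0" by simp
  ultimately show ?case using itv_proj[OF I(1) _ I(2)] by blast
next
  case (insert x S)
  obtain a m where x: "x = (a, m)" by force
  have am: "a \<in> V" "one Q a * m = m" "m * idn (Suc 0) = m" using insert.prems[of a m] x by auto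
  obtain F g where F: "proj F" "inj_mod F" "hom F Q g"
    and surj0: "\<forall>(a, m)\<in>S. \<exists>e. one F a * e = e \<and> e * idn (Suc 0) = e \<and> g a * e = m"
    using insert.IH[OF insert.prems[OF insertI2]] by blast
  have surj: "\<exists>e. one F a * e = e \<and> e * idn (Suc 0) = e \<and> g a * e = m" if "(a, m) \<in> S" for a m
    using bspec[OF surj0 that] by simp
  obtain I where I: "itv a I" "cm k n (rank_one I)" by (rule itv_exists)
  note P = itv_proj[OF I(1) am(1) I(2)]
  obtain h where h: "hom (rank_one I) Q h" "h a = m" using hom_from_itv[OF Q I(1) am] by blast
  let ?P = "rank_one I"
  note D = cm_dsum[OF proj_cm[OF P(1)] proj_cm[OF F(1)]]
  let ?g = "h * pr1 ?P F + g * pr2 ?P F"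
  have g: "hom (dsum n ?P F) Q ?g" using D h F by (auto intro!: hom_add hom_mult)
  have g1: "?g * in1 ?P F = h" "?g * in2 ?P F = g"
    by (simp_all add: distrib_right mult.assoc dsum_simps(1-4) homD[OF h(1)] homD[OF F(3)])
  have d: "one (dsum n ?P F) * in1 ?P F = in1 ?P F" "one (dsum n ?P F) * in2 ?P F = in2 ?P F"
    by (simp_all add: dsum_one)
  have "\<exists>e. one (dsum n ?P F) b * e = e \<and> e * idn (Suc 0) = e \<and> ?g b * e = m'" if "(b, m') \<in> insert x S" for b m'
  proof (cases "(b, m') \<in> S")
    case True
    then obtain e where e: "one F b * e = e" "e * idn (Suc 0) = e" "g b * e = m'" using surj by blast
    have "(one (dsum n ?P F) * in2 ?P F) b * e = in2 ?P F b * e" "(?g * in2 ?P F) b * e = m'"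
      unfolding d g1 using e by auto
    then show ?thesis using e by (intro exI[of _ "in2 ?P F b * e"]) (auto simp: mult.assoc)
  next
    case False
    then have b: "b = a" "m' = m" using that x by auto
    let ?e = "in1 ?P F a * idn (Suc 0)"
    have "(one (dsum n ?P F) * in1 ?P F) a * idn (Suc 0) = ?e" "(?g * in1 ?P F) a * idn (Suc 0) = m"
      unfolding d g1 using h am by auto
    then show ?thesis using b by (intro exI[of _ ?e]) (auto simp: mult.assoc)
  qed
  then show ?case using g proj_dsum[OF P(1) F(1)] inj_dsum[OF P(2) F(2)] by blast
qed

lemma enough_projectives:
  assumes Q: "cm k n Q"
  shows "\<exists>K i F g. proj F \<and> inj_mod F \<and> sexact K i F g Q"
proof -
  let ?S = "SIGMA a:V. (\<lambda>l. munit l 0) ` {..<rk Q a}"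
  have "finite ?S" by (auto simp: verts_def)
  moreover have "a \<in> V \<and> one Q a * m = m \<and> m * idn (Suc 0) = m" if "(a, m) \<in> ?S" for a m
    using that by (auto simp: one_def)
  ultimately obtain F g where F: "proj F" "inj_mod F" "hom F Q g"
    and surj0: "\<forall>(a, m)\<in>?S. \<exists>e. one F a * e = e \<and> e * idn (Suc 0) = e \<and> g a * e = m"
    using free_cover[OF Q, of ?S] by blast
  have surj: "\<exists>e. one F a * e = e \<and> e * idn (Suc 0) = e \<and> g a * e = m" if "(a, m) \<in> ?S" for a m
    using bspec[OF surj0 that] by simp
  have "\<exists>e. one F a * e = e \<and> e * idn (Suc 0) = e \<and> g a * e = munit l 0" if "a \<in> V" "l < rk Q a" for a l
    by (rule surj) (use that in auto)
  then obtain e where e: "\<And>a l. a \<in> V \<Longrightarrow> l < rk Q a \<Longrightarrow> one F a * e a l = e a l \<and> g a * e a l = munit l 0"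
    by metis
  \<comment> \<open>A linear section of \<open>g\<close>: the basis vector \<open>l\<close> at
    \<open>a\<close> goes to its chosen preimage \<open>e a l\<close>.\<close>
  define s where "s = (\<lambda>a. if a \<in> V then (\<Sum>l<rk Q a. e a l * munit 0 l) else 0)"
  have "one F * s = s"
    by (rule ext) (auto simp: s_def sum_distrib_left mult.assoc[symmetric] e intro!: sum.cong)
  moreover have "s * one Q = s"
    by (rule ext) (auto simp: s_def sum_distrib_right mult.assoc one_def intro!: sum.cong)
  moreover have "g * s = one Q"
  proof
    fix a
    have "g a * (e a l * munit 0 l) = munit l l" if "a \<in> V" "l < rk Q a" for l
      using e[OF that] by (simp add: mult.assoc[symmetric])
    then show "(g * s) a = one Q a"
      by (auto simp: s_def one_def sum_distrib_left sum_munit[symmetric] simp del: sum_munit intro!: sum.cong)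
  qed
  ultimately show ?thesis
    using kernel_module[OF proj_cm[OF F(1)] Q F(3), of s] F unfolding zmap_def by blast
qed

text \<open>\<open>Q\<close> is a direct summand of its cover \<open>F\<close>, and \<open>F\<close>
  is a sum of rank one modules that are projective and injective at once.\<close>

lemma proj_inj: "proj Q \<Longrightarrow> inj_mod Q"
  unfolding inj_mod_def
proof (intro conjI allI impI proj_cm)
  fix A f E g C h assume Q: "proj Q" and se: "sexact A f E g C" and h: "hom A Q h"
  obtain K i F p where F: "inj_mod F" "sexact K i F p Q" using enough_projectives[OF proj_cm[OF Q]] by blast
  from F(2) have p: "hom F Q p" by (rule sexactE)
  obtain s where s: "hom Q F s" "p * s = one Q" using proj_lift[OF Q F(2) hom_one[OF cm_pre[OF proj_cm[OF Q]]]] by blast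
  obtain h' where h': "hom E F h'" "h' * f = s * h" using inj_extend[OF F(1) se hom_mult[OF s(1) h]] by blast
  have "(p * h') * f = (p * s) * h" by (simp add: mult.assoc h')
  then have "(p * h') * f = h" using s homD[OF h] by simp
  then show "\<exists>h'. hom E Q h' \<and> h' * f = h" using hom_mult[OF p h'(1)] by blast
qed

end

section \<open>Rank one modules on two cyclic intervals of lengths \<open>P\<close> and
  \<open>q\<close>\<close>

locale two_intervals = quiver k n for k n :: nat +
  fixes P q :: nat
  assumes Pq: "0 < P" "0 < q" "k = P + q"
begin

text \<open>The gap after the first interval is \<open>b - a\<close>, the gap after the second is
  \<open>N - (b - a)\<close>. When one of them closes, the intervals merge into a single one of
  length \<open>k\<close>; this is why \<open>L a a\<close> and \<open>L a (a + N)\<close> are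
  projective.\<close>

definition D :: "int \<Rightarrow> int \<Rightarrow> int set" where
  "D a b = {j \<in> V. (j - a - 1) mod int n < int P \<or> (j - int P - b - 1) mod int n < int q}"

text \<open>Counts, up to a constant, the integers outside both periodic intervals. It is a term in
  \<open>a\<close> plus a term in \<open>b\<close>, which is the content of
  \<open>H_split\<close>.\<close>

definition H :: "int \<Rightarrow> int \<Rightarrow> int \<Rightarrow> int" where
  "H a b j = j - cnt (int n) (int P) (j - a) - cnt (int n) (int q) (j - int P - b)"

definition N :: int where "N = int n - int k"

lemma N: "int n = int P + int q + N" "0 < N"
  using k_less Pq unfolding N_def by auto

abbreviation L :: "int \<Rightarrow> int \<Rightarrow> bmod" where "L a b \<equiv> rank_one (D a b)"

lemma cyc_mod: "(c j - a) mod int n = (j - a) mod int n"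
proof -
  have "c j - a = j - a + int n * (- ((j - 1) div int n))" by (simp add: cyc_eq)
  then show ?thesis by (simp only: mod_mult_self2)
qed

lemma D_disjoint:
  assumes "a \<le> b" "b \<le> a + N" "(j - a - 1) mod int n < int P"
  shows "\<not> (j - int P - b - 1) mod int n < int q"
proof -
  define u where "u = (j - a - 1) mod int n"
  have u: "0 \<le> u" "u < int P" using assms n_pos by (simp_all add: u_def)
  have "(j - int P - b - 1) mod int n = ((j - a - 1) - (int P + (b - a))) mod int n" by (simp add: algebra_simps)
  also have "\<dots> = (u - (int P + (b - a)) + int n) mod int n" by (simp add: u_def mod_diff_left_eq)
  also have "\<dots> = u - (int P + (b - a)) + int n" using u assms N by (intro mod_pos_pos_trivial) auto
  finally show ?thesis using u assms N by simp
qed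

lemma hgt_D:
  assumes "a \<le> b" "b \<le> a + N"
  shows "hgt (H a b) (D a b)"
  unfolding hgt_def
proof (intro conjI allI)
  fix j
  have e: "c j \<in> D a b \<longleftrightarrow> (j - a - 1) mod int n < int P \<or> (j - int P - b - 1) mod int n < int q"
    using cyc_mod[of j "a + 1"] cyc_mod[of j "int P + b + 1"] by (simp add: D_def algebra_simps)
  have le: "int P \<le> int n" "int q \<le> int n" using N by linarith+
  have "cnt (int n) (int P) (j - a) - cnt (int n) (int P) (j - a - 1) = (if (j - a - 1) mod int n < int P then 1 else 0)"
    "cnt (int n) (int q) (j - int P - b) - cnt (int n) (int q) (j - int P - b - 1) = (if (j - int P - b - 1) mod int n < int q then 1 else 0)"
    using cnt_step le n_pos by simp_all
  moreover have "H a b j - H a b (j - 1) = 1 - (cnt (int n) (int P) (j - a) - cnt (int n) (int P) (j - a - 1))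
      - (cnt (int n) (int q) (j - int P - b) - cnt (int n) (int q) (j - int P - b - 1))"
    by (simp add: H_def algebra_simps)
  ultimately show "H a b j - H a b (j - 1) = (if c j \<in> D a b then 0 else 1)"
    using D_disjoint[OF assms, of j] e by auto
  have "cnt (int n) (int P) (j - a + int n) = cnt (int n) (int P) (j - a) + int P"
    "cnt (int n) (int q) (j - int P - b + int n) = cnt (int n) (int q) (j - int P - b) + int q"
    using n_pos by (simp_all add: cnt_period)
  moreover have "j + int n - a = j - a + int n" "j + int n - int P - b = j - int P - b + int n" by simp_all
  moreover have "int (n - k) = int n - int P - int q" using k_less Pq by (simp add: of_nat_diff)
  ultimately show "H a b (j + int n) = H a b j + int (n - k)"
    unfolding H_def by presburger
qed

lemma cm_L: "a \<le> b \<Longrightarrow> b \<le> a + N \<Longrightarrow> cm k n (L a b)"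
  by (rule cm_rank_one[OF hgt_D])

lemma H_mono: "a \<le> a' \<Longrightarrow> b \<le> b' \<Longrightarrow> H a b j \<le> H a' b' j"
proof -
  have le: "int P \<le> int n" "int q \<le> int n" using N by linarith+
  assume "a \<le> a'" "b \<le> b'"
  then have "cnt (int n) (int P) (j - a') \<le> cnt (int n) (int P) (j - a)"
    "cnt (int n) (int q) (j - int P - b') \<le> cnt (int n) (int q) (j - int P - b)"
    using le n_pos by (auto intro!: cnt_mono)
  then show ?thesis by (simp add: H_def)
qed

abbreviation cn :: "int \<Rightarrow> int \<Rightarrow> int \<Rightarrow> int \<Rightarrow> zfam" where
  "cn a b a' b' \<equiv> can (H a b) (H a' b')"

lemma cn_hom: "a \<le> b \<Longrightarrow> b \<le> a + N \<Longrightarrow> a' \<le> b' \<Longrightarrow> b' \<le> a' + N \<Longrightarrow> a \<le> a' \<Longrightarrow> b \<le> b' \<Longrightarrow>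
    hom (L a b) (L a' b') (cn a b a' b')"
  by (intro can_hom hgt_D H_mono)

lemma cn_comp: "a \<le> a' \<Longrightarrow> b \<le> b' \<Longrightarrow> a' \<le> a'' \<Longrightarrow> b' \<le> b'' \<Longrightarrow>
    cn a' b' a'' b'' * cn a b a' b' = cn a b a'' b''"
  by (intro can_comp H_mono)

text \<open>The heights meet at \<open>P + b\<close>: both first intervals have ended there because
  \<open>a' \<le> b\<close>, and neither second interval has begun. The bound
  \<open>b' \<le> b + int n - int q\<close> ensures that the preceding copy of the target's second
  interval has ended too.\<close>

lemma hom_L_scalar:
  assumes "a \<le> b" "b \<le> a + N" "a' \<le> b'" "b' \<le> a' + N" "a \<le> a'" "b \<le> b'" "a' \<le> b" "b' \<le> b + int n - int q"
    and f: "hom (L a b) (L a' b') f"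
  shows "\<exists>z. f = sc z (cn a b a' b')"
proof (rule hom_scalar[OF hgt_D hgt_D H_mono _ f])
  have "cnt (int n) (int P) (int P + b - a) = int P" "cnt (int n) (int P) (int P + b - a') = int P"
    using cnt_flat[of "int n" "int P" 0] assms N by simp_all
  moreover have "cnt (int n) (int q) 0 = 0" "cnt (int n) (int q) (b - b') = 0"
    using cnt_flat[of "int n" "int q" "-1"] assms N by simp_all
  ultimately show "H a b (int P + b) = H a' b' (int P + b)" by (simp add: H_def)
qed (use assms in auto)

lemma itv_shift: "itv (c a) I \<longleftrightarrow> itv a I"
proof -
  have "(j - c a - 1) mod int n = (j - a - 1) mod int n" for j
  proof -
    have "j - c a - 1 = j - a - 1 + int n * ((a - 1) div int n)" by (simp add: cyc_eq)
    then show ?thesis by (simp only: mod_mult_self2)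
  qed
  then show ?thesis by (simp add: itv_def)
qed

lemma proj_L1: "proj (L a a)"
proof -
  have "itv a (D a a)" unfolding itv_def
  proof
    fix j assume j: "j \<in> V"
    define u where "u = (j - a - 1) mod int n"
    have u: "0 \<le> u" "u < int n" using n_pos by (simp_all add: u_def)
    have e: "(j - int P - a - 1) mod int n = (u - int P) mod int n"
      unfolding u_def by (simp add: mod_diff_left_eq algebra_simps)
    have "(u - int P) mod int n = u - int P" if "int P \<le> u" using u that by (intro mod_pos_pos_trivial) auto
    moreover have "j \<in> D a a \<longleftrightarrow> u < int P \<or> (u - int P) mod int n < int q"
      using j e by (simp add: D_def u_def)
    ultimately show "j \<in> D a a \<longleftrightarrow> (j - a - 1) mod int n < int k"
      unfolding u_def[symmetric] using Pq by (cases "int P \<le> u") auto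
  qed
  then show ?thesis using itv_proj[of "c a" "D a a"] cm_L[of a a] N by (simp add: itv_shift)
qed

text \<open>Modulo n the second interval fills the \<open>q\<close> places before the first, so the
  merged interval starts after \<open>a - q\<close>.\<close>

lemma proj_L2: "proj (L a (a + N))"
proof -
  have "itv (a - int q) (D a (a + N))" unfolding itv_def
  proof
    fix j assume j: "j \<in> V"
    define u where "u = (j - (a - int q) - 1) mod int n"
    have u: "0 \<le> u" "u < int n" using n_pos by (simp_all add: u_def)
    have e: "(j - a - 1) mod int n = (u - int q) mod int n"
      unfolding u_def by (simp add: mod_diff_left_eq algebra_simps)
    have "j - int P - (a + N) - 1 = j - (a - int q) - 1 - int n" using N by simp
    then have e': "(j - int P - (a + N) - 1) mod int n = u" unfolding u_def by (simp only: minus_mod_self2)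
    have "(u - int q) mod int n = u - int q" if "int q \<le> u" using u that by (intro mod_pos_pos_trivial) auto
    moreover have "j \<in> D a (a + N) \<longleftrightarrow> (u - int q) mod int n < int P \<or> u < int q"
      using j by (simp add: D_def e e')
    ultimately show "j \<in> D a (a + N) \<longleftrightarrow> (j - (a - int q) - 1) mod int n < int k"
      unfolding u_def[symmetric] using Pq u by (cases "int q \<le> u") auto
  qed
  then show ?thesis using itv_proj[of "c (a - int q)" "D a (a + N)"] cm_L[of a "a + N"] N by (simp add: itv_shift)
qed

end

context quiver
begin

section \<open>Rigidity and triangles\<close>

text \<open>Vanishing of Ext^1 in the form used below, the splitting of all extensions;
  \<open>rigid_iff\<close> relates it to Yoneda classes.\<close>

definition ext0 :: "bmod \<Rightarrow> bmod \<Rightarrow> bool" where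
  "ext0 C A \<longleftrightarrow> (\<forall>u E v. sexact A u E v C \<longrightarrow> (\<exists>s. hom C E s \<and> v * s = one C))"

lemma fm_dsum_in: "fm (dsum_in M N) = in1 M N"
proof (rule ext, rule fmat_eqI)
  fix j i l show "ent (fm (dsum_in M N) j) i l = ent (in1 M N j) i l"
    by (auto simp: fm_def dsum_in_def in1_def one_def ent_emb ent_idn)
qed

lemma fm_dsum_out: "fm (dsum_out M N) = pr2 M N"
proof (rule ext, rule fmat_eqI)
  fix j i l show "ent (fm (dsum_out M N) j) i l = ent (pr2 M N j) i l"
    by (auto simp: fm_def dsum_out_def pr2_def ent_emb ent_unshift)
qed

lemma un_fm:
  assumes "\<And>j. j \<in> V \<Longrightarrow> f j \<in> carrier_mat (rk N j) (rk M j)"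
  shows "j \<in> V \<Longrightarrow> un M N (fm f) j = f j"
  using assms[of j] by (intro eq_matI) (auto simp: un_def fm_def unemb_def ent_emb)

lemma Hom_if_fm:
  assumes c: "\<And>j. j \<in> V \<Longrightarrow> f j \<in> carrier_mat (rk N j) (rk M j)" and "pre M" "pre N" "hom M N (fm f)"
  shows "f \<in> Hom n M N"
  using un_Hom[OF assms(2-4)] un_fm[OF c] unfolding Hom_def by (auto simp: c)

lemma dsum_short_exact:
  assumes "cm k n M" "cm k n N"
  shows "short_exact k n M (dsum_in M N) (dsum n M N) (dsum_out M N) N"
proof -
  note D = cm_dsum[OF assms]
  have "splits M (in1 M N) (dsum n M N) (pr2 M N) N (pr1 M N) (in2 M N)"
    using dsum_zmap by (simp add: splits_def dsum_simps)
  then have "sexact M (in1 M N) (dsum n M N) (pr2 M N) N" using D assms unfolding sexact_def by blast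
  moreover have "dsum_in M N \<in> Hom n M (dsum n M N)" "dsum_out M N \<in> Hom n (dsum n M N) N"
    using D assms by (intro Hom_if_fm; simp add: fm_dsum_in fm_dsum_out cm_pre; simp add: dsum_in_def dsum_out_def dsum_def)+
  ultimately show ?thesis by (simp add: short_exact_iff fm_dsum_in fm_dsum_out)
qed

lemma yoneda_iff:
  "((f, E, g), (f', E', g')) \<in> yoneda_rel k n C A \<longleftrightarrow>
    short_exact k n A f E g C \<and> short_exact k n A f' E' g' C \<and>
    (\<exists>h. hom E E' h \<and> h * fm f = fm f' \<and> fm g' * h = fm g)"
proof (cases "short_exact k n A f E g C \<and> short_exact k n A f' E' g' C")
  case True
  then have H: "f \<in> Hom n A E" "g \<in> Hom n E C" "f' \<in> Hom n A E'" "g' \<in> Hom n E' C"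
    and p: "pre A" "pre C" "pre E" "pre E'" by (auto simp: short_exact_iff sexact_def intro: cm_pre)
  have *: "fam_eq n (h \<circ>\<^sub>f f) f' \<and> fam_eq n (g' \<circ>\<^sub>f h) g \<longleftrightarrow> fm h * fm f = fm f' \<and> fm g' * fm h = fm g"
    if "h \<in> Hom n E E'" for h
    using fam_eq_comp_iff[OF H(1) that H(3)] fam_eq_comp_iff[OF that H(4) H(2)] by simp
  have "(\<exists>h\<in>Hom n E E'. fam_eq n (h \<circ>\<^sub>f f) f' \<and> fam_eq n (g' \<circ>\<^sub>f h) g) \<longleftrightarrow>
      (\<exists>h. hom E E' h \<and> h * fm f = fm f' \<and> fm g' * h = fm g)" (is "?l \<longleftrightarrow> ?r")
  proof
    assume ?l then show ?r using * Hom_hom[OF _ p(3,4)] by blast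
  next
    assume ?r
    then obtain h where h: "hom E E' h" "h * fm f = fm f'" "fm g' * h = fm g" by blast
    then show ?l using *[OF un_Hom[OF p(3,4) h(1)]] un_Hom[OF p(3,4) h(1)] fm_un[OF hom_zmap[OF h(1)]] by auto
  qed
  then show ?thesis using True by (simp add: yoneda_rel_def)
qed (auto simp: yoneda_rel_def)

lemma ext0_retraction:
  assumes "ext0 C A" "sexact A u E v C"
  shows "\<exists>r. hom E A r \<and> r * u = one A"
proof -
  obtain s where s: "hom C E s" "v * s = one C" using assms unfolding ext0_def by blast
  from assms(2) have d: "cm k n E" "hom A E u" "hom E C v" "v * u = 0" by (auto elim: sexactE)
  have "hom E E (one E - s * v)" using d s by (intro hom_diff hom_one hom_mult cm_pre)
  moreover have "v * (one E - s * v) = 0"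
    using homD[OF d(3)] by (simp add: right_diff_distrib s(2)[THEN asc])
  ultimately obtain r where r: "hom E A r" "u * r = one E - s * v" using sexact_lift[OF assms(2) _ _ cm_pre[OF d(1)]] by blast
  have "u * (r * u) = u * one A"
    using homD[OF d(2)] by (simp add: mult.assoc[symmetric] r left_diff_distrib) (simp add: mult.assoc d)
  then have "r * u = one A"
    using sexact_mono[OF assms(2) zmap_mult[OF hom_zmap[OF r(1)] hom_zmap[OF d(2)]] zmap_one] by blast
  then show ?thesis using r by blast
qed

text \<open>If there is only one class, the map from the split extension to a given one carries the
  section along. Conversely, between two split extensions a retraction of the first and a section of
  the second assemble to an equivalence, so every class contains all extensions.\<close>

lemma rigid_iff:
  assumes M: "cm k n M"
  shows "rigid k n M \<longleftrightarrow> ext0 M M"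
proof
  let ?r = "yoneda_rel k n M M" and ?t = "(dsum_in M M, dsum n M M, dsum_out M M)"
  assume R: "rigid k n M"
  show "ext0 M M" unfolding ext0_def
  proof (intro allI impI)
    fix u E v assume se: "sexact M u E v M"
    let ?x = "(un M E u, E, un E M v)"
    note x = sexact_short_exact[OF se]
    from se have uv: "cm k n E" "hom M E u" "hom E M v" by (auto elim: sexactE)
    have "?r `` {?x} \<in> Ext1 k n M M" unfolding Ext1_def by (intro quotientI) (use x in auto)
    then have "?r `` {?x} = ?r `` {?t}" using R by (simp add: rigid_def Ext1_zero_def)
    moreover have "(?x, ?x) \<in> ?r" unfolding yoneda_iff using x uv
      by (intro conjI exI[of _ "one E"]) (auto simp: hom_one cm_pre fm_un hom_zmap homD)
    ultimately have "(?t, ?x) \<in> ?r" by blast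
    then obtain h where h: "hom (dsum n M M) E h" "fm (un E M v) * h = pr2 M M"
      unfolding yoneda_iff fm_dsum_out by blast
    have "v * (h * in2 M M) = one M"
      using h(2) uv by (simp add: fm_un hom_zmap mult.assoc[symmetric] dsum_simps)
    then show "\<exists>s. hom M E s \<and> v * s = one M" using hom_mult[OF h(1)] cm_dsum[OF M M] by blast
  qed
next
  let ?r = "yoneda_rel k n M M" and ?t = "(dsum_in M M, dsum n M M, dsum_out M M)"
  let ?E = "{(f, E, g). short_exact k n M f E g M}"
  assume e: "ext0 M M"
  have "((f, E, g), (f', E', g')) \<in> ?r" if "short_exact k n M f E g M" "short_exact k n M f' E' g' M" for f E g f' E' g'
  proof -
    have se: "sexact M (fm f) E (fm g) M" "sexact M (fm f') E' (fm g') M" using that by (auto simp: short_exact_iff)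
    obtain r where r: "hom E M r" "r * fm f = one M" using ext0_retraction[OF e se(1)] by blast
    obtain s where s: "hom M E' s" "fm g' * s = one M" using e se(2) unfolding ext0_def by blast
    from se have d: "hom M E (fm f)" "hom E M (fm g)" "fm g * fm f = 0" "hom M E' (fm f')" "hom E' M (fm g')" "fm g' * fm f' = 0"
      by (auto elim: sexactE)
    have "hom E E' (fm f' * r + s * fm g)" using r s d by (intro hom_add hom_mult)
    moreover have "(fm f' * r + s * fm g) * fm f = fm f'"
      using homD[OF d(4)] by (simp add: distrib_right mult.assoc r d)
    moreover have "fm g' * (fm f' * r + s * fm g) = fm g"
      using homD[OF d(2)] by (simp add: distrib_left s(2)[THEN asc] d(6)[THEN asc])
    ultimately show ?thesis unfolding yoneda_iff using that by blast
  qed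
  then have all: "?r `` {x} = ?E" if "x \<in> ?E" for x
    using that by (auto simp: yoneda_iff)
  have t: "?t \<in> ?E" using dsum_short_exact[OF M M] by simp
  show "rigid k n M" unfolding rigid_def Ext1_def Ext1_zero_def quotient_def using all t by auto
qed

text \<open>The pushout of the sequence along \<open>h\<close> splits, and a retraction of it is an
  extension of \<open>h\<close>.\<close>

lemma ext0_extend:
  assumes e: "ext0 M N" and se: "sexact A f F g M" and N: "cm k n N" and h: "hom A N h"
  shows "\<exists>h'. hom F N h' \<and> h' * f = h"
proof -
  obtain E u w v where E: "sexact N u E v M" "hom F E w" "w * f = u * h" using pushout[OF se N h] by blast
  obtain r where r: "hom E N r" "r * u = one N" using ext0_retraction[OF e E(1)] by blast
  have "r * w * f = (r * u) * h" by (simp add: mult.assoc E)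
  then have "r * w * f = h" using r homD[OF h] by simp
  then show ?thesis using hom_mult[OF r(1) E(2)] by blast
qed

section \<open>Cones, triangles and splitting off a summand\<close>

definition std_cone :: "bmod \<Rightarrow> zfam \<Rightarrow> bmod \<Rightarrow> zfam \<Rightarrow> bmod \<Rightarrow> bmod \<Rightarrow> zfam \<Rightarrow> bmod \<Rightarrow> zfam \<Rightarrow> zfam \<Rightarrow> zfam \<Rightarrow> bool" where
  "std_cone A i I p S B u C v w h \<longleftrightarrow> inj_mod I \<and> sexact A i I p S \<and> hom A B u \<and> sexact B v C w S \<and>
     hom I C h \<and> h * i = v * u \<and> w * h = p"

text \<open>The class of the extension \<open>A \<rightarrow> B \<oplus> I \<rightarrow> C\<close> is the pullback along \<open>w\<close> of that of
  \<open>A \<rightarrow> I \<rightarrow> S\<close>; rigidity forces its pushout along any \<open>\<psi>\<close> to split.\<close>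

lemma rigid_cone_factor:
  assumes st: "std_cone A i I p S B u C v w h" and M: "cm k n M" "ext0 M M" and inv: "stable_inv M C m d"
    and psi: "hom A M psi"
  shows "\<exists>x y. hom B M x \<and> hom I M y \<and> psi = x * u + y * i"
proof -
  note st' = st[unfolded std_cone_def]
  from st' have se: "sexact A i I p S" "sexact B v C w S" "hom A B u" "hom I C h" "h * i = v * u" "w * h = p" by auto
  from se(1) have cA: "cm k n A" "cm k n I" "hom A I i" "hom I S p" "p * i = 0" by (auto elim: sexactE)
  from se(2) have cB: "cm k n B" "cm k n C" "hom B C v" "hom C S w" "w * v = 0" by (auto elim: sexactE)
  from inv obtain Q e1 e2 where cd: "hom M C m" "hom C M d" "proj Q" "hom C Q e1" "hom Q C e2" "m * d - one C = e2 * e1"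
    unfolding stable_inv_def stable0_def by blast
  \<comment> \<open>\<open>m * d\<close> is the identity of \<open>C\<close> only up to
    \<open>e2 * e1\<close>. Lifting \<open>w * e2\<close> along \<open>p\<close> moves this error
    into \<open>I\<close>, where the pullback can absorb it.\<close>
  obtain e where e: "hom Q I e" "p * e = w * e2" using proj_lift[OF cd(3) se(1) hom_mult[OF cB(4) cd(5)]] by blast
  obtain F f g q where F: "sexact A f F g M" "hom F I q" "q * f = i" "p * q = (w * m) * g"
    and univ: "\<And>L a b. pre L \<Longrightarrow> hom L I a \<Longrightarrow> hom L M b \<Longrightarrow> p * a = (w * m) * b \<Longrightarrow> \<exists>e. hom L F e \<and> q * e = a \<and> g * e = b"
    using pullback[OF se(1) M(1) hom_mult[OF cB(4) cd(1)]] by blast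
  have wcd: "(w * m) * d = w + w * e2 * e1"
  proof -
    have "w * (m * d - one C) = w * (e2 * e1)" by (simp add: cd)
    then show ?thesis using homD[OF cB(4)] by (simp add: right_diff_distrib mult.assoc algebra_simps)
  qed
  have wcdx: "(w * m) * (d * x) = w * x + p * e * e1 * x" for x
  proof -
    have "(w * m) * (d * x) = ((w * m) * d) * x" by (simp add: mult.assoc)
    then show ?thesis unfolding wcd by (simp add: distrib_right mult.assoc e(2)[THEN asc])
  qed
  have "p * (e * e1 * v) = (w * m) * (d * v)" unfolding wcdx cB(5) by (simp add: mult.assoc)
  \<comment> \<open>The maps \<open>v\<close> and \<open>h\<close> into the cone, carried to
    \<open>M\<close> by \<open>d\<close>, lift to the pullback; their components in \<open>I\<close>
    are those forced by the error term.\<close>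
  then obtain b1 where b1: "hom B F b1" "q * b1 = e * e1 * v" "g * b1 = d * v"
    using univ[of B "e * e1 * v" "d * v"] cB cd e by (auto intro: hom_mult cm_pre)
  have "p * (one I + e * e1 * h) = (w * m) * (d * h)"
    unfolding wcdx se(6) using homD[OF cA(4)] by (simp add: distrib_left mult.assoc)
  then obtain i1 where i1: "hom I F i1" "q * i1 = one I + e * e1 * h" "g * i1 = d * h"
    using univ[of I "one I + e * e1 * h" "d * h"] cA cd e se by (auto intro!: hom_mult hom_add hom_one cm_pre)
  have f: "hom A F f" "g * f = 0" using F(1) by (auto elim: sexactE)
  have x: "hom A F (i1 * i - b1 * u - f)" using i1 b1 f se cA by (intro hom_diff hom_mult)
  have "g * (i1 * i - b1 * u - f) = 0"
    by (simp add: right_diff_distrib i1(3)[THEN asc] b1(3)[THEN asc] f mult.assoc se)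
  then obtain y where y: "hom A A y" "f * y = i1 * i - b1 * u - f"
    using sexact_lift[OF F(1) x _ cm_pre[OF cA(1)]] by blast
  \<comment> \<open>Two maps from \<open>A\<close> to \<open>F\<close> are compared,
    \<open>i1 * i - b1 * u\<close> and \<open>f\<close>. Their difference is killed by
    \<open>g\<close>, so it is \<open>f * y\<close>; it is also killed by \<open>q\<close>, and
    \<open>q * f = i\<close> is injective.\<close>
  have "i * y = q * (i1 * i - b1 * u - f)" unfolding y(2)[symmetric] by (simp add: F(3)[THEN asc])
  also have "\<dots> = 0"
    using homD[OF cA(3)] by (simp add: right_diff_distrib i1(2)[THEN asc] b1(2)[THEN asc] F distrib_right mult.assoc se)
  finally have "i * y = i * 0" by simp
  then have "y = 0" using sexact_mono[OF se(1) hom_zmap[OF y(1)] zmap_zero] by blast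
  then have fe: "f = i1 * i - b1 * u" using y(2) by simp
  obtain t where t: "hom F M t" "t * f = psi" using ext0_extend[OF M(2) F(1) M(1) psi] by blast
  have "psi = - (t * b1) * u + (t * i1) * i"
    unfolding t(2)[symmetric] fe by (simp add: right_diff_distrib mult.assoc)
  then show ?thesis using t b1 i1 by (blast intro: hom_mult hom_uminus)
qed

lemma stable0_zero: "stable0 M N 0"
proof -
  obtain I where I: "itv (c 1) I" "cm k n (rank_one I)" by (rule itv_exists)
  then have "stable0 M N (0 * 0)" by (intro stable0I[OF itv_proj(1)[OF I(1) cyc_in I(2)]] hom_zero)
  then show ?thesis by simp
qed

lemma stable_inv_one: "pre M \<Longrightarrow> stable_inv M M (one M) (one M)"
  by (simp add: stable_inv_def hom_one stable0_zero)

lemma std_cone_standard_triangle: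
  assumes st: "std_cone A i I p S B u C v w h"
  shows "standard_triangle k n (un A I i, I, un I S p, S) A (un A B u) B (un B C v) C (un C S w)"
proof -
  note st' = st[unfolded std_cone_def]
  from st' have se: "sexact A i I p S" "sexact B v C w S" "hom A B u" "hom I C h" "h * i = v * u" "w * h = p" "inj_mod I" by auto
  from se(1) have cA: "pre A" "pre I" "pre S" "hom A I i" "hom I S p" by (auto elim: sexactE intro: cm_pre)
  from se(2) have cB: "pre B" "pre C" "hom B C v" "hom C S w" by (auto elim: sexactE intro: cm_pre)
  have f: "fm (un A I i) = i" "fm (un I S p) = p" "fm (un A B u) = u" "fm (un B C v) = v" "fm (un C S w) = w" "fm (un I C h) = h"
    using cA cB se by (simp_all add: fm_un hom_zmap)
  have H: "un A I i \<in> Hom n A I" "un I S p \<in> Hom n I S" "un A B u \<in> Hom n A B" "un B C v \<in> Hom n B C"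
    "un C S w \<in> Hom n C S" "un I C h \<in> Hom n I C" using cA cB se by (auto intro!: un_Hom)
  have "fam_eq n (un I C h \<circ>\<^sub>f un A I i) (un B C v \<circ>\<^sub>f un A B u)"
    unfolding fam_eq_comp2_iff[OF H(1,6,3,4)] f by (rule se)
  moreover have "fam_eq n (un C S w \<circ>\<^sub>f un I C h) (un I S p)"
    unfolding fam_eq_comp_iff[OF H(6,5,2)] f by (rule se)
  ultimately show ?thesis
    unfolding standard_triangle_def suspension_def injective_iff
    using se sexact_short_exact H by auto
qed

text \<open>The comparison with the standard triangle is the identity on \<open>A\<close>, on
  \<open>B\<close> and on the suspension, and \<open>x\<close> on the cone.\<close>

lemma triangleI:
  assumes st: "std_cone A i I p S B u C v w h" and M: "cm k n M" and inv: "stable_inv M C x y"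
  shows "has_triangle k n A B M"
proof -
  note st' = st[unfolded std_cone_def]
  from st' have se: "sexact A i I p S" "sexact B v C w S" "hom A B u" "hom I C h" "h * i = v * u" "w * h = p" "inj_mod I" by auto
  from se(1) have cA: "pre A" "pre I" "pre S" "hom A I i" "hom I S p" by (auto elim: sexactE intro: cm_pre)
  from se(2) have cB: "cm k n B" "cm k n C" "hom B C v" "hom C S w" by (auto elim: sexactE)
  note pB = cm_pre[OF cB(1)] and pC = cm_pre[OF cB(2)] and pM = cm_pre[OF M]
  from inv have xy: "hom M C x" "hom C M y" "stable0 C C (x * y - one C)" unfolding stable_inv_def by auto
  have yv: "hom B M (y * v)" and wx: "hom M S (w * x)" using xy cB by (auto intro: hom_mult)
  have f: "fm (un A I i) = i" "fm (un I S p) = p" "fm (un A B u) = u" "fm (un B C v) = v" "fm (un C S w) = w"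
    "fm (un M C x) = x" "fm (un B M (y * v)) = y * v" "fm (un M S (w * x)) = w * x"
    using cA cB se xy yv wx by (simp_all add: fm_un hom_zmap)
  have H: "un A I i \<in> Hom n A I" "un I S p \<in> Hom n I S" "un A B u \<in> Hom n A B" "un B C v \<in> Hom n B C"
    "un C S w \<in> Hom n C S" "un M C x \<in> Hom n M C" "un B M (y * v) \<in> Hom n B M" "un M S (w * x) \<in> Hom n M S"
    using cA cB se xy yv wx pB pC pM by (auto intro!: un_Hom)
  note idH = fam_id_Hom[OF cA(1)] fam_id_Hom[OF pB] fam_id_Hom[OF cA(2)] fam_id_Hom[OF cA(3)]
  let ?D = "(un A I i, I, un I S p, S)"
  have iso: "stable_iso k n A A (fam_id A)" "stable_iso k n B B (fam_id B)" "stable_iso k n M C (un M C x)"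
    using stable_inv_one[OF cA(1)] stable_inv_one[OF pB] inv idH H(6) cA(1) pB pC pM
    by (auto simp: stable_iso_iff fm_id f)
  have sus: "suspension_map n ?D ?D (fam_id A) (fam_id S)"
    unfolding suspension_map_def
    using idH fam_eq_comp2_iff[OF H(1) idH(3) idH(1) H(1)] fam_eq_comp2_iff[OF H(2) idH(4) idH(3) H(2)] homD[OF cA(4)] homD[OF cA(5)]
    by (auto simp: fm_id f intro!: bexI[of _ "fam_id I"])
  have e1: "stable_eq k n A B (fam_id B \<circ>\<^sub>f un A B u) (un A B u \<circ>\<^sub>f fam_id A)"
    using stable_eq_iff[OF Hom_comp[OF H(3) idH(2)] Hom_comp[OF idH(1) H(3)]] cA pB homD[OF se(3)]
    by (simp add: fm_comp[OF H(3) idH(2)] fm_comp[OF idH(1) H(3)] fm_id f stable0_zero)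
  have "x * (y * v) - v = (x * y - one C) * v" using homD[OF cB(3)] by (simp add: left_diff_distrib mult.assoc)
  then have "stable0 B C (x * (y * v) - v)" using stable0_right[OF xy(3) cB(3)] by simp
  then have e2: "stable_eq k n B C (un M C x \<circ>\<^sub>f un B M (y * v)) (un B C v \<circ>\<^sub>f fam_id B)"
    using stable_eq_iff[OF Hom_comp[OF H(7) H(6)] Hom_comp[OF idH(2) H(4)]] pB pC pM homD[OF cB(3)]
    by (simp add: fm_comp[OF H(7) H(6)] fm_comp[OF idH(2) H(4)] fm_id f)
  have e3: "stable_eq k n M S (fam_id S \<circ>\<^sub>f un M S (w * x)) (un C S w \<circ>\<^sub>f un M C x)"
    using stable_eq_iff[OF Hom_comp[OF H(8) idH(4)] Hom_comp[OF H(6) H(5)]] cA pM pC homD[OF wx]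
    by (simp add: fm_comp[OF H(8) idH(4)] fm_comp[OF H(6) H(5)] fm_id f stable0_zero)
  have "suspension k n A ?D"
    using se sexact_short_exact by (simp add: suspension_def injective_iff)
  then have "triangle k n ?D A (un A B u) B (un B M (y * v)) M (un M S (w * x))"
    unfolding triangle_def using std_cone_standard_triangle[OF st] iso sus e1 e2 e3 H cB M
    by (simp only: prod.case) blast
  then show ?thesis unfolding has_triangle_def by blast
qed

lemma triangleE:
  assumes t: "has_triangle k n A B M" and A: "cm k n A"
  obtains A' i I p S B' u C v w h a a' b b' x y where
    "std_cone A' i I p S B' u C v w h" "stable_inv A A' a a'" "stable_inv B B' b b'" "stable_inv M C x y"
proof -
  obtain D0 u0 v0 w0 where "triangle k n D0 A u0 B v0 M w0" using t unfolding has_triangle_def by blast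
  then obtain i I p S A' u B' v C w a b x where st: "standard_triangle k n (i, I, p, S) A' u B' v C w"
    and iso: "stable_iso k n A A' a" "stable_iso k n B B' b" "stable_iso k n M C x"
    and cm: "cm k n B'" "cm k n C" "cm k n B" "cm k n M"
    unfolding triangle_def by (auto split: prod.splits)
  from st obtain h where d: "inj_mod I" "short_exact k n A' i I p S" "u \<in> Hom n A' B'" "short_exact k n B' v C w S"
    "h \<in> Hom n I C" "fam_eq n (h \<circ>\<^sub>f i) (v \<circ>\<^sub>f u)" "fam_eq n (w \<circ>\<^sub>f h) p"
    unfolding standard_triangle_def suspension_def injective_iff by auto
  from d(2) have 1: "sexact A' (fm i) I (fm p) S" "i \<in> Hom n A' I" "p \<in> Hom n I S" by (auto simp: short_exact_iff)
  from d(4) have 2: "sexact B' (fm v) C (fm w) S" "v \<in> Hom n B' C" "w \<in> Hom n C S" by (auto simp: short_exact_iff)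
  have pr: "pre A'" "pre I" "pre B'" "pre C" "pre A" "pre B" "pre M" using 1 cm A by (auto elim: sexactE intro: cm_pre)
  have "fm h * fm i = fm v * fm u" "fm w * fm h = fm p"
    using d fam_eq_comp2_iff[OF 1(2) d(5) d(3) 2(2)] fam_eq_comp_iff[OF d(5) 2(3) 1(3)] by auto
  then have "std_cone A' (fm i) I (fm p) S B' (fm u) C (fm v) (fm w) (fm h)"
    unfolding std_cone_def using 1 2 d Hom_hom pr by auto
  moreover obtain a' b' y where "stable_inv A A' (fm a) a'" "stable_inv B B' (fm b) b'" "stable_inv M C (fm x) y"
    using iso pr by (auto simp: stable_iso_iff)
  ultimately show ?thesis by (rule that)
qed

lemma isoI:
  assumes "pre M" "pre N" "hom M N f" "hom N M g" "g * f = one M" "f * g = one N"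
  shows "isomorphic n M N"
  unfolding isomorphic_def
proof (intro bexI conjI)
  note H = un_Hom[OF assms(1-3)] un_Hom[OF assms(2,1,4)]
  show "fam_eq n (un N M g \<circ>\<^sub>f un M N f) (fam_id M)" "fam_eq n (un M N f \<circ>\<^sub>f un N M g) (fam_id N)"
    using fam_eq_comp_iff[OF H fam_id_Hom] fam_eq_comp_iff[OF H(2,1) fam_id_Hom] assms
    by (simp_all add: fm_un hom_zmap fm_id)
qed (use assms in \<open>auto intro: un_Hom\<close>)

text \<open>Both composites of \<open>x_j\<close> and \<open>y_j\<close> are t, so
  \<open>x_j\<close> is a square matrix and an object has the same rank at all vertices. In a
  decomposition one summand has rank 0 at one vertex and hence everywhere.\<close>

lemma indecomposable_rank_one: "indecomposable k n (rank_one I)"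
  unfolding indecomposable_def
proof (intro conjI allI impI)
  have v: "1 \<in> V" using k_less by (simp add: verts_def)
  then show "\<not> is_zero n (rank_one I)" by (auto simp: is_zero_def rank_one_def)
  fix M1 M2 assume "cm k n M1 \<and> cm k n M2 \<and> isomorphic n (rank_one I) (dsum n M1 M2)"
  then have M: "cm k n M1" "cm k n M2" and iso: "isomorphic n (rank_one I) (dsum n M1 M2)" by auto
  from iso obtain f g where fg: "f \<in> Hom n (rank_one I) (dsum n M1 M2)" "g \<in> Hom n (dsum n M1 M2) (rank_one I)"
    "fam_eq n (g \<circ>\<^sub>f f) (fam_id (rank_one I))" "fam_eq n (f \<circ>\<^sub>f g) (fam_id (dsum n M1 M2))"
    unfolding isomorphic_def by blast
  have r: "rk M1 j + rk M2 j = 1" if j: "j \<in> V" for j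
  proof (rule square_of_inverse[where x = 1])
    show "f j \<in> carrier_mat (rk M1 j + rk M2 j) 1" "g j \<in> carrier_mat 1 (rk M1 j + rk M2 j)"
      using Hom_carrier[OF fg(1) j] Hom_carrier[OF fg(2) j] by (simp_all add: rank_one_def dsum_def)
    show "f j * g j = 1 \<cdot>\<^sub>m 1\<^sub>m (rk M1 j + rk M2 j)" "g j * f j = 1 \<cdot>\<^sub>m 1\<^sub>m 1"
      using fg(3,4) j by (auto simp: fam_eq_def fcomp_def fam_id_def rank_one_def dsum_def intro!: eq_matI)
  qed simp
  have e: "rk M (c (a + int p)) = rk M (c a)" if "cm k n M" for M a p
  proof (induction p)
    case (Suc p)
    let ?j = "c (a + int (Suc p))"
    have cc: "c (?j - 1) = c (a + int p)" by (simp add: cyc_diff)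
    have "xm M ?j \<in> carrier_mat (rk M ?j) (rk M (c (?j - 1))) \<and> ym M ?j \<in> carrier_mat (rk M (c (?j - 1))) (rk M ?j) \<and>
      xm M ?j * ym M ?j = fps_X \<cdot>\<^sub>m 1\<^sub>m (rk M ?j) \<and> ym M ?j * xm M ?j = fps_X \<cdot>\<^sub>m 1\<^sub>m (rk M (c (?j - 1)))"
      by (rule bspec[OF cm_pre[OF that, unfolded pre_def] cyc_in])
    then have "rk M ?j = rk M (c (?j - 1))" using square_of_inverse[of "xm M ?j" _ _ "ym M ?j" fps_X] by auto
    then show ?case unfolding cc using Suc by simp
  qed simp
  have const: "rk M j = rk M 1" if "cm k n M" "j \<in> V" for M j
  proof -
    have "j = c (1 + int (nat (j - 1)))" using that(2) by (simp add: cyc_id verts_def)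
    then have "rk M j = rk M (c (1 + int (nat (j - 1))))" by simp
    also have "\<dots> = rk M (c 1)" by (rule e[OF that(1)])
    finally show ?thesis using cyc_id[OF v] by simp
  qed
  have "rk M1 1 = 0 \<or> rk M2 1 = 0" using r[OF v] by auto
  then show "is_zero n M1 \<or> is_zero n M2"
    unfolding is_zero_def using const[OF M(1)] const[OF M(2)] by auto
qed

text \<open>\<open>C\<close> is the pushout of \<open>i\<close> and \<open>u\<close>: maps from
  \<open>B\<close> and \<open>I\<close> that agree on \<open>A\<close> extend to it.\<close>

lemma cone_out:
  assumes st: "std_cone A i I p S B u C v w h" and b: "hom B L b" and e: "hom I L e" and eq: "b * u = e * i" and L: "pre L"
  shows "\<exists>f. hom C L f \<and> f * v = b \<and> f * h = e"
proof -
  note st' = st[unfolded std_cone_def]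
  from st' have se: "sexact A i I p S" "sexact B v C w S" "hom A B u" "hom I C h" "h * i = v * u" "w * h = p" by auto
  from se(1) obtain r s where 1: "cm k n I" "hom I S p" "zmap I A r" "zmap S I s" "i * r + s * p = one I" "p * s = one S"
    by (rule sexactE)
  from se(2) obtain r' s' where 2: "cm k n B" "cm k n C" "hom B C v" "hom C S w" "zmap C B r'" "zmap S C s'"
    "r' * v = one B" "v * r' + s' * w = one C" "w * v = 0" by (rule sexactE)
  \<comment> \<open>As a linear map \<open>h * s\<close> is a section of \<open>w\<close>;
    \<open>l\<close> is the complementary projection of \<open>C\<close> onto
    \<open>B\<close>.\<close>
  define l where "l = r' * (one C - h * s * w)"
  have on: "v * one B = v" "one C * v = v" "b * one B = b" "w * one C = w" "one S * w = w" "h * one I = h" "e * one I = e" "one C * h = h" "one B * u = u"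
    using 2 se b e by (simp_all add: homD)
  have vr: "v * r' = one C - s' * w" using 2(8) by (simp add: algebra_simps)
  have "v * l = (one C - s' * w) * (one C - h * s * w)" by (simp add: l_def vr[symmetric] mult.assoc)
  also have "\<dots> = one C - h * s * w"
    using zmapD[OF 2(6)] by (simp add: algebra_simps on on(8)[THEN asc] on(4)[THEN asc] se(6)[THEN asc] 1(6)[THEN asc])
  finally have vl: "v * l + h * s * w = one C" by simp
  have lv: "l * v = one B" by (simp add: l_def left_diff_distrib mult.assoc 2 on)
  have sp: "one I - s * p = i * r" using 1(5) by (simp add: algebra_simps)
  have "l * h = r' * (h * (one I - s * p))"
    by (simp add: l_def algebra_simps on se(6))
  also have "\<dots> = (r' * v) * u * r" unfolding sp by (simp add: se(5)[THEN asc] mult.assoc)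
  finally have lh: "l * h = u * r" by (simp add: 2 on)
  define f where "f = e * s * w + b * l"
  have fv: "f * v = b" by (simp add: f_def distrib_right mult.assoc 2 lv on)
  have "f * h = e * (s * p + i * r)"
    by (simp add: f_def distrib_left distrib_right mult.assoc se lh eq[THEN asc])
  then have fh: "f * h = e" using 1(5) by (simp add: add.commute on)
  have zf: "zmap C L f" unfolding f_def l_def
    by (intro zmap_add zmap_mult[OF zmap_mult[OF hom_zmap[OF e] 1(4)] hom_zmap[OF 2(4)]] zmap_mult[OF hom_zmap[OF b]]
        zmap_mult[OF 2(5)] zmap_diff zmap_one zmap_mult[OF zmap_mult[OF hom_zmap[OF se(4)] 1(4)] hom_zmap[OF 2(4)]])
  have "f * X C = f * (X C * sh (v * l + h * s * w))" unfolding vl by (simp add: X_simps cm_pre[OF 2(2)])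
  also have "\<dots> = f * (X C * sh v) * sh l + f * (X C * sh h) * sh s * sh w"
    by (simp add: sh_simps distrib_left mult.assoc)
  also have "\<dots> = (f * v) * X B * sh l + (f * h) * X I * sh s * sh w"
    by (simp add: hom_comm[OF 2(3), symmetric] hom_comm[OF se(4), symmetric] mult.assoc)
  also have "\<dots> = X L * sh b * sh l + X L * sh e * sh s * sh w"
    unfolding fv fh hom_comm[OF b] hom_comm[OF e] ..
  also have "\<dots> = X L * sh f" by (simp add: f_def sh_simps distrib_left mult.assoc add.commute)
  finally have "hom C L f" using zf by (simp add: hom_def)
  then show ?thesis using fv fh by blast
qed

text \<open>The kernel \<open>K\<close> of \<open>f\<close> is a complement of \<open>L\<close> in
  \<open>M\<close>, so indecomposability forces it to vanish.\<close>

lemma split_summand: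
  assumes M: "cm k n M" "indecomposable k n M" and L: "cm k n L" "\<not> is_zero n L"
    and f: "hom M L f" and s: "hom L M s" and fs: "f * s = one L"
  shows "isomorphic n M L"
proof -
  obtain K i where K: "sexact K i M f L" using kernel_module[OF M(1) L(1) f hom_zmap[OF s] fs] by blast
  then have K': "cm k n K" "hom K M i" "f * i = 0" by (auto elim: sexactE)
  have on: "one L * f = f" "f * one M = f" "one M * s = s" "s * one L = s" "one M * i = i" "i * one K = i"
    using f s K' by (simp_all add: homD)
  have "hom M M (one M - s * f)" using M f s by (intro hom_diff hom_one hom_mult cm_pre)
  moreover have "f * (one M - s * f) = 0" by (simp add: right_diff_distrib on fs[THEN asc])
  ultimately obtain r where r: "hom M K r" "i * r = one M - s * f" using sexact_lift[OF K _ _ cm_pre[OF M(1)]] by blast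
  have "i * (r * i) = i * one K" by (simp add: r(2)[THEN asc] left_diff_distrib mult.assoc K' on)
  then have ri: "r * i = one K"
    using sexact_mono[OF K zmap_mult[OF hom_zmap[OF r(1)] hom_zmap[OF K'(2)]] zmap_one] by blast
  have "i * (r * s) = i * 0" by (simp add: r(2)[THEN asc] left_diff_distrib mult.assoc fs on)
  then have rs: "r * s = 0"
    using sexact_mono[OF K zmap_mult[OF hom_zmap[OF r(1)] hom_zmap[OF s]] zmap_zero] by blast
  note D = cm_dsum[OF L(1) K'(1)]
  have "isomorphic n M (dsum n L K)"
  proof (rule isoI[OF cm_pre[OF M(1)] cm_pre[OF D(1)]])
    show "hom M (dsum n L K) (in1 L K * f + in2 L K * r)" "hom (dsum n L K) M (s * pr1 L K + i * pr2 L K)"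
      using D f r s K' by (auto intro!: hom_add hom_mult)
    show "(s * pr1 L K + i * pr2 L K) * (in1 L K * f + in2 L K * r) = one M"
      using homD[OF r(1)] by (simp add: distrib_left distrib_right mult.assoc dsum_simps(1-4)[THEN asc] on r(2))
    have "(in1 L K * f + in2 L K * r) * (s * pr1 L K + i * pr2 L K) = in1 L K * pr1 L K + in2 L K * pr2 L K"
      by (simp add: distrib_left distrib_right mult.assoc fs[THEN asc] ri[THEN asc] rs[THEN asc] K'(3)[THEN asc] dsum_one)
    then show "(in1 L K * f + in2 L K * r) * (s * pr1 L K + i * pr2 L K) = one (dsum n L K)" by (simp only: dsum_simps)
  qed
  then have "is_zero n K" using M(2) L K' unfolding indecomposable_def by blast
  then have "one K = 0" by (auto simp: one_def is_zero_def fun_eq_iff)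
  then have "i = 0" using on(6) by simp
  then have "s * f = one M" using r(2) by simp
  then show ?thesis using isoI[OF cm_pre[OF M(1)] cm_pre[OF L(1)] f s _ fs] by blast
qed

text \<open>The error made in passing from \<open>A'\<close> to \<open>A\<close> and back factors through a projective, and can be corrected
  because projectives are injective.\<close>

lemma lift_to_injective:
  assumes se: "sexact A' i I p S" and inv: "stable_inv A A' a a'" and cov: "sexact K f F g B" "proj F"
    and ext: "\<And>x. hom K A x \<Longrightarrow> \<exists>y. hom F A y \<and> y * f = x" and h: "hom B S h"
  shows "\<exists>h'. hom B I h' \<and> p * h' = h"
proof -
  from se have 1: "cm k n A'" "cm k n I" "hom A' I i" "hom I S p" "p * i = 0" by (auto elim: sexactE)
  from cov(1) have 2: "cm k n K" "cm k n F" "cm k n B" "hom K F f" "hom F B g" "g * f = 0" by (auto elim: sexactE)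
  from inv obtain Q e1 e2 where aa: "hom A A' a" "hom A' A a'" "proj Q" "hom A' Q e1" "hom Q A' e2" "a * a' - one A' = e2 * e1"
    unfolding stable_inv_def stable0_def by blast
  obtain h1 where h1: "hom F I h1" "p * h1 = h * g" using proj_lift[OF cov(2) se hom_mult[OF h 2(5)]] by blast
  have "p * (h1 * f) = 0" by (simp add: h1(2)[THEN asc] mult.assoc 2)
  then obtain x where x: "hom K A' x" "i * x = h1 * f"
    using sexact_lift[OF se hom_mult[OF h1(1) 2(4)] _ cm_pre[OF 2(1)]] by blast
  obtain y where y: "hom F A y" "y * f = a' * x" using ext[OF hom_mult[OF aa(2) x(1)]] by blast
  obtain z where z: "hom F Q z" "z * f = e1 * x" using inj_extend[OF proj_inj[OF aa(3)] cov(1) hom_mult[OF aa(4) x(1)]] by blast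
  have "(a * a' - one A') * x = e2 * e1 * x" by (simp add: aa)
  then have xe: "x = (a * y - e2 * z) * f"
    using homD[OF x(1)] by (simp add: left_diff_distrib mult.assoc y z algebra_simps)
  \<comment> \<open>Subtracting a map through \<open>i\<close> leaves the composite with
    \<open>p\<close> unchanged. This choice vanishes on \<open>K\<close> and therefore descends to
    \<open>B\<close>.\<close>
  let ?h = "h1 - i * (a * y - e2 * z)"
  have "hom F I ?h" using h1 1 aa y z by (intro hom_diff hom_mult)
  moreover have "?h * f = 0" unfolding left_diff_distrib mult.assoc xe[symmetric, unfolded left_diff_distrib mult.assoc]
    using x(2) xe by (simp add: mult.assoc[symmetric])
  ultimately obtain h' where h': "hom B I h'" "h' * g = ?h" using sexact_colift[OF cov(1) _ _ cm_pre[OF 1(2)]] by blast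
  have "p * h' * g = h * g" by (simp add: mult.assoc h' right_diff_distrib h1 1(5)[THEN asc])
  then have "p * h' = h"
    using sexact_epi[OF cov(1) zmap_mult[OF hom_zmap[OF 1(4)] hom_zmap[OF h'(1)]] hom_zmap[OF h]] by blast
  then show ?thesis using h' by blast
qed

text \<open>A factorisation of \<open>v * m\<close> through a projective extends over the hull
  \<open>P\<close> of \<open>L\<close>. Its image in \<open>S\<close> lifts to \<open>I\<close>, and
  the remainder lifts to \<open>B\<close>. This is exactness of the stable triangle at
  \<open>B\<close>.\<close>

lemma stable0_cone_kernel:
  assumes st: "std_cone A' i I p S B u C v w h" and hull: "sexact L e P q R" "proj P"
    and m: "hom L B m" and vm: "stable0 L C (v * m)"
  shows "\<exists>x y. hom L A' x \<and> stable0 L B y \<and> m = u * x + y"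
proof -
  note st' = st[unfolded std_cone_def]
  from st' have se: "sexact A' i I p S" "sexact B v C w S" "hom A' B u" "hom I C h" "h * i = v * u" "w * h = p" by auto
  from se(1) have 1: "hom A' I i" by (rule sexactE)
  from se(2) have 2: "hom B C v" "hom C S w" "w * v = 0" by (auto elim: sexactE)
  from hull(1) have 3: "cm k n L" "cm k n P" "hom L P e" by (auto elim: sexactE)
  obtain Q b1 b2 where b: "proj Q" "hom L Q b1" "hom Q C b2" "v * m = b2 * b1" using vm unfolding stable0_def by blast
  obtain b' where b': "hom P Q b'" "b' * e = b1" using inj_extend[OF proj_inj[OF b(1)] hull(1) b(2)] by blast
  let ?z = "b2 * b'"
  have z: "hom P C ?z" "?z * e = v * m" using b b' by (auto intro: hom_mult simp: mult.assoc)
  obtain z1 where z1: "hom P I z1" "p * z1 = w * ?z" using proj_lift[OF hull(2) se(1) hom_mult[OF 2(2) z(1)]] by blast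
  have "w * (?z - h * z1) = 0" by (simp add: right_diff_distrib se(6)[THEN asc] z1)
  then obtain z2 where z2: "hom P B z2" "v * z2 = ?z - h * z1"
    using sexact_lift[OF se(2) hom_diff[OF z(1) hom_mult[OF se(4) z1(1)]] _ cm_pre[OF 3(2)]] by blast
  have "p * (z1 * e) = (w * v) * m" by (simp only: z1(2)[THEN asc] mult.assoc z(2)[unfolded mult.assoc])
  then have "p * (z1 * e) = 0" by (simp add: 2)
  then obtain x where x: "hom L A' x" "i * x = z1 * e"
    using sexact_lift[OF se(1) hom_mult[OF z1(1) 3(3)] _ cm_pre[OF 3(1)]] by blast
  have "v * (u * x + z2 * e) = h * (i * x) + (v * z2) * e"
    by (simp add: distrib_left mult.assoc[symmetric] se)
  also have "\<dots> = v * m" unfolding z2(2) x(2) left_diff_distrib z(2) by (simp add: mult.assoc)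
  finally have "u * x + z2 * e = m"
    using sexact_mono[OF se(2) hom_zmap[OF hom_add[OF hom_mult[OF se(3) x(1)] hom_mult[OF z2(1) 3(3)]]] hom_zmap[OF m]] by blast
  then show ?thesis using x(1) stable0I[OF hull(2) 3(3) z2(1)] by metis
qed

text \<open>The map into the injective extends over the hull of its source, so the composite factors
  through the projective \<open>P\<close>.\<close>

lemma inj_stable0:
  assumes hull: "sexact L e P q R" "proj P" and "inj_mod I" "hom L I a" "hom I C b"
  shows "stable0 L C (b * a)"
proof -
  obtain a' where a': "hom P I a'" "a' * e = a" using inj_extend[OF assms(3) hull(1) assms(4)] by blast
  from hull(1) have "hom L P e" by (rule sexactE)
  then have "stable0 L C ((b * a') * e)" using a' assms by (intro stable0I[OF hull(2)] hom_mult)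
  then show ?thesis by (simp add: mult.assoc a')
qed

end

context two_intervals
begin

section \<open>Subsets consisting of two intervals\<close>

lemma H_split: "H a b j + H a' b' j = H a b' j + H a' b j"
  by (simp add: H_def)

text \<open>Moving the first interval to \<open>a'\<close> changes heights only strictly between
  \<open>a\<close> and \<open>a' + P\<close>; moving the second to \<open>b'\<close> only strictly
  between \<open>P + b\<close> and \<open>P + b' + q\<close>. Modulo n these ranges are disjoint
  because \<open>a' \<le> b\<close> and \<open>b' \<le> a + N\<close>.\<close>

lemma H_flat:
  assumes "a \<le> a'" "a' \<le> b" "b \<le> b'" "b' \<le> a + N"
  shows "H a' b j = H a b j \<or> H a b' j = H a b j"
proof -
  define z where "z = (j - a' - int P) div int n"
  have j: "a' + int P + int n * z \<le> j" "j < a' + int P + int n * z + int n"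
    using n_pos pos_mod_sign[OF n_pos, of "j - a' - int P"] pos_mod_bound[OF n_pos, of "j - a' - int P"]
      mult_div_mod_eq[of "int n" "j - a' - int P"] unfolding z_def by linarith+
  show ?thesis
  proof (cases "j \<le> a + int n + int n * z")
    case True
    have "cnt (int n) (int P) (j - a) = int P * (z + 1)" "cnt (int n) (int P) (j - a') = int P * (z + 1)"
      using j True assms N by (intro cnt_flat; linarith)+
    then show ?thesis by (simp add: H_def)
  next
    case False
    have "cnt (int n) (int q) (j - int P - b) = int q * (z + 1)" "cnt (int n) (int q) (j - int P - b') = int q * (z + 1)"
      using j False assms N by (intro cnt_flat; linarith)+
    then show ?thesis by (simp add: H_def)
  qed
qed

text \<open>At each vertex \<open>H_flat\<close> makes one of the two maps out of
  \<open>L a b\<close> the identity. By \<open>H_split\<close> the opposite side of the square is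
  then the identity too, and the other two sides coincide.\<close>

lemma square:
  assumes h: "a \<le> a'" "a' \<le> b" "b \<le> b'" "b' \<le> a + N"
  defines "A \<equiv> L a b'" and "B \<equiv> L a' b"
  shows "sexact (L a b) (in1 A B * cn a b a b' + in2 A B * cn a b a' b) (dsum n A B)
    (cn a b' a' b' * pr1 A B - cn a' b a' b' * pr2 A B) (L a' b')"
    (is "sexact _ ?f _ ?g _")
proof -
  have cmA: "cm k n A" "cm k n B" "cm k n (L a b)" "cm k n (L a' b')" unfolding A_def B_def using h N by (auto intro!: cm_L)
  note Ds = cm_dsum[OF cmA(1,2)]
  have hom: "hom (L a b) A (cn a b a b')" "hom (L a b) B (cn a b a' b)" "hom A (L a' b') (cn a b' a' b')" "hom B (L a' b') (cn a' b a' b')"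
    unfolding A_def B_def using h N by (auto intro!: cn_hom)
  have fg: "hom (L a b) (dsum n A B) ?f" "hom (dsum n A B) (L a' b') ?g"
    using hom Ds by (auto intro!: hom_add hom_diff hom_mult)
  \<comment> \<open>\<open>r\<close> uses the summand onto which \<open>L a b\<close> maps
    identically; \<open>s\<close> uses the other one, with the sign that \<open>?g\<close> has on
    it.\<close>
  define r where "r = (\<lambda>j. if H a b' j = H a b j then pr1 A B j else pr2 A B j)"
  define s where "s = (\<lambda>j. if H a b' j = H a b j then - in2 A B j else in1 A B j)"
  have ds: "pr1 A B j * in1 A B j = one A j" "pr2 A B j * in2 A B j = one B j" "pr1 A B j * in2 A B j = 0" "pr2 A B j * in1 A B j = 0"
    "in1 A B j * pr1 A B j + in2 A B j * pr2 A B j = one (dsum n A B) j" for j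
    using dsum_simps[of A B, THEN fun_cong, of j] by simp_all
  have ones: "one A = one (L a b)" "one B = one (L a b)" "one (L a' b') = one (L a b)"
    by (simp_all add: A_def B_def rank_one_simps)
  have d1: "in1 A B j * one (L a b) j = in1 A B j" "in2 A B j * one (L a b) j = in2 A B j"
    "one (L a b) j * pr1 A B j = pr1 A B j" "one (L a b) j * pr2 A B j = pr2 A B j"
    "one (dsum n A B) j * in1 A B j = in1 A B j" "one (dsum n A B) j * in2 A B j = in2 A B j"
    "pr1 A B j * one (dsum n A B) j = pr1 A B j" "pr2 A B j * one (dsum n A B) j = pr2 A B j" for j
    using dsum_one[where M = A and N = B, THEN fun_cong, of j] unfolding ones by simp_all
  have one1: "one (L a b) j = idn (Suc 0)" if "j \<in> V" for j using that by (simp add: rank_one_simps)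
  have out: "in1 A B j = 0" "in2 A B j = 0" "pr1 A B j = 0" "pr2 A B j = 0" "one M j = 0" "can H1 H2 j = 0"
    if "j \<notin> V" for j M H1 H2
    using that by (simp_all add: in1_def in2_def pr1_def pr2_def one_def can_def)
  have pt: "r j * ?f j = one (L a b) j \<and> ?g j * s j = one (L a b) j \<and> ?f j * r j + s j * ?g j = one (dsum n A B) j" for j
  proof (cases "j \<in> V")
    case True
    show ?thesis
    proof (cases "H a b' j = H a b j")
      case eq: True
      then have "cn a b a b' j = one (L a b) j" "cn a' b a' b' j = one (L a b) j" "cn a b a' b j = cn a b' a' b' j"
        using True H_split[of a b j a' b'] by (simp_all add: can_def rank_one_simps scal_ring)
      moreover have "one (L a b) j * cn a b' a' b' j = cn a b' a' b' j" using True by (simp add: can_def rank_one_simps scal_mult_right)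
      ultimately show ?thesis using eq
        by (simp add: r_def s_def distrib_left distrib_right left_diff_distrib right_diff_distrib mult.assoc
            ds(1-4) ds(1-4)[THEN asc] d1 d1[THEN asc] ones ds(5)[symmetric])
    next
      case neq: False
      then have "H a' b j = H a b j" using H_flat[OF h, of j] by simp
      then have "cn a b a' b j = one (L a b) j" "cn a b' a' b' j = one (L a b) j" "cn a b a b' j = cn a' b a' b' j"
        using True H_split[of a b j a' b'] by (simp_all add: can_def rank_one_simps scal_ring)
      moreover have "one (L a b) j * cn a' b a' b' j = cn a' b a' b' j" using True by (simp add: can_def rank_one_simps scal_mult_right)
      ultimately show ?thesis using neq
        by (simp add: r_def s_def distrib_left distrib_right left_diff_distrib right_diff_distrib mult.assoc
            ds(1-4) ds(1-4)[THEN asc] d1 d1[THEN asc] ones ds(5)[symmetric])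
    qed
  qed (simp add: r_def s_def out)
  have zr: "zmap (dsum n A B) (L a b) r" unfolding zmap_def
    by (intro conjI ext) (auto simp: r_def d1)
  have zs: "zmap (L a' b') (dsum n A B) s" unfolding zmap_def ones
    by (intro conjI ext) (auto simp: s_def d1)
  have "splits (L a b) ?f (dsum n A B) ?g (L a' b') r s"
    unfolding splits_def using zr zs pt ones by (auto simp: fun_eq_iff)
  then show ?thesis unfolding sexact_def using cmA Ds fg by blast
qed

lemma proj_L2': "proj (L (b - N) b)"
  using proj_L2[of "b - N"] by simp

text \<open>A map that factors through a projective lifts to the projective cover of its target, and each of the two
  summands of the cover lies below the source at some vertex.\<close>

lemma stable0_scalar:
  assumes h: "a \<le> a0" "a0 < b" "b \<le> b0" "b0 < a + N"
    and st: "stable0 (L a b) (L a0 b0) (sc z (cn a b a0 b0))"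
  shows "fps_X dvd z"
proof -
  obtain Q e1 e2 where Q: "proj Q" "hom (L a b) Q e1" "hom Q (L a0 b0) e2" "sc z (cn a b a0 b0) = e2 * e1"
    using st unfolding stable0_def by blast
  let ?A = "L (b0 - N) b0" and ?B = "L a0 a0"
  have sq: "sexact (L (b0 - N) a0) (in1 ?A ?B * cn (b0 - N) a0 (b0 - N) b0 + in2 ?A ?B * cn (b0 - N) a0 a0 a0) (dsum n ?A ?B)
    (cn (b0 - N) b0 a0 b0 * pr1 ?A ?B - cn a0 a0 a0 b0 * pr2 ?A ?B) (L a0 b0)"
    using square[of "b0 - N" a0 a0 b0] h by simp
  obtain e where e: "hom Q (dsum n ?A ?B) e" "(cn (b0 - N) b0 a0 b0 * pr1 ?A ?B - cn a0 a0 a0 b0 * pr2 ?A ?B) * e = e2"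
    using proj_lift[OF Q(1) sq Q(3)] by blast
  have cms: "cm k n ?A" "cm k n ?B" using N by (auto intro!: cm_L)
  note Ds = cm_dsum[OF cms]
  define u1 where "u1 = pr1 ?A ?B * e * e1"
  define u2 where "u2 = pr2 ?A ?B * e * e1"
  have u: "hom (L a b) ?A u1" "hom (L a b) ?B u2" unfolding u1_def u2_def using Ds e Q by (auto intro: hom_mult)
  have eq: "sc z (cn a b a0 b0) = cn (b0 - N) b0 a0 b0 * u1 - cn a0 a0 a0 b0 * u2"
    unfolding Q(4) e(2)[symmetric] u1_def u2_def by (simp add: left_diff_distrib mult.assoc)
  have c: "hom ?A (L a0 b0) (cn (b0 - N) b0 a0 b0)" "hom ?B (L a0 b0) (cn a0 a0 a0 b0)" using h N by (auto intro!: cn_hom)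
  have "\<exists>z. f = sc z (cn a b a0 b0)" if "hom (L a b) (L a0 b0) f" for f
    by (rule hom_L_scalar[OF _ _ _ _ _ _ _ _ that]) (use h N in linarith)+
  then obtain z1 z2 where z: "cn (b0 - N) b0 a0 b0 * u1 = sc z1 (cn a b a0 b0)" "cn a0 a0 a0 b0 * u2 = sc z2 (cn a b a0 b0)"
    using hom_mult[OF c(1) u(1)] hom_mult[OF c(2) u(2)] by blast
  have "sc z (cn a b a0 b0) = sc (z1 - z2) (cn a b a0 b0)" using eq unfolding z by (simp add: sc_ring)
  then have zz: "z = z1 - z2" by (rule sc_can_eq)
  have hg: "hgt (H a b) (D a b)" "hgt (H (b0 - N) b0) (D (b0 - N) b0)" "hgt (H a0 a0) (D a0 a0)" "hgt (H a0 b0) (D a0 b0)"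
    using h N by (auto intro!: hgt_D)
  have d1: "fps_X dvd z1"
  proof (rule can_factor_dvd[OF hg(1,2) _ _ _ hg(4) u(1) z(1)])
    \<comment> \<open>At \<open>b0 - N + 1\<close> the first interval of \<open>?A\<close> has begun
      and that of the source has not, since \<open>b0 < a + N\<close>.\<close>
    have "cnt (int n) (int P) (b0 - N + 1 - (b0 - N)) = 1" using cnt_small[of 1 "int n" "int P"] Pq N by simp
    moreover have "cnt (int n) (int P) (b0 - N + 1 - a) = int P * (-1 + 1)"
      using h N Pq by (intro cnt_flat; simp)
    moreover have "cnt (int n) (int q) (b0 - N + 1 - int P - b0) = int q * (-1 + 1)" "cnt (int n) (int q) (b0 - N + 1 - int P - b) = int q * (-1 + 1)"
      using h N Pq by (intro cnt_flat; simp)+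
    ultimately show "H (b0 - N) b0 (b0 - N + 1) < H a b (b0 - N + 1)" by (simp add: H_def)
  qed (use h in \<open>auto intro: H_mono\<close>)
  have d2: "fps_X dvd z2"
  proof (rule can_factor_dvd[OF hg(1,3) _ _ _ hg(4) u(2) z(2)])
    \<comment> \<open>At \<open>P + a0 + 1\<close> the second interval of \<open>?B\<close> has
      begun and that of the source has not, since \<open>a0 < b\<close>.\<close>
    have "cnt (int n) (int P) (int P + a0 + 1 - a0) = int P * (0 + 1)" "cnt (int n) (int P) (int P + a0 + 1 - a) = int P * (0 + 1)"
      using h N Pq by (intro cnt_flat; simp)+
    moreover have "cnt (int n) (int q) (int P + a0 + 1 - int P - a0) = 1" using cnt_small[of 1 "int n" "int q"] Pq N by simp
    moreover have "cnt (int n) (int q) (int P + a0 + 1 - int P - b) = int q * (-1 + 1)"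
      using h N Pq by (intro cnt_flat; simp)
    ultimately show "H a0 a0 (int P + a0 + 1) < H a b (int P + a0 + 1)" by (simp add: H_def)
  qed (use h in \<open>auto intro: H_mono\<close>)
  show ?thesis unfolding zz using d1 d2 by (rule dvd_diff)
qed

text \<open>The kernel of the cover is \<open>L (b - N) a\<close>, and all its maps to \<open>L a b'\<close> factor through the summand
  \<open>L a a\<close> of the cover.\<close>

lemma cover:
  assumes "a \<le> b" "b \<le> a + N"
  shows "\<exists>K f F g. sexact K f F g (L a b) \<and> proj F \<and>
    (\<forall>b' x. a \<le> b' \<longrightarrow> b' \<le> a + N \<longrightarrow> hom K (L a b') x \<longrightarrow> (\<exists>y. hom F (L a b') y \<and> y * f = x))"
proof -
  let ?A = "L (b - N) b" and ?B = "L a a"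
  let ?f = "in1 ?A ?B * cn (b - N) a (b - N) b + in2 ?A ?B * cn (b - N) a a a"
  have sq: "sexact (L (b - N) a) ?f (dsum n ?A ?B) (cn (b - N) b a b * pr1 ?A ?B - cn a a a b * pr2 ?A ?B) (L a b)"
    using square[of "b - N" a a b] assms by simp
  have cms: "cm k n ?A" "cm k n ?B" using N by (auto intro!: cm_L)
  note Ds = cm_dsum[OF cms]
  have "\<exists>y. hom (dsum n ?A ?B) (L a b') y \<and> y * ?f = x" if b': "a \<le> b'" "b' \<le> a + N" and x: "hom (L (b - N) a) (L a b') x" for b' x
  proof -
    obtain z where z: "x = sc z (cn (b - N) a a b')"
      using hom_L_scalar[OF _ _ _ _ _ _ _ _ x] assms b' N by auto
    have c1: "hom ?B (L a b') (cn a a a b')" using b' N by (auto intro!: cn_hom)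
    have c2: "hom (L (b - N) a) ?B (cn (b - N) a a a)" using assms N by (auto intro!: cn_hom)
    have "sc z (cn a a a b') * pr2 ?A ?B * ?f = sc z (cn a a a b' * cn (b - N) a a a)"
      using homD[OF c2] by (simp add: distrib_left mult.assoc dsum_simps(1-4)[THEN asc] sc_mult_left sc_ring)
    also have "\<dots> = x" unfolding z using assms b' by (simp add: cn_comp)
    finally show ?thesis using hom_mult[OF hom_sc[OF c1] Ds(5)] by blast
  qed
  then show ?thesis using sq proj_dsum[OF proj_L2' proj_L1] by blast
qed

text \<open>Lift the cover \<open>F\<close> of the quotient term to \<open>E\<close>. On the kernel
  \<open>K\<close> the lift has values in the submodule \<open>L a b\<close>, and by
  \<open>cover\<close> this restriction extends to \<open>F\<close>. Subtracting the extension lets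
  the lift descend to a section.\<close>

lemma ext0_L: "a \<le> b \<Longrightarrow> b \<le> a + N \<Longrightarrow> ext0 (L a b) (L a b)"
  unfolding ext0_def
proof (intro allI impI)
  fix u E v assume ab: "a \<le> b" "b \<le> a + N" and se: "sexact (L a b) u E v (L a b)"
  obtain K f F g where cov: "sexact K f F g (L a b)" "proj F"
    and ext0: "\<forall>b' x. a \<le> b' \<longrightarrow> b' \<le> a + N \<longrightarrow> hom K (L a b') x \<longrightarrow> (\<exists>y. hom F (L a b') y \<and> y * f = x)"
    using cover[OF ab] by blast
  have ext: "\<exists>y. hom F (L a b) y \<and> y * f = x" if "hom K (L a b) x" for x
    using ext0[rule_format, OF ab that] .
  from se have 1: "cm k n (L a b)" "cm k n E" "hom (L a b) E u" "hom E (L a b) v" "v * u = 0" by (auto elim: sexactE)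
  from cov(1) have 2: "cm k n K" "hom K F f" "hom F (L a b) g" "g * f = 0" by (auto elim: sexactE)
  obtain e where e: "hom F E e" "v * e = g" using proj_lift[OF cov(2) se 2(3)] by blast
  have "v * (e * f) = 0" by (simp add: e(2)[THEN asc] 2)
  then obtain x where x: "hom K (L a b) x" "u * x = e * f"
    using sexact_lift[OF se hom_mult[OF e(1) 2(2)] _ cm_pre[OF 2(1)]] by blast
  obtain y where y: "hom F (L a b) y" "y * f = x" using ext[OF x(1)] by blast
  have "(e - u * y) * f = 0" by (simp add: left_diff_distrib mult.assoc y x)
  then obtain s where s: "hom (L a b) E s" "s * g = e - u * y"
    using sexact_colift[OF cov(1) hom_diff[OF e(1) hom_mult[OF 1(3) y(1)]] _ cm_pre[OF 1(2)]] by blast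
  have "v * s * g = one (L a b) * g"
    using homD[OF 2(3)] by (simp add: mult.assoc s right_diff_distrib e 1(5)[THEN asc])
  then have "v * s = one (L a b)"
    using sexact_epi[OF cov(1) zmap_mult[OF hom_zmap[OF 1(4)] hom_zmap[OF s(1)]] zmap_one] by blast
  then show "\<exists>s. hom (L a b) E s \<and> v * s = one (L a b)" using s by blast
qed

text \<open>\<open>square\<close> for \<open>a, b, b, a + N\<close> is an injective hull of
  \<open>L a b\<close>, and for \<open>a, b, b', a + N\<close> it is the pushed out sequence. The
  cone is therefore \<open>L a (a + N) \<oplus> L b b'\<close>, whose first summand is
  projective.\<close>

lemma cone_exists:
  assumes h: "a < b" "b < b'" "b' < a + N"
  shows "has_triangle k n (L a b) (L a b') (L b b')"
proof -
  let ?A = "L a (a + N)" and ?B = "L b b" and ?C = "L b b'"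
  let ?i = "in1 ?A ?B * cn a b a (a + N) + in2 ?A ?B * cn a b b b"
  let ?p = "cn a (a + N) b (a + N) * pr1 ?A ?B - cn b b b (a + N) * pr2 ?A ?B"
  let ?v = "in1 ?A ?C * cn a b' a (a + N) + in2 ?A ?C * cn a b' b b'"
  let ?w = "cn a (a + N) b (a + N) * pr1 ?A ?C - cn b b' b (a + N) * pr2 ?A ?C"
  let ?h = "in1 ?A ?C * pr1 ?A ?B + in2 ?A ?C * (cn b b b b' * pr2 ?A ?B)"
  have cms: "cm k n ?A" "cm k n ?B" "cm k n ?C" using h N by (auto intro!: cm_L)
  note D1 = cm_dsum[OF cms(1,2)] and D2 = cm_dsum[OF cms(1,3)]
  have c: "hom ?B ?C (cn b b b b')" "hom (L a b) (L a b') (cn a b a b')" "hom (L a b) ?B (cn a b b b)"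
    "hom (L a b) ?A (cn a b a (a + N))" using h N by (auto intro!: cn_hom)
  have s1: "sexact (L a b) ?i (dsum n ?A ?B) ?p (L b (a + N))" using square[of a b b "a + N"] h by simp
  have s2: "sexact (L a b') ?v (dsum n ?A ?C) ?w (L b (a + N))" using square[of a b b' "a + N"] h by simp
  have hh: "hom (dsum n ?A ?B) (dsum n ?A ?C) ?h" using D1 D2 c by (auto intro!: hom_add hom_mult)
  have vu: "?h * ?i = ?v * cn a b a b'"
    using homD[OF c(3)] homD[OF c(4)] h
    by (simp add: distrib_left distrib_right mult.assoc dsum_simps(1-4)[THEN asc] cn_comp)
  have wp: "?w * ?h = ?p"
    using h homD[OF c(1)]
    by (simp add: distrib_left left_diff_distrib mult.assoc dsum_simps(1-4)[THEN asc] dsum_one dsum_one[THEN asc]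
        homD(1)[OF c(1), THEN asc] cn_comp[THEN asc])
  have st: "std_cone (L a b) ?i (dsum n ?A ?B) ?p (L b (a + N)) (L a b') (cn a b a b') (dsum n ?A ?C) ?v ?w ?h"
    unfolding std_cone_def using inj_dsum[OF proj_inj[OF proj_L2] proj_inj[OF proj_L1]] s1 s2 c hh vu wp by blast
  have "in2 ?A ?C * pr2 ?A ?C - one (dsum n ?A ?C) = - (in1 ?A ?C * pr1 ?A ?C)"
    unfolding dsum_simps(5)[symmetric] by simp
  then have "stable_inv ?C (dsum n ?A ?C) (in2 ?A ?C) (pr2 ?A ?C)"
    unfolding stable_inv_def using D2 stable0_uminus[OF stable0I[OF proj_L2 D2(4,2)]]
    by (simp add: dsum_simps(1-4) stable0_zero)
  then show ?thesis using triangleI[OF st cms(3)] by blast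
qed

end

section \<open>Uniqueness of the rigid indecomposable cone\<close>

lemma fps_unit_mod_X:
  fixes z :: "complex fps"
  assumes "fps_X dvd z - 1"
  shows "fps_nth z 0 \<noteq> 0"
proof -
  obtain y where "z - 1 = fps_X * y" using assms by (elim dvdE)
  then have "fps_nth (z - 1) 0 = 0" by simp
  then show ?thesis by simp
qed

context two_intervals
begin

lemma cone_unique:
  assumes h: "a < b" "b < b'" "b' < a + N"
    and M: "cm k n M" "indecomposable k n M" "ext0 M M" and t: "has_triangle k n (L a b) (L a b') M"
  shows "isomorphic n M (L b b')"
proof -
  let ?A = "L a b" and ?B = "L a b'" and ?L = "L b b'"
  have cms: "cm k n ?A" "cm k n ?B" "cm k n ?L" "cm k n (L b b)" using h N by (auto intro!: cm_L)
  obtain A' i I p S B' u C v w g al al' be be' x y where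
    st: "std_cone A' i I p S B' u C v w g" and iA: "stable_inv ?A A' al al'" and iB: "stable_inv ?B B' be be'" and iM: "stable_inv M C x y"
    using triangleE[OF t cms(1)] .
  note st' = st[unfolded std_cone_def]
  from st' have se: "sexact A' i I p S" "sexact B' v C w S" "hom A' B' u" "hom I C g" "g * i = v * u" "w * g = p" "inj_mod I" by auto
  from se(1) have 1: "hom A' I i" "hom I S p" by (auto elim: sexactE)
  from se(2) have 2: "cm k n B'" "cm k n C" "hom B' C v" "hom C S w" "w * v = 0" by (auto elim: sexactE)
  from iA have al: "hom ?A A' al" "hom A' ?A al'" "stable0 ?A ?A (al' * al - one ?A)" "stable0 A' A' (al * al' - one A')"
    by (auto simp: stable_inv_def)
  from iB have be: "hom ?B B' be" "hom B' ?B be'" "stable0 ?B ?B (be' * be - one ?B)" "stable0 B' B' (be * be' - one B')"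
    by (auto simp: stable_inv_def)
  from iM have xy: "hom M C x" "hom C M y" "stable0 C C (x * y - one C)" by (auto simp: stable_inv_def)
  define g0 where "g0 = cn a b a b'"
  define q1 where "q1 = cn a b' b b'"
  have g0: "hom ?A ?B g0" and q1: "hom ?B ?L q1" unfolding g0_def q1_def using h N by (auto intro!: cn_hom)
  have hull: "sexact ?A (in1 (L a (a + N)) (L b b) * cn a b a (a + N) + in2 (L a (a + N)) (L b b) * cn a b b b)
      (dsum n (L a (a + N)) (L b b))
      (cn a (a + N) b (a + N) * pr1 (L a (a + N)) (L b b) - cn b b b (a + N) * pr2 (L a (a + N)) (L b b)) (L b (a + N))"
    "proj (dsum n (L a (a + N)) (L b b))"
    using square[of a b b "a + N"] h proj_dsum[OF proj_L2 proj_L1] by auto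
  have sc_A: "\<exists>z. f = sc z g0" if "hom ?A ?B f" for f
    unfolding g0_def by (rule hom_L_scalar[OF _ _ _ _ _ _ _ _ that]) (use h N in linarith)+
  have sc_end: "\<exists>z. f = sc z (one (L r s))" if "hom (L r s) (L r s) f" "r \<le> s" "s \<le> r + N" for f r s
  proof -
    have "\<exists>z. f = sc z (cn r s r s)"
      by (rule hom_L_scalar[OF _ _ _ _ _ _ _ _ that(1)]) (use that h N in linarith)+
    then show ?thesis unfolding can_self[of _ "D r s"] .
  qed
  have uab: "hom ?A ?B (be' * u * al)" using se al be by (auto intro: hom_mult)
  \<comment> \<open>Transported to \<open>L a b\<close> and \<open>L a b'\<close> by the stable
    isomorphisms, \<open>u\<close> becomes \<open>ta\<close> times the canonical map
    \<open>g0\<close>.\<close>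
  then obtain ta where ta: "be' * u * al = sc ta g0" using sc_A by blast
  have bu: "stable0 ?A B' (u * al - sc ta (be * g0))"
  proof -
    have "(be * be' - one B') * (u * al) = sc ta (be * g0) - u * al"
      using homD[OF se(3)]
      by (simp add: left_diff_distrib mult.assoc ta[unfolded mult.assoc] sc_mult_right homD(1)[OF se(3), THEN asc])
    moreover have "stable0 ?A B' ((be * be' - one B') * (u * al))"
      by (rule stable0_right[OF be(4) hom_mult[OF se(3) al(1)]])
    ultimately have "stable0 ?A B' (- (u * al - sc ta (be * g0)))" by simp
    then show ?thesis using stable0_uminus by fastforce
  qed
  have unit: "\<not> fps_X dvd ta"
  proof
    assume tta: "fps_X dvd ta"
    \<comment> \<open>The route from \<open>A'\<close> back to \<open>L a b\<close>, along
      \<open>g0\<close>, and on through \<open>B'\<close> and \<open>C\<close> to \<open>M\<close>.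
      By rigidity it factors through \<open>u\<close> up to a map through \<open>I\<close>.\<close>
    define psi where "psi = y * v * be * g0 * al'"
    have psi: "hom A' M psi" unfolding psi_def using xy 2 be g0 al by (auto intro!: hom_mult)
    obtain F G where FG: "hom B' M F" "hom I M G" "psi = F * u + G * i"
      using rigid_cone_factor[OF st M(1,3) iM psi] by blast
    define a1 where "a1 = x * F * be"
    have a1: "hom ?B C a1" unfolding a1_def using xy FG be by (auto intro!: hom_mult)
    have ab': "a \<le> b'" "b' \<le> a + N" and ab: "a \<le> b" "b \<le> a + N" using h by auto
    obtain K f Pc r where cov: "sexact K f Pc r ?B" "proj Pc"
      and ext: "\<forall>s x. a \<le> s \<longrightarrow> s \<le> a + N \<longrightarrow> hom K (L a s) x \<longrightarrow> (\<exists>y. hom Pc (L a s) y \<and> y * f = x)"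
      using cover[OF ab'] by blast
    \<comment> \<open>By \<open>ext\<close>, maps from the kernel of the cover of
      \<open>L a b'\<close> to \<open>L a b\<close> extend to the cover; hence \<open>w * a1\<close>
      lifts to \<open>I\<close>, and \<open>a1\<close> comes from a map \<open>b1\<close> into
      \<open>B'\<close> up to a map through \<open>I\<close>.\<close>
    obtain h2 where h2: "hom ?B I h2" "p * h2 = w * a1"
      using lift_to_injective[OF se(1) iA cov ext[rule_format, OF ab] hom_mult[OF 2(4) a1]] by blast
    have "w * (a1 - g * h2) = 0" by (simp add: right_diff_distrib se(6)[THEN asc] h2)
    then obtain b1 where b1: "hom ?B B' b1" "v * b1 = a1 - g * h2"
      using sexact_lift[OF se(2) hom_diff[OF a1 hom_mult[OF se(4) h2(1)]] _ cm_pre[OF cms(2)]] by blast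
    have s1: "stable0 ?A C (x * psi * al - v * be * g0)"
    proof -
      have vb: "hom ?A C (v * be * g0)" using 2 be g0 by (auto intro!: hom_mult)
      have "x * psi * al - v * be * g0 = (x * y - one C) * (v * be * g0 * al' * al) + v * be * g0 * (al' * al - one ?A)"
        using homD[OF vb] homD[OF 2(3)]
        by (simp add: psi_def left_diff_distrib right_diff_distrib mult.assoc homD(1)[OF 2(3), THEN asc] homD(2)[OF g0])
      then show ?thesis
        using stable0_add[OF stable0_right[OF xy(3) hom_mult[OF hom_mult[OF vb al(2)] al(1)]] stable0_left[OF al(3) vb]] by simp
    qed
    have s2: "stable0 ?A C (x * psi * al - sc ta (a1 * g0))"
    proof -
      have xF: "hom B' C (x * F)" "hom I C (x * G)" using xy FG by (auto intro: hom_mult)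
      have "x * psi * al - sc ta (a1 * g0) = x * F * (u * al - sc ta (be * g0)) + x * G * (i * al)"
        by (simp add: FG a1_def left_diff_distrib right_diff_distrib distrib_left distrib_right mult.assoc sc_mult_right)
      then show ?thesis
        using stable0_add[OF stable0_left[OF bu xF(1)] inj_stable0[OF hull se(7) hom_mult[OF 1(1) al(1)] xF(2)]] by simp
    qed
    have s3: "stable0 ?A C (sc ta (a1 * g0) - sc ta (v * b1 * g0))"
    proof -
      have "sc ta (a1 * g0) - sc ta (v * b1 * g0) = g * (sc ta (h2 * g0))"
        unfolding b1(2) by (simp add: left_diff_distrib sc_ring sc_mult_right mult.assoc)
      then show ?thesis using inj_stable0[OF hull se(7) hom_sc[OF hom_mult[OF h2(1) g0]] se(4)] by simp
    qed
    \<comment> \<open>Precomposed with \<open>al\<close> and viewed in \<open>C\<close>,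
      \<open>psi\<close> is stably both \<open>v * be * g0\<close> and \<open>ta\<close> times
      \<open>v * b1 * g0\<close>; so \<open>v * chi\<close> is stably zero.\<close>
    define chi where "chi = be * g0 - sc ta (b1 * g0)"
    have chi: "hom ?A B' chi" unfolding chi_def using be g0 b1 by (auto intro!: hom_diff hom_mult hom_sc)
    have "v * chi = (x * psi * al - sc ta (a1 * g0)) + (sc ta (a1 * g0) - sc ta (v * b1 * g0)) - (x * psi * al - v * be * g0)"
      by (simp add: chi_def right_diff_distrib sc_mult_right mult.assoc)
    then have "stable0 ?A C (v * chi)" using stable0_diff[OF stable0_add[OF s2 s3] s1] by simp
    then obtain ga ze where gz: "hom ?A A' ga" "stable0 ?A B' ze" "chi = u * ga + ze"
      using stable0_cone_kernel[OF st hull chi] by blast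
    \<comment> \<open>Endomorphisms of \<open>L a b\<close> and \<open>L a b'\<close> are scalars.
      The relation for \<open>chi\<close> therefore says that \<open>g0\<close> times
      \<open>1 - ta * (c1 + c2)\<close> is stably zero, which is impossible if t divides
      \<open>ta\<close>.\<close>
    obtain c1 c2 where c12: "be' * b1 = sc c1 (one ?B)" "al' * ga = sc c2 (one ?A)"
      using sc_end[OF hom_mult[OF be(2) b1(1)]] sc_end[OF hom_mult[OF al(2) gz(1)]] h by auto
    have bgz: "be' * u * ga = sc (ta * c2) g0 - be' * u * ((al * al' - one A') * ga)"
    proof -
      have "sc (ta * c2) g0 = sc ta g0 * (al' * ga)"
        unfolding c12 using homD[OF g0] by (simp add: sc_mult_left sc_mult_right sc_ring mult.commute)
      then show ?thesis unfolding ta[symmetric] using homD[OF gz(1)] by (simp add: left_diff_distrib right_diff_distrib mult.assoc)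
    qed
    have b1g: "be' * (b1 * g0) = sc c1 g0" using homD[OF g0] by (simp add: c12(1)[THEN asc] sc_mult_left)
    have "sc (1 - ta * (c1 + c2)) g0 = be' * chi - (be' * be - one ?B) * g0 - sc (ta * c2) g0"
      using homD[OF g0] by (simp add: chi_def left_diff_distrib right_diff_distrib sc_mult_right b1g sc_ring distrib_left mult.assoc)
    also have "\<dots> = be' * ze - (be' * be - one ?B) * g0 - be' * u * ((al * al' - one A') * ga)"
      using bgz by (simp add: gz(3) distrib_left mult.assoc)
    finally have "stable0 ?A ?B (sc (1 - ta * (c1 + c2)) g0)"
      using stable0_diff[OF stable0_diff[OF stable0_left[OF gz(2) be(2)] stable0_right[OF be(3) g0]]
          stable0_left[OF stable0_right[OF al(4) gz(1)] hom_mult[OF be(2) se(3)]]] by simp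
    then have "fps_X dvd 1 - ta * (c1 + c2)" unfolding g0_def by (rule stable0_scalar[rotated 4]) (use h in auto)
    then have "fps_X dvd (1 :: complex fps)" using tta by (metis dvd_add_right_iff dvd_mult2 diff_add_cancel add.commute)
    then show False by simp
  qed
  have "fps_nth ta 0 \<noteq> 0"
  proof
    assume "fps_nth ta 0 = 0"
    then have "ta = fps_X * fps_shift 1 ta" by (cases "ta = 0") (auto simp: fps_eq_iff fps_X_mult_nth)
    then show False using unit by (metis dvd_triv_left)
  qed
  then have tinv: "inverse ta * ta = 1" by (rule inverse_mult_eq_1)
  \<comment> \<open>The composite passes through the projective \<open>L b b\<close>. Hence
    \<open>q1 * be' * u\<close> is stably zero, and \<open>q1 * be'\<close> extends over the cone to
    \<open>F\<close>.\<close>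
  have qg: "q1 * g0 = cn b b b b' * cn a b b b"
    unfolding q1_def g0_def using h by (simp add: cn_comp)
  have "stable0 A' ?L (q1 * be' * u)"
  proof -
    have c: "hom ?A (L b b) (cn a b b b)" "hom (L b b) ?L (cn b b b b')" using h N by (auto intro!: cn_hom)
    have qb: "hom A' ?L (q1 * be' * u)" using q1 be se by (auto intro!: hom_mult)
    have "q1 * be' * u * al = cn b b b b' * sc ta (cn a b b b)"
      using ta qg by (simp add: mult.assoc sc_mult_right)
    then have "stable0 ?A ?L (q1 * be' * u * al)" using stable0I[OF proj_L1 hom_sc[OF c(1)] c(2)] by simp
    from stable0_diff[OF stable0_right[OF this al(2)] stable0_left[OF al(4) qb]]
    show ?thesis using homD[OF se(3)] homD[OF qb] by (simp add: right_diff_distrib mult.assoc)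
  qed
  then obtain Q e1 e2 where Q: "proj Q" "hom A' Q e1" "hom Q ?L e2" "q1 * be' * u = e2 * e1" unfolding stable0_def by blast
  obtain e3 where e3: "hom I Q e3" "e3 * i = e1" using inj_extend[OF proj_inj[OF Q(1)] se(1) Q(2)] by blast
  obtain F where F: "hom C ?L F" "F * v = q1 * be'"
    using cone_out[OF st hom_mult[OF q1 be(2)] hom_mult[OF Q(3) e3(1)] _ pre_rank_one] Q e3 by (auto simp: mult.assoc)
  let ?P1 = "L b b"
  let ?f1 = "in1 ?B ?P1 * cn a b a b' + in2 ?B ?P1 * cn a b b b" and ?g1 = "cn a b' b b' * pr1 ?B ?P1 - cn b b b b' * pr2 ?B ?P1"
  have sq: "sexact ?A ?f1 (dsum n ?B ?P1) ?g1 ?L" using square[of a b b b'] h by simp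
  note D1 = cm_dsum[OF cms(2,4)]
  \<comment> \<open>\<open>v * u\<close> is stably zero and the unit \<open>ta\<close> can be
    divided out. The exact sequence \<open>sq\<close> then makes \<open>v * be\<close> factor stably
    over \<open>q1\<close>, which yields \<open>r\<close>, a map opposite to
    \<open>F\<close>.\<close>
  have "stable0 ?A C (v * be * g0)"
  proof -
    have "v * be * g0 = sc (inverse ta) (g * (i * al) - v * (u * al - sc ta (be * g0)))"
      using tinv by (simp add: right_diff_distrib sc_ring sc_mult_right mult.assoc se(5)[THEN asc])
    moreover have "stable0 ?A C (g * (i * al) - v * (u * al - sc ta (be * g0)))"
      by (rule stable0_diff[OF inj_stable0[OF hull se(7) hom_mult[OF 1(1) al(1)] se(4)] stable0_left[OF bu 2(3)]])
    moreover have "stable0 ?A C (sc z X)" if "stable0 ?A C X" for z X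
    proof -
      have "sc z X = sc z (one C) * X" using homD[OF stable0_hom[OF that]] by (simp add: sc_mult_left)
      then show ?thesis using stable0_left[OF that hom_sc[OF hom_one[OF cm_pre[OF 2(2)]]]] by simp
    qed
    ultimately show ?thesis by simp
  qed
  then obtain Q' d1 d2 where Q': "proj Q'" "hom ?A Q' d1" "hom Q' C d2" "v * be * g0 = d2 * d1" unfolding stable0_def by blast
  obtain d3 where d3: "hom (dsum n ?B ?P1) Q' d3" "d3 * ?f1 = d1" using inj_extend[OF proj_inj[OF Q'(1)] sq Q'(2)] by blast
  let ?R = "v * be * pr1 ?B ?P1 - d2 * d3"
  have R: "hom (dsum n ?B ?P1) C ?R" using 2 be D1 Q' d3 by (auto intro!: hom_diff hom_mult)
  have "?R * ?f1 = v * be * g0 - d2 * (d3 * ?f1)"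
    using homD[OF g0] by (simp add: left_diff_distrib distrib_left mult.assoc dsum_simps(1-4)[THEN asc] g0_def)
  then have "?R * ?f1 = 0" unfolding d3(2) using Q'(4) by simp
  then obtain r where r: "hom ?L C r" "r * ?g1 = ?R" using sexact_colift[OF sq R _ cm_pre[OF 2(2)]] by blast
  have "r * q1 = (r * ?g1) * in1 ?B ?P1"
    using homD[OF q1] by (simp add: left_diff_distrib right_diff_distrib mult.assoc dsum_simps(1-4) q1_def)
  also have "\<dots> = v * be - d2 * (d3 * in1 ?B ?P1)"
    unfolding r(2) using homD[OF be(1)] by (simp add: left_diff_distrib mult.assoc dsum_simps(1-4))
  finally have rq: "r * q1 = v * be - d2 * (d3 * in1 ?B ?P1)" .
  \<comment> \<open>The scalar is compared with 1 after composing with \<open>q1\<close>, where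
    \<open>F * v\<close> and \<open>r * q1\<close> are known up to maps through projectives.\<close>
  obtain z where z: "F * r = sc z (one ?L)" using sc_end[OF hom_mult[OF F(1) r(1)]] h by auto
  have "sc (z - 1) q1 = F * (r * q1) - q1"
    using homD[OF q1] by (simp add: z[THEN asc] sc_mult_left sc_ring)
  also have "\<dots> = q1 * (be' * be - one ?B) - F * d2 * (d3 * in1 ?B ?P1)"
    unfolding rq using homD[OF q1] by (simp add: right_diff_distrib F(2)[THEN asc] mult.assoc)
  finally have "stable0 ?B ?L (sc (z - 1) q1)"
    using stable0_diff[OF stable0_left[OF be(3) q1] stable0I[OF Q'(1) hom_mult[OF d3(1) D1(2)] hom_mult[OF F(1) Q'(3)]]] by simp
  then have z1: "fps_X dvd z - 1" unfolding q1_def by (rule stable0_scalar[rotated 4]) (use h in auto)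
  \<comment> \<open>Passing through \<open>M\<close> inserts \<open>x * y\<close>, which differs
    from the identity of \<open>C\<close> by a stably trivial map; this changes the scalar by a
    multiple of t only.\<close>
  obtain z' where z': "F * (x * y - one C) * r = sc z' (one ?L)"
    using sc_end[OF hom_mult[OF hom_mult[OF F(1) stable0_hom[OF xy(3)]] r(1)]] h by auto
  have "stable0 ?L ?L (sc z' (cn b b' b b'))"
    using stable0_right[OF stable0_left[OF xy(3) F(1)] r(1)] unfolding z' can_self[of _ "D b b'"] .
  then have z2: "fps_X dvd z'" by (rule stable0_scalar[rotated 4]) (use h in auto)
  have "F * x * (y * r) = F * (x * y - one C) * r + F * r"
    using homD[OF r(1)] by (simp add: right_diff_distrib left_diff_distrib mult.assoc)
  then have zz: "F * x * (y * r) = sc (z' + z) (one ?L)" unfolding z z' by (simp add: sc_ring)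
  have "fps_X dvd (z' + z) - 1" using dvd_add[OF z2 z1] by (simp add: algebra_simps)
  \<comment> \<open>The scalar is 1 modulo t, so it is invertible and \<open>L b b'\<close> splits
    off from \<open>M\<close> in the module category itself.\<close>
  then have "inverse (z' + z) * (z' + z) = 1" by (intro inverse_mult_eq_1 fps_unit_mod_X)
  then have "sc (inverse (z' + z)) (F * x) * (y * r) = one ?L"
    by (simp only: sc_mult_left zz sc_ring(5,7))
  moreover have "\<not> is_zero n ?L" using indecomposable_rank_one[of "D b b'"] unfolding indecomposable_def by blast
  ultimately show ?thesis
    using split_summand[OF M(1,2) cms(3) _ hom_sc[OF hom_mult[OF F(1) xy(1)]] hom_mult[OF xy(2) r(1)]] by blast
qed

section \<open>Translation into the cyclic intervals of the statement\<close>

lemma cyc_interval_iff: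
  assumes "0 < m" "m \<le> int n"
  shows "j \<in> cyc_interval n a (a + m - 1) \<longleftrightarrow> j \<in> V \<and> (j - a) mod int n < m"
proof
  assume "j \<in> cyc_interval n a (a + m - 1)"
  then obtain i where i: "j = c i" "a \<le> i" "i \<le> a + m - 1" unfolding cyc_interval_def by auto
  have "(j - a) mod int n = (i - a) mod int n" unfolding i(1) by (rule cyc_mod)
  also have "\<dots> = i - a" using i assms by (intro mod_pos_pos_trivial) auto
  finally show "j \<in> V \<and> (j - a) mod int n < m" using i by simp
next
  assume j: "j \<in> V \<and> (j - a) mod int n < m"
  let ?i = "a + (j - a) mod int n"
  have "j = ?i + int n * ((j - a) div int n)" using mult_div_mod_eq[of "int n" "j - a"] by linarith
  then have "c ?i = c j" using cyc_add_mult by metis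
  then have "j = c ?i" using j cyc_id by simp
  then show "j \<in> cyc_interval n a (a + m - 1)"
    unfolding cyc_interval_def using j n_pos by (intro image_eqI[of _ _ ?i]) auto
qed

lemma D_cyc_interval:
  "D a b = cyc_interval n (a + 1) (a + int P) \<union> cyc_interval n (int P + b + 1) (int P + b + int q)"
proof -
  have "j \<in> cyc_interval n (a + 1) (a + int P) \<longleftrightarrow> j \<in> V \<and> (j - a - 1) mod int n < int P"
    "j \<in> cyc_interval n (int P + b + 1) (int P + b + int q) \<longleftrightarrow> j \<in> V \<and> (j - int P - b - 1) mod int n < int q" for j
    using cyc_interval_iff[of "int P" j "a + 1"] cyc_interval_iff[of "int q" j "int P + b + 1"] Pq N
    by (simp_all add: algebra_simps)
  then show ?thesis unfolding D_def by auto
qed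

text \<open>Both intervals lie in the window from \<open>a + 1\<close> to \<open>a + n\<close>, on
  which \<open>cyc\<close> is injective, and \<open>a \<le> b\<close> keeps them apart.\<close>

lemma card_D:
  assumes "a \<le> b" "b \<le> a + N"
  shows "card (D a b) = k"
proof -
  have "inj_on c {a + 1..a + int n}"
  proof (rule inj_onI)
    fix i j assume ij: "i \<in> {a + 1..a + int n}" "j \<in> {a + 1..a + int n}" "c i = c j"
    have "(c i - (a + 1)) mod int n = (c j - (a + 1)) mod int n" by (simp only: ij(3))
    then have "(i - (a + 1)) mod int n = (j - (a + 1)) mod int n" unfolding cyc_mod .
    moreover have "(i - (a + 1)) mod int n = i - (a + 1)" "(j - (a + 1)) mod int n = j - (a + 1)"
      using ij by (intro mod_pos_pos_trivial; simp)+
    ultimately show "i = j" by simp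
  qed
  moreover have "D a b = c ` ({a + 1..a + int P} \<union> {int P + b + 1..int P + b + int q})"
    unfolding D_cyc_interval cyc_interval_def by (rule image_Un[symmetric])
  moreover have "{a + 1..a + int P} \<union> {int P + b + 1..int P + b + int q} \<subseteq> {a + 1..a + int n}"
    using assms N by auto
  ultimately have "card (D a b) = card ({a + 1..a + int P} \<union> {int P + b + 1..int P + b + int q})"
    by (metis card_image inj_on_subset)
  also have "\<dots> = P + q" using assms by (subst card_Un_disjoint) auto
  finally show ?thesis using Pq by simp
qed

end

text \<open>Replacing \<open>m\<close> by \<open>m - 2 v\<close> moves only the second interval of
  \<open>Jset\<close>, by \<open>v\<close> places. So the two given modules are \<open>L a b\<close>
  and \<open>L a b'\<close> with \<open>b' = b + v\<close>, and \<open>Iset\<close> is the subset of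
  \<open>L b b'\<close>.\<close>

theorem theorem6p6:
  fixes k l n i v :: nat and m :: int
  assumes "k \<ge> 2" and "l \<ge> 1" and "n = k + l + 1"
    and "(i, m) \<in> Gamma_minus k l"
    and "v > 0"
    and "real v \<le> (real_of_int m + 2 * real l + (-1) ^ (i + 1)) / 2"
  shows "\<exists>M.
      (cm k n M \<and> indecomposable k n M \<and> rigid k n M \<and>
        has_triangle k n (Lmod k n i m) (Lmod k n i (m - 2 * int v)) M) \<and>
      (\<forall>M'. cm k n M' \<and> indecomposable k n M' \<and> rigid k n M' \<and>
        has_triangle k n (Lmod k n i m) (Lmod k n i (m - 2 * int v)) M' \<longrightarrow>
        isomorphic n M' M) \<and>
      Iset k n i m v \<subseteq> {1..int n} \<and> card (Iset k n i m v) = k \<and>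
      isomorphic n M (rank_one (Iset k n i m v))"
proof -
  have G: "1 \<le> i" "i \<le> k - 1" "m < 0" "- 2 * int l - 2 \<le> m" "odd i \<Longrightarrow> even m" "even i \<Longrightarrow> odd m"
    using assms(4) by (auto simp: Gamma_minus_def)
  interpret two_intervals k n "k - i" i
    by unfold_locales (use assms G in auto)
  have NN: "N = int l + 1" unfolding N_def using assms by simp
  \<comment> \<open>\<open>x\<close> precedes the first interval of \<open>J\<^sub>i\<^sub>,\<^sub>m\<close>, and \<open>s\<close> is the gap between its two intervals.\<close>
  obtain x s where x: "2 * x = int i - xi' i - 2" and s: "2 * s = int i - m + 1 - (int i - xi' i)"
  proof -
    have "even (int i - xi' i - 2)" "even (int i - m + 1 - (int i - xi' i))"
      using G by (auto simp: xi'_def)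
    then show ?thesis using that by (metis dvdE)
  qed
  have v: "2 * int v \<le> m + 2 * int l + (if even i then - 1 else 1)"
  proof (cases "even i")
    case True
    then have "real_of_int (2 * int v) \<le> real_of_int (m + 2 * int l - 1)" using assms(6) by simp
    then show ?thesis using True by (simp only: of_int_le_iff if_True)
  next
    case False
    then have "real_of_int (2 * int v) \<le> real_of_int (m + 2 * int l + 1)" using assms(6) by simp
    then show ?thesis using False by (simp only: of_int_le_iff if_False)
  qed
  \<comment> \<open>\<open>2 * s\<close> is \<open>- m\<close> for odd \<open>i\<close> and
    \<open>1 - m\<close> for even \<open>i\<close>. In both cases the bound on \<open>v\<close>
    amounts to \<open>s + v \<le> l\<close>, where \<open>N = l + 1\<close>: exactly the strict
    inequality \<open>b' < a + N\<close>.\<close>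
  have s1: "1 \<le> s" "s + int v \<le> int l"
    using s v G(3,5,6) by (cases "even i"; simp add: xi'_def; presburger)+
  have J: "Jset k n i m' = D x (x + r)" if "2 * r = int i - m' + 1 - (int i - xi' i)" for m' r
  proof -
    have "(int i - xi' i) div 2 = x + 1" "(int i - m' - 1) div 2 = x + r" using x that by presburger+
    then show ?thesis unfolding Jset_def D_cyc_interval using G by (simp add: of_nat_diff algebra_simps)
  qed
  have JA: "Lmod k n i m = L x (x + s)" unfolding Lmod_def using J[OF s] by simp
  have JB: "Lmod k n i (m - 2 * int v) = L x (x + s + int v)"
    unfolding Lmod_def using J[of "s + int v" "m - 2 * int v"] s by (simp add: algebra_simps)
  have I: "Iset k n i m v = D (x + s) (x + s + int v)"
  proof -
    have "(int i - m + 1) div 2 = x + s + 1" "(int i - m + 2 * int v - 1) div 2 = x + s + int v" using x s by presburger+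
    then show ?thesis unfolding Iset_def D_cyc_interval using G by (simp add: of_nat_diff algebra_simps)
  qed
  let ?M = "L (x + s) (x + s + int v)"
  have h: "x < x + s" "x + s < x + s + int v" "x + s + int v < x + N" using s1 assms NN by auto
  have cm: "cm k n ?M" by (rule cm_L) (use h in auto)
  have ext: "ext0 ?M ?M" by (rule ext0_L) (use h in auto)
  show ?thesis unfolding JA JB I
  proof (intro exI[of _ ?M] conjI allI impI)
    show "cm k n ?M" by (rule cm)
    show "indecomposable k n ?M" by (rule indecomposable_rank_one)
    show "rigid k n ?M" using rigid_iff[OF cm] ext by simp
    show "has_triangle k n (L x (x + s)) (L x (x + s + int v)) ?M" by (rule cone_exists[OF h])
    show "isomorphic n M' ?M" if "cm k n M' \<and> indecomposable k n M' \<and> rigid k n M' \<and>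
      has_triangle k n (L x (x + s)) (L x (x + s + int v)) M'" for M'
      using cone_unique[OF h] that rigid_iff by blast
    show "D (x + s) (x + s + int v) \<subseteq> {1..int n}" by (auto simp: D_def verts_def)
    show "card (D (x + s) (x + s + int v)) = k" by (rule card_D) (use h in auto)
    show "isomorphic n ?M ?M"
      by (rule isoI[OF cm_pre[OF cm] cm_pre[OF cm] hom_one hom_one]) (simp_all add: cm_pre[OF cm])
  qed
qed

end
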